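(* Let $\langle \mathcal W_0, \mathcal W_1\rangle$ denote the subalgebra of $\mathcal U^+_q$ generated by $\mathcal W_0, \mathcal W_1$. The multiplication map $$\langle \mathcal W_0,\mathcal W_1\rangle \otimes \mathcal Z \to \mathcal U^+_q, \qquad w \otimes z \mapsto wz$$ is an algebra isomorphism.
   Context: Let $\mathbb F$ be a field and fix a nonzero $q\in\mathbb F$ that is not a root of unity. $\mathbb N=\{0,1,2,\ldots\}$. All algebras are associative, over $\mathbb F$, with multiplicative identity; a subalgebra has the same multiplicative identity as the parent algebra; tensor products are over $\mathbb F$. For elements $X,Y$ of an algebra, $[X,Y]=XY-YX$ and $[X,Y]_q=qXY-q^{-1}YX$. The algebra $\mathcal U^+_q$ is defined by generators (called alternating generators) $\mathcal W_{-k}, \mathcal W_{k+1}, \mathcal G_{k+1}, \mathcal{\tilde G}_{k+1}$ ($k\in\mathbb N$) and the following relations for all $k,\ell\in\mathbb N$: $[\mathcal W_0,\mathcal W_{k+1}]=[\mathcal W_{-k},\mathcal W_1]=(1-q^{-2})(\mathcal{\tilde G}_{k+1}-\mathcal G_{k+1})$; $[\mathcal W_0,\mathcal G_{k+1}]_q=[\mathcal{\tilde G}_{k+1},\mathcal W_0]_q=(q-q^{-1})\mathcal W_{-k-1}$; $[\mathcal G_{k+1},\mathcal W_1]_q=[\mathcal W_1,\mathcal{\tilde G}_{k+1}]_q=(q-q^{-1})\mathcal W_{k+2}$; $[\mathcal W_{-k},\mathcal W_{-\ell}]=0$; $[\mathcal W_{k+1},\mathcal W_{\ell+1}]=0$;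 $[\mathcal W_{-k},\mathcal W_{\ell+1}]+[\mathcal W_{k+1},\mathcal W_{-\ell}]=0$; $[\mathcal W_{-k},\mathcal G_{\ell+1}]+[\mathcal G_{k+1},\mathcal W_{-\ell}]=0$; $[\mathcal W_{-k},\mathcal{\tilde G}_{\ell+1}]+[\mathcal{\tilde G}_{k+1},\mathcal W_{-\ell}]=0$; $[\mathcal W_{k+1},\mathcal G_{\ell+1}]+[\mathcal G_{k+1},\mathcal W_{\ell+1}]=0$; $[\mathcal W_{k+1},\mathcal{\tilde G}_{\ell+1}]+[\mathcal{\tilde G}_{k+1},\mathcal W_{\ell+1}]=0$; $[\mathcal G_{k+1},\mathcal G_{\ell+1}]=0$; $[\mathcal{\tilde G}_{k+1},\mathcal{\tilde G}_{\ell+1}]=0$; $[\mathcal{\tilde G}_{k+1},\mathcal G_{\ell+1}]+[\mathcal G_{k+1},\mathcal{\tilde G}_{\ell+1}]=0$. Also $\mathcal G_0=\mathcal{\tilde G}_0=1$. In $\mathcal U^+_q$ define, for $n\ge1$, $Z^\vee_n=\sum_{k=0}^n\mathcal G_k\mathcal{\tilde G}_{n-k}q^{n-2k}-q\sum_{k=0}^{n-1}\mathcal W_{-k}\mathcal W_{n-k}q^{n-1-2k}$. $\mathcal Z$ denotes the subalgebra of $\mathcal U^+_q$ generated by $\{Z^\vee_n\}_{n=1}^\infty$. *)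

theory Defs
  imports "HOL-Algebra.QuotRing" "HOL-Algebra.Subrings" "HOL-Algebra.Module"
    "HOL-Library.Poly_Mapping"
begin

text \<open>
  The ground field is a type \<open>'a::field\<close>. An associative unital \<open>'a\<close>-algebra with elements of type
  \<open>'b\<close> is a record of type \<open>('a, 'b) module\<close>, read as a (not necessarily commutative) ring with a
  scalar multiplication; the library locale \<open>algebra\<close> is not used because it requires
  commutativity.
\<close>

section \<open>Algebras over a field\<close>

definition subalgebras :: "('a::field, 'b) module \<Rightarrow> 'b set set" where
  "subalgebras A = {K. subring K A \<and> (\<forall>c. \<forall>x\<in>K. c \<odot>\<^bsub>A\<^esub> x \<in> K)}"

definition gen_subalgebra :: "('a::field, 'b) module \<Rightarrow> 'b set \<Rightarrow> ('a, 'b) module" where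
  "gen_subalgebra A S = A\<lparr>carrier := \<Inter>{K \<in> subalgebras A. S \<subseteq> K}\<rparr>"

definition alg_iso :: "('a::field, 'b) module \<Rightarrow> ('a, 'c) module \<Rightarrow> ('b \<Rightarrow> 'c) set" where
  "alg_iso A B =
     {h \<in> ring_iso A B. \<forall>c. \<forall>x\<in>carrier A. h (c \<odot>\<^bsub>A\<^esub> x) = c \<odot>\<^bsub>B\<^esub> h x}"

text \<open>
  \<open>I\<close> is meant to be a two-sided ideal; it is then closed under scalars because \<open>A\<close> is unital.
  The scalar action on cosets follows the pattern of \<^const>\<open>rcoset_mult\<close>.
\<close>
definition alg_quot :: "('a::field, 'b) module \<Rightarrow> 'b set \<Rightarrow> ('a, 'b set) module" where
  "alg_quot A I =
     \<lparr>carrier = carrier (A Quot I), mult = mult (A Quot I), one = one (A Quot I),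
      zero = zero (A Quot I), add = add (A Quot I),
      smult = (\<lambda>c X. \<Union>x\<in>X. I +>\<^bsub>A\<^esub> (c \<odot>\<^bsub>A\<^esub> x))\<rparr>"

text \<open>Formal linear combinations of elements of \<open>M\<close>, with the multiplication of \<open>M\<close> extended bilinearly.\<close>
definition monoid_algebra :: "('m, 'e) monoid_scheme \<Rightarrow> ('a::field, 'm \<Rightarrow>\<^sub>0 'a) module" where
  "monoid_algebra M =
     \<lparr>carrier = {p. Poly_Mapping.keys p \<subseteq> carrier M},
      mult = (\<lambda>p r. \<Sum>x\<in>Poly_Mapping.keys p. \<Sum>y\<in>Poly_Mapping.keys r.
                Poly_Mapping.single (x \<otimes>\<^bsub>M\<^esub> y) (Poly_Mapping.lookup p x * Poly_Mapping.lookup r y)),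
      one = Poly_Mapping.single \<one>\<^bsub>M\<^esub> 1,
      zero = 0,
      add = (+),
      smult = (\<lambda>c. Poly_Mapping.map ((*) c))\<rparr>"

definition free_algebra :: "('a::field, 'g list \<Rightarrow>\<^sub>0 'a) module" where
  "free_algebra = monoid_algebra \<lparr>carrier = UNIV, mult = (@), one = []\<rparr>"

definition free_gen :: "'g \<Rightarrow> ('g list \<Rightarrow>\<^sub>0 'a::field)" where
  "free_gen g = Poly_Mapping.single [g] 1"

definition relation_ideal ::
    "(('g list \<Rightarrow>\<^sub>0 'a::field) \<times> ('g list \<Rightarrow>\<^sub>0 'a)) set \<Rightarrow> ('g list \<Rightarrow>\<^sub>0 'a) set" where
  "relation_ideal R = genideal free_algebra {l \<ominus>\<^bsub>free_algebra\<^esub> r | l r. (l, r) \<in> R}"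

section \<open>Tensor products of algebras\<close>

text \<open>
  \<open>A \<otimes> B\<close> is the vector space with basis \<open>A \<times> B\<close> modulo the span of the bilinearity relations, with
  the product \<open>(a \<otimes> b)(a' \<otimes> b') = aa' \<otimes> bb'\<close>. The latter is induced by the product of the monoid
  algebra of \<open>A \<times> B\<close>, in which the span of the relations is a two-sided ideal.
\<close>
definition tensor_relations ::
    "('a::field, 'b) module \<Rightarrow> ('a, 'c) module \<Rightarrow> ('b \<times> 'c \<Rightarrow>\<^sub>0 'a) set" where
  "tensor_relations A B =
     {Poly_Mapping.single (a \<oplus>\<^bsub>A\<^esub> a', b) 1 - Poly_Mapping.single (a, b) 1
        - Poly_Mapping.single (a', b) 1 | a a' b.
        a \<in> carrier A \<and> a' \<in> carrier A \<and> b \<in> carrier B} \<union>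
     {Poly_Mapping.single (a, b \<oplus>\<^bsub>B\<^esub> b') 1 - Poly_Mapping.single (a, b) 1
        - Poly_Mapping.single (a, b') 1 | a b b'.
        a \<in> carrier A \<and> b \<in> carrier B \<and> b' \<in> carrier B} \<union>
     {Poly_Mapping.single (c \<odot>\<^bsub>A\<^esub> a, b) 1 - Poly_Mapping.single (a, b) c | c a b.
        a \<in> carrier A \<and> b \<in> carrier B} \<union>
     {Poly_Mapping.single (a, c \<odot>\<^bsub>B\<^esub> b) 1 - Poly_Mapping.single (a, b) c | c a b.
        a \<in> carrier A \<and> b \<in> carrier B}"

definition tensor_null ::
    "('a::field, 'b) module \<Rightarrow> ('a, 'c) module \<Rightarrow> ('b \<times> 'c \<Rightarrow>\<^sub>0 'a) set" where
  "tensor_null A B =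
     Modules.module.span (\<lambda>c::'a. Poly_Mapping.map ((*) c)) (tensor_relations A B)"

definition tensor_algebra ::
    "('a::field, 'b) module \<Rightarrow> ('a, 'c) module \<Rightarrow> ('a, ('b \<times> 'c \<Rightarrow>\<^sub>0 'a) set) module" where
  "tensor_algebra A B = alg_quot (monoid_algebra (A \<times>\<times> B)) (tensor_null A B)"

definition pure_tensor ::
    "('a::field, 'b) module \<Rightarrow> ('a, 'c) module \<Rightarrow> 'b \<Rightarrow> 'c \<Rightarrow> ('b \<times> 'c \<Rightarrow>\<^sub>0 'a) set" where
  "pure_tensor A B a b =
     tensor_null A B +>\<^bsub>(monoid_algebra (A \<times>\<times> B) :: ('a, 'b \<times> 'c \<Rightarrow>\<^sub>0 'a) module)\<^esub>
       Poly_Mapping.single (a, b) 1"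

section \<open>The algebra with alternating generators\<close>

text \<open>
  \<open>AltW i\<close> stands for \<open>W\<^sub>i\<close>, where \<open>i\<close> ranges over all integers: \<open>W\<^sub>-\<^sub>k\<close> and \<open>W\<^sub>k\<^sub>+\<^sub>1\<close> with \<open>k \<ge> 0\<close>.
  The indices of the other two families start at 1, so \<open>AltG k\<close> and \<open>AltGt k\<close> stand for
  \<open>G\<^sub>k\<^sub>+\<^sub>1\<close> and its tilde version.
\<close>
datatype alt_gen = AltW int | AltG nat | AltGt nat

definition commutator :: "('a::field, 'b) module \<Rightarrow> 'b \<Rightarrow> 'b \<Rightarrow> 'b" where
  "commutator A x y = (x \<otimes>\<^bsub>A\<^esub> y) \<ominus>\<^bsub>A\<^esub> (y \<otimes>\<^bsub>A\<^esub> x)"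

definition q_commutator :: "'a::field \<Rightarrow> ('a, 'b) module \<Rightarrow> 'b \<Rightarrow> 'b \<Rightarrow> 'b" where
  "q_commutator q A x y =
     (q \<odot>\<^bsub>A\<^esub> (x \<otimes>\<^bsub>A\<^esub> y)) \<ominus>\<^bsub>A\<^esub> (inverse q \<odot>\<^bsub>A\<^esub> (y \<otimes>\<^bsub>A\<^esub> x))"

text \<open>A pair \<open>(l, r)\<close> is the relation \<open>l = r\<close>. The variables \<open>k\<close>, \<open>l\<close> range over the naturals.\<close>
definition alt_relations ::
    "'a::field \<Rightarrow> ((alt_gen list \<Rightarrow>\<^sub>0 'a) \<times> (alt_gen list \<Rightarrow>\<^sub>0 'a)) set" where
  "alt_relations q =
    (let F = free_algebra :: ('a, alt_gen list \<Rightarrow>\<^sub>0 'a) module;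
         C = commutator F;
         Q = q_commutator q F;
         Wm = (\<lambda>k::nat. free_gen (AltW (- int k)));
         Wp = (\<lambda>k::nat. free_gen (AltW (int k + 1)));
         G = (\<lambda>k::nat. free_gen (AltG k));
         Gt = (\<lambda>k::nat. free_gen (AltGt k))
     in
       (\<Union>k.
         {(C (Wm 0) (Wp k), (1 - inverse (q ^ 2)) \<odot>\<^bsub>F\<^esub> (Gt k \<ominus>\<^bsub>F\<^esub> G k)),
          (C (Wm k) (Wp 0), (1 - inverse (q ^ 2)) \<odot>\<^bsub>F\<^esub> (Gt k \<ominus>\<^bsub>F\<^esub> G k)),
          (Q (Wm 0) (G k), (q - inverse q) \<odot>\<^bsub>F\<^esub> Wm (k + 1)),
          (Q (Gt k) (Wm 0), (q - inverse q) \<odot>\<^bsub>F\<^esub> Wm (k + 1)),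
          (Q (G k) (Wp 0), (q - inverse q) \<odot>\<^bsub>F\<^esub> Wp (k + 1)),
          (Q (Wp 0) (Gt k), (q - inverse q) \<odot>\<^bsub>F\<^esub> Wp (k + 1))}) \<union>
       (\<Union>k l.
         {(C (Wm k) (Wm l), \<zero>\<^bsub>F\<^esub>),
          (C (Wp k) (Wp l), \<zero>\<^bsub>F\<^esub>),
          (C (Wm k) (Wp l) \<oplus>\<^bsub>F\<^esub> C (Wp k) (Wm l), \<zero>\<^bsub>F\<^esub>),
          (C (Wm k) (G l) \<oplus>\<^bsub>F\<^esub> C (G k) (Wm l), \<zero>\<^bsub>F\<^esub>),
          (C (Wm k) (Gt l) \<oplus>\<^bsub>F\<^esub> C (Gt k) (Wm l), \<zero>\<^bsub>F\<^esub>),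
          (C (Wp k) (G l) \<oplus>\<^bsub>F\<^esub> C (G k) (Wp l), \<zero>\<^bsub>F\<^esub>),
          (C (Wp k) (Gt l) \<oplus>\<^bsub>F\<^esub> C (Gt k) (Wp l), \<zero>\<^bsub>F\<^esub>),
          (C (G k) (G l), \<zero>\<^bsub>F\<^esub>),
          (C (Gt k) (Gt l), \<zero>\<^bsub>F\<^esub>),
          (C (Gt k) (G l) \<oplus>\<^bsub>F\<^esub> C (G k) (Gt l), \<zero>\<^bsub>F\<^esub>)}))"

type_synonym 'a Uq_elem = "(alt_gen list \<Rightarrow>\<^sub>0 'a) set"

definition Uq :: "'a::field \<Rightarrow> ('a, 'a Uq_elem) module" where
  "Uq q = alg_quot free_algebra (relation_ideal (alt_relations q))"

definition Uq_gen :: "'a::field \<Rightarrow> alt_gen \<Rightarrow> 'a Uq_elem" where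
  "Uq_gen q g =
     relation_ideal (alt_relations q)
       +>\<^bsub>(free_algebra :: ('a, alt_gen list \<Rightarrow>\<^sub>0 'a) module)\<^esub> free_gen g"

definition Uq_W :: "'a::field \<Rightarrow> int \<Rightarrow> 'a Uq_elem" where
  "Uq_W q i = Uq_gen q (AltW i)"

text \<open>In the next two definitions the index is the one of \<open>G\<^sub>n\<close>, with \<open>G\<^sub>0 = 1\<close>.\<close>
definition Uq_G :: "'a::field \<Rightarrow> nat \<Rightarrow> 'a Uq_elem" where
  "Uq_G q n = (case n of 0 \<Rightarrow> \<one>\<^bsub>Uq q\<^esub> | Suc k \<Rightarrow> Uq_gen q (AltG k))"

definition Uq_Gt :: "'a::field \<Rightarrow> nat \<Rightarrow> 'a Uq_elem" where
  "Uq_Gt q n = (case n of 0 \<Rightarrow> \<one>\<^bsub>Uq q\<^esub> | Suc k \<Rightarrow> Uq_gen q (AltGt k))"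

definition Z_vee :: "'a::field \<Rightarrow> nat \<Rightarrow> 'a Uq_elem" where
  "Z_vee q n =
     (\<Oplus>\<^bsub>Uq q\<^esub> k \<in> {0..n}.
        (q powi (int n - 2 * int k)) \<odot>\<^bsub>Uq q\<^esub> (Uq_G q k \<otimes>\<^bsub>Uq q\<^esub> Uq_Gt q (n - k)))
     \<ominus>\<^bsub>Uq q\<^esub>
     q \<odot>\<^bsub>Uq q\<^esub>
       (\<Oplus>\<^bsub>Uq q\<^esub> k \<in> {0..<n}.
          (q powi (int n - 1 - 2 * int k)) \<odot>\<^bsub>Uq q\<^esub>
            (Uq_W q (- int k) \<otimes>\<^bsub>Uq q\<^esub> Uq_W q (int n - int k)))"

definition W01_subalgebra :: "'a::field \<Rightarrow> ('a, 'a Uq_elem) module" where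
  "W01_subalgebra q = gen_subalgebra (Uq q) {Uq_W q 0, Uq_W q 1}"

definition Z_subalgebra :: "'a::field \<Rightarrow> ('a, 'a Uq_elem) module" where
  "Z_subalgebra q = gen_subalgebra (Uq q) {Z_vee q n | n. n \<ge> 1}"

end

theory Submission
  imports Defs "HOL-Computational_Algebra.Formal_Power_Series"
begin

text \<open>
  Collect the generators in the power series
  \<open>W\<^sup>-(t) = \<Sum> W\<^sub>-\<^sub>k t\<^sup>k\<close>, \<open>W\<^sup>+(t) = \<Sum> W\<^sub>k\<^sub>+\<^sub>1 t\<^sup>k\<close>,
  \<open>G(t) = \<Sum> G\<^sub>k t\<^sup>k\<close> and \<open>G'(t) = \<Sum> G'\<^sub>k t\<^sup>k\<close> (\<open>G'\<close> is the family with a tilde), so that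
  \<open>Z(t) = G(t/q) G'(qt) - q t W\<^sup>-(t/q) W\<^sup>+(qt)\<close> is the generating series of the \<open>Z\<^sub>n\<close>, with \<open>Z\<^sub>0 = 1\<close>.
  Three facts about these series give the theorem.

  \<^item> The \<open>Z\<^sub>n\<close> are central (\<open>Z_central\<close>). The relations yield exchange rules between the four series;
    commutation with \<open>W\<^sub>0\<close> and \<open>W\<^sub>1\<close> comes from the case \<open>t = q\<^sup>2 s\<close> of the rule that exchanges a
    \<open>W\<close> and a \<open>G\<close> series, and \<open>[Z(r), G(t)]\<close> vanishes because it is annihilated by \<open>t - q r\<close>.
    All generators arise from \<open>W\<^sub>0\<close>, \<open>W\<^sub>1\<close> and the \<open>G\<^sub>n\<close> by (twisted) commutators.

  \<^item> The relations are homogeneous in the series: if \<open>z(t)\<close> has constant term 1 and central coefficients, then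
    the four products with \<open>z(t)\<close> satisfy the relations again, and \<open>Z(t)\<close> is replaced by
    \<open>Z(t) z(t/q) z(qt)\<close> (\<open>scaled_alternating\<close>, \<open>Z_scaled\<close>).

  \<^item> If all \<open>Z\<^sub>n\<close> lie in a subalgebra that contains \<open>W\<^sub>0\<close> and \<open>W\<^sub>1\<close>, then all generators do
    (\<open>generated_by_W0_W1\<close>): the first relation determines \<open>G'\<^sub>n - G\<^sub>n\<close>, and \<open>Z\<^sub>n\<close> determines
    \<open>q\<^sup>-\<^sup>n G\<^sub>n + q\<^sup>n G'\<^sub>n\<close>. Here \<open>q\<^sup>n + q\<^sup>-\<^sup>n \<noteq> 0\<close> because \<open>q\<close> is not a root of unity.

  Solve \<open>\<zeta>(t/q) \<zeta>(qt) = Z(t)\<close> for a series \<open>\<zeta>\<close> with constant term 1 and coefficients in the algebra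
  generated by the \<open>Z\<^sub>n\<close>. Scaling the generators by \<open>1/\<zeta>(t)\<close> produces a family with \<open>Z(t) = 1\<close>, which therefore
  lies in \<open>\<langle>W\<^sub>0, W\<^sub>1\<rangle>\<close> (\<open>factorization\<close>). In the tensor product of the two subalgebras, scale this
  family by \<open>1 \<otimes> \<zeta>(t)\<close>. The result satisfies the defining relations, so it defines a homomorphism \<open>\<Phi>\<close> from the
  whole algebra to the tensor product. It maps \<open>W\<^sub>0\<close>, \<open>W\<^sub>1\<close> to \<open>W\<^sub>0 \<otimes> 1\<close>, \<open>W\<^sub>1 \<otimes> 1\<close> and
  \<open>Z\<^sub>n\<close> to \<open>1 \<otimes> Z\<^sub>n\<close>, hence it is a left inverse of the multiplication map. The latter is onto since
  every generator is a sum of products of an element of \<open>\<langle>W\<^sub>0, W\<^sub>1\<rangle>\<close> and a coefficient of \<open>\<zeta>\<close>.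

  The computations with power series take place in a type of class \<open>ring\<close>; the type \<open>ualg\<close> carries their results
  over to algebras on carrier sets.
\<close>

unbundle fps_syntax

section \<open>Power series over an algebra\<close>

lemma fps_mult_commute_if_nth:
  fixes A B :: "'u::ring fps"
  assumes "\<And>i j. A $ i * B $ j = B $ j * A $ i"
  shows "A * B = B * A"
proof (rule fps_ext)
  show "(A * B) $ n = (B * A) $ n" for n
    unfolding fps_mult_nth
    by (rule sum.reindex_bij_witness[of _ "\<lambda>i. n - i" "\<lambda>i. n - i"]) (auto simp: assms)
qed

text \<open>
  Associative algebras on a whole type. The class is that of rings without unit: the algebras of interest sit
  as corners \<open>e R e\<close> in a bigger ring \<open>R\<close>, the type \<open>ualg\<close> constructed below, and have unit \<open>e\<close>.
\<close>
locale scaled_ring = vector_space scale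
  for scale :: "'a::field \<Rightarrow> 'u::ring \<Rightarrow> 'u" (infixr "*s" 75) +
  assumes mult_scale_left [simp]: "(c *s x) * y = c *s (x * y)"
    and mult_scale_right [simp]: "x * (c *s y) = c *s (x * y)"
begin

text \<open>
  Linear functionals separate points, so a linear identity between products may be checked after applying a
  functional: it then becomes an identity in the field, with the values on the products as unknowns.
\<close>
definition functional :: "('u \<Rightarrow> 'a) \<Rightarrow> bool" where
  "functional \<phi> \<longleftrightarrow> (\<forall>x y. \<phi> (x + y) = \<phi> x + \<phi> y) \<and> (\<forall>c x. \<phi> (c *s x) = c * \<phi> x)"

lemma functional_simps:
  assumes "functional \<phi>"
  shows "\<phi> (x + y) = \<phi> x + \<phi> y" "\<phi> (c *s x) = c * \<phi> x" "\<phi> 0 = 0"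
    "\<phi> (- x) = - \<phi> x" "\<phi> (x - y) = \<phi> x - \<phi> y"
proof -
  have a: "\<phi> (x + y) = \<phi> x + \<phi> y" for x y using assms by (simp add: functional_def)
  show "\<phi> (x + y) = \<phi> x + \<phi> y" by (rule a)
  show "\<phi> (c *s x) = c * \<phi> x" using assms by (simp add: functional_def)
  show z: "\<phi> 0 = 0" using a[of 0 0] by (metis add_0 add_right_cancel)
  have m: "\<phi> (- x) = - \<phi> x" for x using a[of x "-x"] z by (simp add: eq_neg_iff_add_eq_0 add.commute)
  show "\<phi> (- x) = - \<phi> x" by (rule m)
  show "\<phi> (x - y) = \<phi> x - \<phi> y" using a[of x "-y"] m[of y] by simp
qed

lemma functional_ext:
  assumes "\<And>\<phi>. functional \<phi> \<Longrightarrow> \<phi> x = \<phi> y"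
  shows "x = y"
proof (rule ccontr)
  assume "x \<noteq> y"
  then have "independent {x - y}" by (simp add: dependent_single)
  interpret F: vector_space "(*) :: 'a \<Rightarrow> 'a \<Rightarrow> 'a"
    by unfold_locales (simp_all add: algebra_simps)
  interpret P: vector_space_pair scale "(*) :: 'a \<Rightarrow> 'a \<Rightarrow> 'a" by unfold_locales
  obtain g where g: "Vector_Spaces.linear scale (*) g" "g (x - y) = (1::'a)"
    using P.linear_independent_extend[OF \<open>independent {x - y}\<close>, of "\<lambda>_. 1"] by auto
  interpret g: Vector_Spaces.linear scale "(*)" g by (rule g)
  have f: "functional g" by (auto simp: functional_def g.add g.scale)
  have "g (x - y) = 0" using assms[OF f] functional_simps(5)[OF f] by simp
  with g show False by simp
qed

end

text \<open>
  Power series are an algebra again. \<open>shift\<close> is multiplication by the variable \<open>t\<close> and \<open>twist c\<close> is the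
  substitution of \<open>c t\<close> for \<open>t\<close>.
\<close>
locale series_ring = scaled_ring scale
  for scale :: "'a::field \<Rightarrow> 'u::ring \<Rightarrow> 'u" (infixr "*s" 75)
begin

definition fscale :: "'a \<Rightarrow> 'u fps \<Rightarrow> 'u fps" where
  "fscale c f = Abs_fps (\<lambda>n. c *s f $ n)"

lemma fscale_nth [simp]: "fscale c f $ n = c *s f $ n"
  by (simp add: fscale_def)

sublocale fps: scaled_ring fscale
  by unfold_locales
    (auto simp: fps_eq_iff fps_mult_nth scale_sum_right algebra_simps)

definition shift :: "'u fps \<Rightarrow> 'u fps" where
  "shift f = Abs_fps (\<lambda>n. case n of 0 \<Rightarrow> 0 | Suc m \<Rightarrow> f $ m)"

lemma shift_nth [simp]: "shift f $ 0 = 0" "shift f $ Suc m = f $ m"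
  by (simp_all add: shift_def)

lemma fps_ext_Suc: "f = g" if "f $ 0 = g $ 0" "\<And>n. f $ Suc n = g $ Suc n"
  using that by (metis fps_eq_iff not0_implies_Suc)

lemma shift_add: "shift (f + g) = shift f + shift g"
  and shift_diff: "shift (f - g) = shift f - shift g"
  and shift_scale: "shift (fscale c f) = fscale c (shift f)"
  by (rule fps_ext_Suc; simp)+

lemma shift_mult_left: "shift f * g = shift (f * g)"
proof (rule fps_ext_Suc)
  show "(shift f * g) $ Suc n = shift (f * g) $ Suc n" for n
    by (simp add: fps_mult_nth sum.atLeast0_atMost_Suc_shift
        del: sum.atLeast0_atMost_Suc sum.cl_ivl_Suc)
qed simp

lemma shift_mult_right: "f * shift g = shift (f * g)"
proof (rule fps_ext_Suc)
  show "(f * shift g) $ Suc n = shift (f * g) $ Suc n" for n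
    by (simp add: fps_mult_nth Suc_diff_le)
qed simp

definition twist :: "'a \<Rightarrow> 'u fps \<Rightarrow> 'u fps" where
  "twist c f = Abs_fps (\<lambda>n. (c ^ n) *s f $ n)"

lemma twist_nth [simp]: "twist c f $ n = (c ^ n) *s f $ n"
  by (simp add: twist_def)

lemma twist_mult: "twist c (f * g) = twist c f * twist c g"
  by (rule fps_ext)
    (auto simp: fps_mult_nth scale_sum_right power_add[symmetric] intro!: sum.cong)

lemma twist_add: "twist c (f + g) = twist c f + twist c g"
  and twist_diff: "twist c (f - g) = twist c f - twist c g"
  and twist_scale: "twist c (fscale d f) = fscale d (twist c f)"
  by (rule fps_ext; simp add: scale_right_distrib scale_right_diff_distrib mult.commute)+

lemma twist_shift: "twist c (shift f) = fscale c (shift (twist c f))"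
  by (rule fps_ext_Suc) simp_all

lemma twist_const [simp]: "twist c (fps_const x) = fps_const x"
  by (rule fps_ext_Suc) simp_all

lemmas series_linear = shift_add shift_diff shift_scale shift_mult_left shift_mult_right
  twist_mult twist_add twist_diff twist_scale twist_shift

end

section \<open>Alternating families\<close>

datatype kind = Wm | Wp | Gk | Gtk

text \<open>
  The defining relations, for four sequences in an algebra with unit \<open>e\<close>. Here \<open>f Wm n\<close> is \<open>W\<^sub>-\<^sub>n\<close>,
  \<open>f Wp n\<close> is \<open>W\<^sub>n\<^sub>+\<^sub>1\<close>, and \<open>f Gk n\<close>, \<open>f Gtk n\<close> are \<open>G\<^sub>n\<close> and its tilde version. Since the
  index of the last two starts at 0, all relations are homogeneous in the four generating series.
\<close>
locale alternating = series_ring scale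
  for scale :: "'a::field \<Rightarrow> 'u::ring \<Rightarrow> 'u" (infixr "*s" 75) +
  fixes e :: 'u and q :: 'a and f :: "kind \<Rightarrow> nat \<Rightarrow> 'u"
  assumes unit_left [simp]: "e * f x n = f x n"
    and unit_right [simp]: "f x n * e = f x n"
    and G_0 [simp]: "f Gk 0 = e"
    and Gt_0 [simp]: "f Gtk 0 = e"
    and W0_Wp: "f Wm 0 * f Wp n - f Wp n * f Wm 0 = (1 - inverse (q ^ 2)) *s (f Gtk (Suc n) - f Gk (Suc n))"
    and Wm_W1: "f Wm n * f Wp 0 - f Wp 0 * f Wm n = (1 - inverse (q ^ 2)) *s (f Gtk (Suc n) - f Gk (Suc n))"
    and W0_G: "q *s (f Wm 0 * f Gk n) - inverse q *s (f Gk n * f Wm 0) = (q - inverse q) *s f Wm n"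
    and Gt_W0: "q *s (f Gtk n * f Wm 0) - inverse q *s (f Wm 0 * f Gtk n) = (q - inverse q) *s f Wm n"
    and G_W1: "q *s (f Gk n * f Wp 0) - inverse q *s (f Wp 0 * f Gk n) = (q - inverse q) *s f Wp n"
    and W1_Gt: "q *s (f Wp 0 * f Gtk n) - inverse q *s (f Gtk n * f Wp 0) = (q - inverse q) *s f Wp n"
    and same_commute: "f x m * f x n = f x n * f x m"
    and Wm_Wp: "f Wm m * f Wp n - f Wp n * f Wm m + (f Wp m * f Wm n - f Wm n * f Wp m) = 0"
    and Gt_G: "f Gtk m * f Gk n - f Gk n * f Gtk m + (f Gk m * f Gtk n - f Gtk n * f Gk m) = 0"
    and W_G: "x \<in> {Wm, Wp} \<Longrightarrow> y \<in> {Gk, Gtk} \<Longrightarrow>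
      f x m * f y (Suc n) - f y (Suc n) * f x m + (f y (Suc m) * f x n - f x n * f y (Suc m)) = 0"
begin

abbreviation ser :: "kind \<Rightarrow> 'u fps" where
  "ser x \<equiv> Abs_fps (f x)"

definition Z :: "'u fps" where
  "Z = twist (inverse q) (ser Gk) * twist q (ser Gtk)
     - fscale q (shift (twist (inverse q) (ser Wm) * twist q (ser Wp)))"

lemma unit_idem [simp]: "e * e = e"
  using unit_left[of Gk 0] by simp

lemma shift_W0_Wp:
  "shift (fps_const (f Wm 0) * ser Wp - ser Wp * fps_const (f Wm 0))
     = fscale (1 - inverse (q ^ 2)) (ser Gtk - ser Gk)"
  by (rule fps_ext_Suc) (simp_all add: W0_Wp)

lemma shift_Wm_W1:
  "shift (ser Wm * fps_const (f Wp 0) - fps_const (f Wp 0) * ser Wm)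
     = fscale (1 - inverse (q ^ 2)) (ser Gtk - ser Gk)"
  by (rule fps_ext_Suc) (simp_all add: Wm_W1)

text \<open>
  The symmetry of the relations that exchanges the two \<open>W\<close> families and the two \<open>G\<close> families.
\<close>
lemma swapped: "alternating scale e q (\<lambda>x. f (case x of Wm \<Rightarrow> Wp | Wp \<Rightarrow> Wm | Gk \<Rightarrow> Gtk | Gtk \<Rightarrow> Gk))"
proof -
  have neg: "a - b = c *s (x - y)" if "b - a = c *s (y - x)" for a b x y :: 'u and c
    by (metis that minus_diff_eq scale_minus_right)
  show ?thesis
  proof (unfold_locales, goal_cases)
    case (12 m n)
    show ?case using Wm_Wp[of n m] by (simp add: algebra_simps)
  next
    case (13 m n)
    show ?case using Gt_G[of n m] by (simp add: algebra_simps)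
  next
    case (14 x y m n)
    then show ?case using W_G[of _ _ m n] by auto
  next
    case (5 n)
    show ?case using neg[OF Wm_W1[of n]] by simp
  next
    case (6 n)
    show ?case using neg[OF W0_Wp[of n]] by simp
  next
    case (11 x m n)
    show ?case by (rule same_commute)
  qed (simp_all add: W0_G Gt_W0 G_W1 W1_Gt)
qed

end

locale alternating_nonroot = alternating scale e q f
  for scale :: "'a::field \<Rightarrow> 'u::ring \<Rightarrow> 'u" (infixr "*s" 75) and e q f +
  assumes q0: "q \<noteq> 0" and nonroot: "\<And>m::nat. m \<ge> 1 \<Longrightarrow> q ^ m \<noteq> 1"
begin

lemma nonroot_diff: "q - inverse q \<noteq> 0"
proof
  assume "q - inverse q = 0"
  then have "q ^ 2 = 1" using q0 by (simp add: power2_eq_square field_simps)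
  then show False using nonroot[of 2] by simp
qed

lemma W_eq_q_commutator: "f Wm n = inverse (q - inverse q) *s (q *s (f Wm 0 * f Gk n) - inverse q *s (f Gk n * f Wm 0))"
  using nonroot_diff by (simp add: W0_G)

lemma Wm_series_eq:
  "ser Wm = fscale (inverse (q - inverse q)) (fscale q (fps_const (f Wm 0) * ser Gk) - fscale (inverse q) (ser Gk * fps_const (f Wm 0)))"
  by (rule fps_ext) (simp add: W_eq_q_commutator[symmetric])

lemma commutator_nth: "(A * B - B * A) $ n = (\<Sum>i=0..n. A $ i * B $ (n - i) - B $ (n - i) * A $ i)" for A B :: "'u fps"
proof -
  have "(B * A) $ n = (\<Sum>i=0..n. B $ (n - i) * A $ i)"
    unfolding fps_mult_nth by (rule sum.reindex_bij_witness[of _ "\<lambda>i. n - i" "\<lambda>i. n - i"]) auto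
  then show ?thesis by (simp add: fps_mult_nth sum_subtractf)
qed

text \<open>
  The relation \<open>s [W(s), G(t)] = t [W(t), G(s)]\<close> at \<open>s = r/q\<close>, \<open>t = q r\<close>, divided by \<open>r/q\<close>.
\<close>
lemma twisted_W_G_commutator:
  fixes x y
  assumes xy: "x \<in> {Wm, Wp}" "y \<in> {Gk, Gtk}"
  defines "A \<equiv> twist (inverse q) (ser x)" and "B \<equiv> twist q (ser y)"
    and "A' \<equiv> twist q (ser x)" and "B' \<equiv> twist (inverse q) (ser y)"
  shows "A * B - B * A = fscale (q ^ 2) (A' * B' - B' * A')"
proof (rule fps_ext)
  fix n
  define C where "C i j = f x i * f y j - f y j * f x i" for i j
  have C0: "C i 0 = 0" for i
    using xy by (auto simp: C_def)
  have C: "C i (Suc j) = C j (Suc i)" for i j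
    using W_G[OF xy, of i j] by (simp add: C_def algebra_simps)
  have "(A * B - B * A) $ n = (\<Sum>i=0..n. (inverse q ^ i * q ^ (n - i)) *s C i (n - i))"
    unfolding commutator_nth A_def B_def C_def
    by (auto intro!: sum.cong simp: scale_right_diff_distrib mult.commute)
  also have "\<dots> = (\<Sum>i<n. (inverse q ^ i * q ^ (n - i)) *s C i (n - i))"
    by (rule sum.mono_neutral_right) (auto simp: C0 not_less)
  \<comment> \<open>reflect the index, using the symmetry \<open>C i (Suc j) = C j (Suc i)\<close>\<close>
  also have "\<dots> = (\<Sum>i<n. (q ^ 2 * (q ^ i * inverse q ^ (n - i))) *s C i (n - i))"
  proof (rule sum.reindex_bij_witness[of _ "\<lambda>i. n - Suc i" "\<lambda>i. n - Suc i"])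
    fix i assume "i \<in> {..<n}"
    then obtain j where j: "n = Suc (i + j)"
      by (metis lessThan_iff less_iff_Suc_add)
    then show "(q ^ 2 * (q ^ (n - Suc i) * inverse q ^ (n - (n - Suc i)))) *s C (n - Suc i) (n - (n - Suc i))
      = (inverse q ^ i * q ^ (n - i)) *s C i (n - i)"
      using q0 C[of i j] by (simp add: Suc_diff_le power2_eq_square field_simps)
  qed auto
  also have "\<dots> = (\<Sum>i=0..n. (q ^ 2 * (q ^ i * inverse q ^ (n - i))) *s C i (n - i))"
    by (rule sum.mono_neutral_left) (auto simp: C0 not_less)
  also have "\<dots> = fscale (q ^ 2) (A' * B' - B' * A') $ n"
    unfolding fscale_nth commutator_nth A'_def B'_def C_def scale_sum_right
    by (auto intro!: sum.cong simp: scale_right_diff_distrib mult.commute)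
  finally show "(A * B - B * A) $ n = fscale (q ^ 2) (A' * B' - B' * A') $ n" .
qed

lemma ser_commute: "twist c (ser x) * twist d (ser x) = twist d (ser x) * twist c (ser x)"
  by (rule fps_mult_commute_if_nth) (simp add: same_commute[of x] mult.commute)

text \<open>
  Write \<open>W\<^sup>-\<close> as the \<open>q\<close>-commutator of \<open>W\<^sub>0\<close> with \<open>G\<close>. With \<open>A = G(r/q)\<close>, \<open>B = G(qr)\<close> and
  \<open>w = W\<^sub>0\<close>, both sides and the previous lemma become combinations of \<open>wAB\<close>, \<open>ABw\<close>, \<open>AwB\<close> and \<open>BwA\<close>.
  The choice \<open>t = q\<^sup>2 s\<close> makes \<open>BwA\<close> cancel in the previous lemma, and what is left is \<open>1 - q\<^sup>2\<close> times the claim.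
\<close>
lemma Wm_G_exchange:
  "twist (inverse q) (ser Wm) * twist q (ser Gk) = twist (inverse q) (ser Gk) * twist q (ser Wm)"
proof -
  define A B where "A = twist (inverse q) (ser Gk)" and "B = twist q (ser Gk)"
  define w where "w = fps_const (f Wm 0)"
  define c where "c = inverse (q - inverse q)"
  have c: "c * (q - inverse q) = 1" unfolding c_def using nonroot_diff by simp
  have Wa: "twist (inverse q) (ser Wm) = fscale c (fscale q (w * A) - fscale (inverse q) (A * w))"
    and Wb: "twist q (ser Wm) = fscale c (fscale q (w * B) - fscale (inverse q) (B * w))"
    by (simp_all only: Wm_series_eq series_linear A_def B_def w_def c_def twist_const)
  have AB: "A * B = B * A" unfolding A_def B_def by (rule ser_commute)
  then have AB': "A * (B * w) = B * (A * w)" by (metis mult.assoc)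
  have sp: "twist (inverse q) (ser Wm) * B - B * twist (inverse q) (ser Wm)
     = fscale (q ^ 2) (twist q (ser Wm) * A - A * twist q (ser Wm))"
    unfolding A_def B_def by (rule twisted_W_G_commutator) auto
  have "fscale c (fscale q (w * A) - fscale (inverse q) (A * w)) * B = A * fscale c (fscale q (w * B) - fscale (inverse q) (B * w))"
  proof (rule fps.functional_ext)
    fix \<phi> assume phi: "fps.functional \<phi>"
    note [simp] = fps.functional_simps[OF phi]
    from sp have "\<phi> (twist (inverse q) (ser Wm) * B - B * twist (inverse q) (ser Wm))
     = \<phi> (fscale (q ^ 2) (twist q (ser Wm) * A - A * twist q (ser Wm)))" by simp
    moreover define P R X Y where "P = \<phi> (w * (B * A))" and "R = \<phi> (B * (A * w))"
      and "X = \<phi> (A * (w * B))" and "Y = \<phi> (B * (w * A))"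
    moreover define v where "v = inverse q"
    ultimately have "c * (q * P - v * X - (q * Y - v * R)) = q ^ 2 * (c * (q * P - v * Y - (q * X - v * R)))"
      unfolding Wa Wb by (simp add: algebra_simps AB AB')
    moreover have "q * v = 1" using q0 by (simp add: v_def)
    moreover have "(1 - q ^ 2) * (c * (q * P - v * X) - c * (q * X - v * R))
      = c * (q * P - v * X - (q * Y - v * R)) - q ^ 2 * (c * (q * P - v * Y - (q * X - v * R)))
        + c * q * (X - Y) * (q * v - 1)"
      by (simp add: algebra_simps power2_eq_square)
    ultimately have "(1 - q ^ 2) * (c * (q * P - v * X) - c * (q * X - v * R)) = 0" by simp
    then have "c * (q * P - v * X) = c * (q * X - v * R)"
      using nonroot[of 2] by auto
    then show "\<phi> (fscale c (fscale q (w * A) - fscale (inverse q) (A * w)) * B)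
      = \<phi> (A * fscale c (fscale q (w * B) - fscale (inverse q) (B * w)))"
      by (simp add: algebra_simps P_def R_def X_def Y_def v_def AB AB')
  qed
  then show ?thesis by (simp add: Wa Wb A_def B_def)
qed

section \<open>Centrality of the coefficients of Z\<close>

text \<open>
  Moving \<open>W\<^sub>0\<close> through \<open>Z(r)\<close> leaves a multiple of \<open>W\<^sup>-(r/q) G(qr) - G(r/q) W\<^sup>-(qr)\<close>, which is zero by
  \<open>Wm_G_exchange\<close>.
\<close>
lemma Z_commute_W0: "Z * fps_const (f Wm 0) = fps_const (f Wm 0) * Z"
proof -
  define v where "v = inverse q"
  have qv: "q * v = 1" using q0 by (simp add: v_def)
  define Ga Gb Ta Tb Wa Wb Pb w where "Ga = twist v (ser Gk)" and "Gb = twist q (ser Gk)"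
    and "Ta = twist v (ser Gtk)" and "Tb = twist q (ser Gtk)"
    and "Wa = twist v (ser Wm)" and "Wb = twist q (ser Wm)" and "Pb = twist q (ser Wp)"
    and "w = fps_const (f Wm 0)"
  note defs = Ga_def Gb_def Ta_def Tb_def Wa_def Wb_def Pb_def w_def
  have Z: "Z = Ga * Tb - fscale q (shift (Wa * Pb))" by (simp add: Z_def defs v_def)
  have ex: "Wa * Gb = Ga * Wb" unfolding defs v_def by (rule Wm_G_exchange)
  have 1: "fscale q (w * ser Gk) - fscale v (ser Gk * w) = fscale (q - v) (ser Wm)"
    by (rule fps_ext) (simp add: w_def v_def W0_G)
  have 2: "fscale q (ser Gtk * w) - fscale v (w * ser Gtk) = fscale (q - v) (ser Wm)"
    by (rule fps_ext) (simp add: w_def v_def Gt_W0)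
  have a: "fscale q (w * Ga) - fscale v (Ga * w) = fscale (q - v) Wa"
    using arg_cong[OF 1, of "twist v"] by (simp add: series_linear defs)
  have b: "fscale q (Tb * w) - fscale v (w * Tb) = fscale (q - v) Wb"
    using arg_cong[OF 2, of "twist q"] by (simp add: series_linear defs)
  have p: "fscale q (shift (w * Pb - Pb * w)) = fscale (1 - v ^ 2) (Tb - Gb)"
    using arg_cong[OF shift_W0_Wp, of "twist q"]
    by (simp add: series_linear defs v_def power_inverse fps.scale_right_diff_distrib)
  have wW: "w * Wa = Wa * w"
    by (rule fps_ext) (simp add: defs same_commute)
  have "fps.functional \<phi> \<Longrightarrow> \<phi> (Z * w) = \<phi> (w * Z)" for \<phi>
  proof -
    assume phi: "fps.functional \<phi>"
    note [simp] = fps.functional_simps[OF phi]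
    have a': "\<phi> (fscale q (w * Ga) * Tb - fscale v (Ga * w) * Tb) = \<phi> (fscale (q - v) Wa * Tb)"
      by (simp only: a[symmetric] left_diff_distrib)
    have b': "\<phi> (Ga * (fscale q (Tb * w) - fscale v (w * Tb))) = \<phi> (Ga * fscale (q - v) Wb)"
      by (simp only: b)
    have p': "\<phi> (Wa * fscale q (shift (w * Pb - Pb * w))) = \<phi> (Wa * fscale (1 - v ^ 2) (Tb - Gb))"
      by (simp only: p)
    have wWP: "Wa * (w * Pb) = w * (Wa * Pb)" by (simp add: wW mult.assoc[symmetric])
    define x1 x2 x3 where "x1 = \<phi> (w * (Ga * Tb))" and "x2 = \<phi> (Ga * (w * Tb))" and "x3 = \<phi> (Ga * (Tb * w))"
    define y1 y2 where "y1 = \<phi> (Wa * Tb)" and "y2 = \<phi> (Ga * Wb)"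
    define z1 z2 where "z1 = \<phi> (shift (w * (Wa * Pb)))" and "z2 = \<phi> (shift (Wa * (Pb * w)))"
    note xyz = x1_def x2_def x3_def y1_def y2_def z1_def z2_def
    have a'': "q * x1 - v * x2 = (q - v) * y1"
      using a' by (simp add: xyz mult.assoc left_diff_distrib)
    have b'': "q * x3 - v * x2 = (q - v) * y2"
      using b' by (simp add: xyz mult.assoc right_diff_distrib)
    have p'': "q * (z1 - z2) = (1 - v ^ 2) * (y1 - y2)"
      using p' by (simp add: xyz mult.assoc right_diff_distrib series_linear wWP ex)
    have "q * (x3 - q * z2 - (x1 - q * z1)) = 0"
    proof -
      have "q * (x3 - q * z2 - (x1 - q * z1)) = (q * x3 - v * x2 - (q * x1 - v * x2)) + q * (q * (z1 - z2))"
        by (simp add: algebra_simps)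
      also have "\<dots> = (q * v - 1) * v * (y2 - y1)"
        unfolding a'' b'' p'' by (simp add: algebra_simps power2_eq_square)
      finally show ?thesis by (simp add: qv)
    qed
    then have "x3 - q * z2 = x1 - q * z1"
      using q0 by simp
    then show ?thesis
      by (simp add: xyz Z algebra_simps series_linear)
  qed
  then show ?thesis unfolding w_def by (rule fps.functional_ext)
qed

lemma swapped_nonroot:
  "alternating_nonroot scale e q (\<lambda>x. f (case x of Wm \<Rightarrow> Wp | Wp \<Rightarrow> Wm | Gk \<Rightarrow> Gtk | Gtk \<Rightarrow> Gk))"
  by (intro alternating_nonroot.intro swapped alternating_nonroot_axioms.intro q0 nonroot)

text \<open>
  As for \<open>W\<^sub>0\<close>; what remains is now the exchange rule for the swapped family.
\<close>
lemma Z_commute_W1: "Z * fps_const (f Wp 0) = fps_const (f Wp 0) * Z"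
proof -
  define v where "v = inverse q"
  have qv: "q * v = 1" using q0 by (simp add: v_def)
  then have v0: "v \<noteq> 0" by auto
  define Ga Ta Tb Wa Pa Pb u where "Ga = twist v (ser Gk)"
    and "Ta = twist v (ser Gtk)" and "Tb = twist q (ser Gtk)"
    and "Wa = twist v (ser Wm)" and "Pa = twist v (ser Wp)" and "Pb = twist q (ser Wp)"
    and "u = fps_const (f Wp 0)"
  note defs = Ga_def Ta_def Tb_def Wa_def Pa_def Pb_def u_def
  interpret S: alternating_nonroot scale e q "\<lambda>x. f (case x of Wm \<Rightarrow> Wp | Wp \<Rightarrow> Wm | Gk \<Rightarrow> Gtk | Gtk \<Rightarrow> Gk)"
    by (rule swapped_nonroot)
  have Z: "Z = Ga * Tb - fscale q (shift (Wa * Pb))" by (simp add: Z_def defs v_def)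
  have ex: "Pa * Tb = Ta * Pb" unfolding defs v_def using S.Wm_G_exchange by simp
  have 1: "fscale q (ser Gk * u) - fscale v (u * ser Gk) = fscale (q - v) (ser Wp)"
    by (rule fps_ext) (simp add: u_def v_def G_W1)
  have 2: "fscale q (u * ser Gtk) - fscale v (ser Gtk * u) = fscale (q - v) (ser Wp)"
    by (rule fps_ext) (simp add: u_def v_def W1_Gt)
  have a: "fscale q (Ga * u) - fscale v (u * Ga) = fscale (q - v) Pa"
    using arg_cong[OF 1, of "twist v"] by (simp add: series_linear defs)
  have b: "fscale q (u * Tb) - fscale v (Tb * u) = fscale (q - v) Pb"
    using arg_cong[OF 2, of "twist q"] by (simp add: series_linear defs)
  have p: "fscale v (shift (Wa * u - u * Wa)) = fscale (1 - v ^ 2) (Ta - Ga)"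
    using arg_cong[OF shift_Wm_W1, of "twist v"]
    by (simp add: series_linear defs v_def power_inverse fps.scale_right_diff_distrib)
  have uP: "u * Pb = Pb * u"
    by (rule fps_ext) (simp add: defs same_commute)
  have "fps.functional \<phi> \<Longrightarrow> \<phi> (Z * u) = \<phi> (u * Z)" for \<phi>
  proof -
    assume phi: "fps.functional \<phi>"
    note [simp] = fps.functional_simps[OF phi]
    have a': "\<phi> ((fscale q (Ga * u) - fscale v (u * Ga)) * Tb) = \<phi> (fscale (q - v) Pa * Tb)"
      by (simp only: a)
    have b': "\<phi> (Ga * (fscale q (u * Tb) - fscale v (Tb * u))) = \<phi> (Ga * fscale (q - v) Pb)"
      by (simp only: b)
    have p': "\<phi> (fscale v (shift (Wa * u - u * Wa)) * Pb) = \<phi> (fscale (1 - v ^ 2) (Ta - Ga) * Pb)"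
      by (simp only: p)
    define x1 x2 x3 where "x1 = \<phi> (Ga * (Tb * u))" and "x2 = \<phi> (Ga * (u * Tb))" and "x3 = \<phi> (u * (Ga * Tb))"
    define y1 y2 where "y1 = \<phi> (Ta * Pb)" and "y2 = \<phi> (Ga * Pb)"
    define z1 z2 where "z1 = \<phi> (shift (Wa * (Pb * u)))" and "z2 = \<phi> (shift (u * (Wa * Pb)))"
    note xyz = x1_def x2_def x3_def y1_def y2_def z1_def z2_def
    have a'': "q * x2 - v * x3 = (q - v) * y1"
      using a' by (simp add: xyz mult.assoc left_diff_distrib ex)
    have b'': "q * x2 - v * x1 = (q - v) * y2"
      using b' by (simp add: xyz mult.assoc right_diff_distrib)
    have p'': "v * (z1 - z2) = (1 - v ^ 2) * (y1 - y2)"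
      using p' by (simp add: xyz mult.assoc left_diff_distrib series_linear uP)
    have "v * (x1 - q * z1 - (x3 - q * z2)) = 0"
    proof -
      have "v * (x1 - q * z1 - (x3 - q * z2)) = (q * x2 - v * x3 - (q * x2 - v * x1)) - q * (v * (z1 - z2))"
        by (simp add: algebra_simps)
      also have "\<dots> = (q * v - 1) * v * (y1 - y2)"
        unfolding a'' b'' p'' by (simp add: algebra_simps power2_eq_square)
      finally show ?thesis by (simp add: qv)
    qed
    then have "x1 - q * z1 = x3 - q * z2"
      using v0 by simp
    then show ?thesis
      by (simp add: xyz Z algebra_simps series_linear)
  qed
  then show ?thesis unfolding u_def by (rule fps.functional_ext)
qed

lemma W0_G_reorder: "f Wm 0 * f Gk n = (inverse q ^ 2) *s (f Gk n * f Wm 0) + (1 - inverse q ^ 2) *s f Wm n"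
proof (rule functional_ext)
  fix \<phi> assume phi: "functional \<phi>"
  note [simp] = functional_simps[OF phi]
  from arg_cong[OF W0_G[of n], of \<phi>]
  show "\<phi> (f Wm 0 * f Gk n) = \<phi> ((inverse q ^ 2) *s (f Gk n * f Wm 0) + (1 - inverse q ^ 2) *s f Wm n)"
    using q0 by (simp add: field_simps power2_eq_square)
qed

text \<open>
  After expanding \<open>W\<^sup>+\<close> as the \<open>q\<close>-commutator of \<open>G\<close> with \<open>W\<^sub>1\<close>, both sides agree because the \<open>G\<^sub>n\<close>
  commute.
\<close>
lemma G_Wp_exchange:
  "(q ^ 2) *s (f Gk i * f Wp m) - f Wp m * f Gk i = (q ^ 2) *s (f Gk m * f Wp i) - f Wp i * f Gk m"
proof (rule functional_ext)
  fix \<phi> assume phi: "functional \<phi>"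
  note [simp] = functional_simps[OF phi]
  define d where "d = inverse (q - inverse q)"
  have P: "f Wp n = d *s (q *s (f Gk n * f Wp 0) - inverse q *s (f Wp 0 * f Gk n))" for n
    unfolding d_def G_W1 using nonroot_diff by simp
  show "\<phi> ((q ^ 2) *s (f Gk i * f Wp m) - f Wp m * f Gk i) = \<phi> ((q ^ 2) *s (f Gk m * f Wp i) - f Wp i * f Gk m)"
    using q0 unfolding P[of i] P[of m]
    by (simp add: algebra_simps same_commute power2_eq_square)
      (simp add: mult.assoc[symmetric] same_commute[of Gk m i])
qed

lemma Wm_G_exchange_nth:
  "(q ^ 2) *s (f Wm i * f Gk m) - f Gk m * f Wm i = (q ^ 2) *s (f Wm m * f Gk i) - f Gk i * f Wm m"
proof (rule functional_ext)
  fix \<phi> assume phi: "functional \<phi>"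
  note [simp] = functional_simps[OF phi]
  show "\<phi> ((q ^ 2) *s (f Wm i * f Gk m) - f Gk m * f Wm i) = \<phi> ((q ^ 2) *s (f Wm m * f Gk i) - f Gk i * f Wm m)"
    using q0 unfolding W_eq_q_commutator[of i] W_eq_q_commutator[of m]
    by (simp add: algebra_simps same_commute power2_eq_square)
      (simp add: mult.assoc[symmetric] same_commute[of Gk m i])
qed

end

context alternating_nonroot begin

lemma inverse_q_square_neq_1: "1 - inverse q ^ 2 \<noteq> 0"
proof
  assume "1 - inverse q ^ 2 = 0"
  then have "q ^ 2 = 1" using q0 by (simp add: field_simps)
  then show False using nonroot[of 2] by simp
qed

text \<open>
  This determines the commutators of the two \<open>G\<close> families, about which the defining relations only state a
  symmetry. It is the result of applying \<open>W\<^sub>0\<close> to the exchange rule of \<open>G\<close> and \<open>W\<^sup>+\<close>: the expression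
  \<open>M i j\<close> is symmetric in \<open>i\<close> and \<open>j\<close>, hence so is its twisted commutator with \<open>W\<^sub>0\<close>, which is a multiple of
  \<open>S i j\<close>.
\<close>
lemma Gt_G_reorder:
  "(f Gtk (Suc j) * f Gk i - f Gk i * f Gtk (Suc j)) - (f Gtk (Suc i) * f Gk j - f Gk j * f Gtk (Suc i))
    = (q ^ 2 - 1) *s (f Wm i * f Wp j - f Wm j * f Wp i)"
proof -
  define v where "v = inverse q"
  have qv: "q * v = 1" using q0 by (simp add: v_def)
  define S where "S i j = q *s (f Wm i * f Wp j) - v *s (f Wp j * f Wm i)
      + v *s (f Gk i * f Gtk (Suc j) - f Gtk (Suc j) * f Gk i)" for i j
  define M where "M i j = (q ^ 2) *s (f Gk i * f Wp j) - f Wp j * f Gk i" for i j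
  have wG: "f Wm 0 * f Gk n = (v ^ 2) *s (f Gk n * f Wm 0) + (1 - v ^ 2) *s f Wm n" for n
    unfolding v_def by (rule W0_G_reorder)
  then have wG': "f Wm 0 * (f Gk n * x) = (v ^ 2) *s (f Gk n * (f Wm 0 * x)) + (1 - v ^ 2) *s (f Wm n * x)" for n x
    by (simp add: mult.assoc[symmetric] distrib_right)
  have wP: "f Wm 0 * f Wp n = f Wp n * f Wm 0 + (1 - v ^ 2) *s (f Gtk (Suc n) - f Gk (Suc n))" for n
    using W0_Wp[of n] by (simp add: v_def power_inverse algebra_simps)
  then have wP': "f Wm 0 * (f Wp n * x) = f Wp n * (f Wm 0 * x) + (1 - v ^ 2) *s (f Gtk (Suc n) * x - f Gk (Suc n) * x)" for n x
    by (simp add: mult.assoc[symmetric] distrib_right left_diff_distrib)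
  have MS: "f Wm 0 * M i j - (v ^ 2) *s (M i j * f Wm 0) = (q * (1 - v ^ 2)) *s S i j" for i j
  proof (rule functional_ext)
    fix \<phi> assume phi: "functional \<phi>"
    note [simp] = functional_simps[OF phi]
    have [simp]: "q * (v * x) = x" for x
      using qv by (metis mult.assoc mult_1)
    show "\<phi> (f Wm 0 * M i j - (v ^ 2) *s (M i j * f Wm 0)) = \<phi> ((q * (1 - v ^ 2)) *s S i j)"
      unfolding M_def S_def
      by (simp add: algebra_simps wG wG' wP wP' power2_eq_square same_commute[of Gk i "Suc j"])
  qed
  have "M i j = M j i" unfolding M_def by (rule G_Wp_exchange)
  with MS[of i j] MS[of j i] have "(q * (1 - v ^ 2)) *s S i j = (q * (1 - v ^ 2)) *s S j i" by metis
  moreover have "q * (1 - v ^ 2) \<noteq> 0" using inverse_q_square_neq_1 q0 by (simp add: v_def)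
  ultimately have S: "S i j = S j i" by (rule scale_left_imp_eq[rotated])
  show ?thesis
  proof (rule functional_ext)
    fix \<phi> assume phi: "functional \<phi>"
    note [simp] = functional_simps[OF phi]
    define a b c d where "a = \<phi> (f Wm i * f Wp j)" and "b = \<phi> (f Wp j * f Wm i)"
      and "c = \<phi> (f Wm j * f Wp i)" and "d = \<phi> (f Wp i * f Wm j)"
    define h k where "h = \<phi> (f Gtk (Suc j) * f Gk i) - \<phi> (f Gk i * f Gtk (Suc j))"
      and "k = \<phi> (f Gtk (Suc i) * f Gk j) - \<phi> (f Gk j * f Gtk (Suc i))"
    from arg_cong[OF S, of \<phi>] have 1: "q * a - v * b - v * h = q * c - v * d - v * k"
      by (simp add: S_def a_def b_def c_def d_def h_def k_def algebra_simps)
    from arg_cong[OF Wm_Wp[of i j], of \<phi>] have 2: "a - b + (d - c) = 0"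
      by (simp add: a_def b_def c_def d_def)
    have "h - k - (q ^ 2 - 1) * (a - c) = (1 - q * v) * (h - k) - q * ((q * a - v * b - v * h) - (q * c - v * d - v * k))
        + q * v * (a - b + (d - c)) + (1 - q * v) * (a - c)"
      by (simp add: algebra_simps power2_eq_square)
    then have "h - k = (q ^ 2 - 1) * (a - c)" unfolding 1 2 qv by simp
    then show "\<phi> ((f Gtk (Suc j) * f Gk i - f Gk i * f Gtk (Suc j)) - (f Gtk (Suc i) * f Gk j - f Gk j * f Gtk (Suc i)))
      = \<phi> ((q ^ 2 - 1) *s (f Wm i * f Wp j - f Wm j * f Wp i))"
      by (simp add: a_def c_def h_def k_def)
  qed
qed

text \<open>
  The coefficient of \<open>t\<^sup>m\<^sup>+\<^sup>1\<close> in \<open>(t - q r) [Z(r), G(t)] = 0\<close>. Three commutators with \<open>G(t)\<close> contribute, one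
  for each of the series \<open>G'\<close>, \<open>W\<^sup>+\<close>, \<open>W\<^sup>-\<close> in \<open>Z\<close>. Each is rewritten by an exchange rule (facts \<open>i\<close>, \<open>ii\<close>,
  \<open>iii\<close>), and the sum vanishes by \<open>Wm_G_exchange\<close>.
\<close>
lemma Z_commute_G_step:
  fixes m
  defines "D n \<equiv> Z * fps_const (f Gk n) - fps_const (f Gk n) * Z"
  shows "D m = fscale q (shift (D (Suc m)))"
proof -
  define v where "v = inverse q"
  have qv: "q * v = 1" using q0 by (simp add: v_def)
  define Ga Gb Tb Wa Wb Pb where "Ga = twist v (ser Gk)" and "Gb = twist q (ser Gk)"
    and "Tb = twist q (ser Gtk)"
    and "Wa = twist v (ser Wm)" and "Wb = twist q (ser Wm)" and "Pb = twist q (ser Wp)"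
  define g h w p where "g = fps_const (f Gk m)" and "h = fps_const (f Gk (Suc m))"
    and "w = fps_const (f Wm m)" and "p = fps_const (f Wp m)"
  note defs = Ga_def Gb_def Tb_def Wa_def Wb_def Pb_def
  note cdefs = g_def h_def w_def p_def
  define k where "k = q ^ 2 - 1"
  have Z: "Z = Ga * Tb - fscale q (shift (Wa * Pb))" by (simp add: Z_def defs v_def)
  have ex: "Wa * Gb = Ga * Wb" unfolding defs v_def by (rule Wm_G_exchange)
  have Gg: "Ga * g = g * Ga" and Gh: "Ga * h = h * Ga"
    by (rule fps_ext; simp add: defs cdefs same_commute)+
  have Gg': "Ga * (g * x) = g * (Ga * x)" and Gh': "Ga * (h * x) = h * (Ga * x)"
    and ex': "Wa * (Gb * x) = Ga * (Wb * x)" for x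
    by (simp_all only: mult.assoc[symmetric] Gg Gh ex)
  have 1: "(ser Gtk * g - g * ser Gtk) - shift (ser Gtk * h - h * ser Gtk) = fscale k (shift (w * ser Wp - ser Wm * p))"
  proof (rule fps_ext_Suc)
    fix n
    have "f Gtk n * f Gk (Suc m) - f Gk (Suc m) * f Gtk n = f Gtk (Suc m) * f Gk n - f Gk n * f Gtk (Suc m)"
      using Gt_G[of "Suc m" n] by (simp add: algebra_simps)
    then show "((ser Gtk * g - g * ser Gtk) - shift (ser Gtk * h - h * ser Gtk)) $ Suc n
      = fscale k (shift (w * ser Wp - ser Wm * p)) $ Suc n"
      using Gt_G_reorder[of n m] by (simp add: cdefs k_def)
  qed (simp add: cdefs)
  have 2: "(ser Wp * g - g * ser Wp) - shift (ser Wp * h - h * ser Wp) = fscale k (g * ser Wp - ser Gk * p)"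
  proof (rule fps_ext)
    fix n
    show "((ser Wp * g - g * ser Wp) - shift (ser Wp * h - h * ser Wp)) $ n
      = fscale k (g * ser Wp - ser Gk * p) $ n"
      using W_G[of Wp Gk] G_Wp_exchange[of n m]
      by (cases n) (simp_all add: cdefs k_def algebra_simps)
  qed
  have 3: "(ser Wm * g - g * ser Wm) - fscale (q ^ 2) (shift (ser Wm * h - h * ser Wm)) = fscale k (ser Gk * w - ser Wm * g)"
  proof (rule fps_ext)
    fix n
    show "((ser Wm * g - g * ser Wm) - fscale (q ^ 2) (shift (ser Wm * h - h * ser Wm))) $ n
      = fscale k (ser Gk * w - ser Wm * g) $ n"
    proof (cases n)
      case 0
      then show ?thesis using Wm_G_exchange_nth[of 0 m] by (simp add: cdefs k_def algebra_simps)
    next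
      case (Suc i)
      have "f Wm i * f Gk (Suc m) - f Gk (Suc m) * f Wm i = f Wm m * f Gk n - f Gk n * f Wm m"
        using W_G[of Wm Gk i m] Suc by (simp add: algebra_simps)
      then have "((ser Wm * g - g * ser Wm) - fscale (q ^ 2) (shift (ser Wm * h - h * ser Wm))) $ n
        = (f Wm n * f Gk m - f Gk m * f Wm n) - (q ^ 2) *s (f Wm m * f Gk n - f Gk n * f Wm m)"
        using Suc by (simp add: cdefs)
      then show ?thesis using Wm_G_exchange_nth[of n m] by (simp add: cdefs k_def algebra_simps)
    qed
  qed
  have i: "(Tb * g - g * Tb) - fscale q (shift (Tb * h - h * Tb)) = fscale (k * q) (shift (w * Pb - Wb * p))"
    using arg_cong[OF 1, of "twist q"] by (simp add: series_linear defs cdefs fps.scale_right_diff_distrib)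
  have ii: "(Pb * g - g * Pb) - fscale q (shift (Pb * h - h * Pb)) = fscale k (g * Pb - Gb * p)"
    using arg_cong[OF 2, of "twist q"] by (simp add: series_linear defs cdefs fps.scale_right_diff_distrib)
  have "q ^ 2 * v = q" using qv by (simp add: power2_eq_square mult.assoc)
  then have iii: "(Wa * g - g * Wa) - fscale q (shift (Wa * h - h * Wa)) = fscale k (Ga * w - Wa * g)"
    using arg_cong[OF 3, of "twist v"] by (simp add: series_linear defs cdefs fps.scale_right_diff_distrib)
  have "D m - fscale q (shift (D (Suc m))) = Ga * ((Tb * g - g * Tb) - fscale q (shift (Tb * h - h * Tb)))
    - fscale q (shift (Wa * ((Pb * g - g * Pb) - fscale q (shift (Pb * h - h * Pb)))
         + ((Wa * g - g * Wa) - fscale q (shift (Wa * h - h * Wa))) * Pb))"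
    by (simp add: D_def Z g_def[symmetric] h_def[symmetric] algebra_simps series_linear Gg' Gh'
        fps.scale_right_distrib fps.scale_right_diff_distrib)
  also have "\<dots> = 0"
    unfolding i ii iii by (simp add: algebra_simps series_linear ex'
        fps.scale_right_distrib fps.scale_right_diff_distrib)
  finally show ?thesis by simp
qed

text \<open>
  By the previous lemma the \<open>n\<close>-th coefficient of the commutator with \<open>G\<^sub>m\<close> is a multiple of the
  \<open>(n - 1)\<close>-st coefficient of the commutator with \<open>G\<^sub>m\<^sub>+\<^sub>1\<close>, and the coefficients of index 0 are zero.
\<close>
lemma Z_commute_G: "Z * fps_const (f Gk m) = fps_const (f Gk m) * Z"
proof -
  define D where "D n = Z * fps_const (f Gk n) - fps_const (f Gk n) * Z" for n
  have D0: "D m $ 0 = 0" for m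
    by (simp add: D_def Z_def)
  have "D m $ n = 0" for n
  proof (induction n arbitrary: m)
    case (Suc n)
    then show ?case using Z_commute_G_step[of m] by (simp add: D_def)
  qed (rule D0)
  then have "D m = 0" by (simp add: fps_eq_iff)
  then show ?thesis by (simp add: D_def)
qed

theorem Z_central: "Z $ k * f x n = f x n * Z $ k"
proof -
  define C where "C a \<longleftrightarrow> (\<forall>k. Z $ k * a = a * Z $ k)" for a
  have C: "C a" if "Z * fps_const a = fps_const a * Z" for a
    using that by (simp add: C_def fps_eq_iff)
  have mult: "C (a * b)" if "C a" "C b" for a b
    using that unfolding C_def by (metis mult.assoc)
  have add: "C (a + b)" and diff: "C (a - b)" if "C a" "C b" for a b
    using that by (simp_all add: C_def distrib_left distrib_right right_diff_distrib left_diff_distrib)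
  have scale: "C (c *s a)" if "C a" for c a
    using that by (simp add: C_def)
  have W0: "C (f Wm 0)" and W1: "C (f Wp 0)" and G: "C (f Gk n)" for n
    by (rule C Z_commute_W0 Z_commute_W1 Z_commute_G)+
  have Wm: "C (f Wm n)" for n
    unfolding W_eq_q_commutator[of n] by (intro scale diff mult W0 G)
  have "C ((q - inverse q) *s f Wp n)" for n
    unfolding G_W1[symmetric] by (intro scale diff mult W1 G)
  from scale[OF this, of "inverse (q - inverse q)"] have Wp: "C (f Wp n)" for n
    using nonroot_diff by simp
  have "C ((1 - inverse (q ^ 2)) *s (f Gtk (Suc n) - f Gk (Suc n)))" for n
    unfolding W0_Wp[symmetric] by (intro diff mult W0 Wp)
  from scale[OF this, of "inverse (1 - inverse (q ^ 2))"]
  have "C (f Gtk (Suc n) - f Gk (Suc n))" for n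
    using inverse_q_square_neq_1 by (simp add: power_inverse)
  then have "C (f Gtk (Suc n) - f Gk (Suc n) + f Gk (Suc n))" for n by (intro add G)
  then have "C (f Gtk (Suc n))" for n by simp
  moreover have "C (f Gtk 0)" using G[of 0] by simp
  ultimately have "C (f Gtk n)" for n by (cases n) auto
  with Wm Wp G have "C (f x n)" by (cases x) auto
  then show ?thesis by (simp add: C_def)
qed

end

section \<open>Rescaling by a central power series\<close>

locale central_scaling = alternating scale e q f
  for scale :: "'a::field \<Rightarrow> 'u::ring \<Rightarrow> 'u" (infixr "*s" 75) and e q f +
  fixes z :: "nat \<Rightarrow> 'u"
  assumes z_0 [simp]: "z 0 = e"
    and z_unit [simp]: "e * z n = z n"
    and z_f: "z m * f x n = f x n * z m"
    and z_z: "z m * z n = z n * z m"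
begin

abbreviation zser :: "'u fps" where
  "zser \<equiv> Abs_fps z"

definition scaled :: "kind \<Rightarrow> nat \<Rightarrow> 'u" where
  "scaled x n = (ser x * zser) $ n"

lemma scaled_0 [simp]: "scaled x 0 = f x 0"
  by (simp add: scaled_def)

lemma scaled_ser: "Abs_fps (scaled x) = ser x * zser"
  by (rule fps_ext) (simp add: scaled_def)

lemma zser_const: "fps_const (f x n) * zser = zser * fps_const (f x n)"
  by (rule fps_ext) (simp add: z_f)

lemma commutator_zser:
  "fps_const (f x n) * (A * zser) - (A * zser) * fps_const (f x n)
    = (fps_const (f x n) * A - A * fps_const (f x n)) * zser"
  by (simp add: left_diff_distrib mult.assoc zser_const)

text \<open>
  Commutators of coefficients of two scaled series are the same combinations of commutators for every pair of
  families, so each relation between commutators is inherited term by term.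
\<close>
lemma scaled_commutator:
  "scaled x k * scaled y l - scaled y l * scaled x k
    = (\<Sum>i\<le>k. \<Sum>j\<le>l. (f x i * f y j - f y j * f x i) * (z (k - i) * z (l - j)))"
proof -
  have swap: "a * z m * (b * z n) = a * b * (z m * z n)" if "z m * b = b * z m" for a b m n
    using that by (metis mult.assoc)
  have "scaled x k * scaled y l = (\<Sum>i\<le>k. \<Sum>j\<le>l. f x i * f y j * (z (k - i) * z (l - j)))"
    for x y k l
    by (simp add: scaled_def fps_mult_nth sum_product atLeast0AtMost swap z_f)
  moreover from this[of y l x k] have "scaled y l * scaled x k = (\<Sum>i\<le>k. \<Sum>j\<le>l. f y j * f x i * (z (k - i) * z (l - j)))"
    by (subst sum.swap) (simp add: z_z[of "k - _" "l - _"])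
  ultimately show ?thesis by (simp add: sum_subtractf left_diff_distrib)
qed

lemma linear_relation:
  assumes "fscale a (fps_const (f y 0) * ser x) - fscale b (ser x * fps_const (f y 0)) = fscale c (ser w)"
  shows "a *s (f y 0 * scaled x n) - b *s (scaled x n * f y 0) = c *s scaled w n"
proof -
  have "fscale a (fps_const (f y 0) * (ser x * zser)) - fscale b (ser x * zser * fps_const (f y 0))
    = (fscale a (fps_const (f y 0) * ser x) - fscale b (ser x * fps_const (f y 0))) * zser"
    by (simp add: left_diff_distrib mult.assoc zser_const)
  also have "\<dots> = fscale c (ser w * zser)"
    by (simp add: assms)
  finally show ?thesis
    by (simp add: fps_eq_iff scaled_def)
qed

lemma linear_relation':
  assumes "fscale a (ser x * fps_const (f y 0)) - fscale b (fps_const (f y 0) * ser x) = fscale c (ser w)"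
  shows "a *s (scaled x n * f y 0) - b *s (f y 0 * scaled x n) = c *s scaled w n"
  using linear_relation[of b y x a "- c" w n] assms by (simp add: fps_eq_iff algebra_simps)

lemma scaled_alternating: "alternating scale e q scaled"
proof (unfold_locales, goal_cases)
  case (1 x n)
  show ?case
    by (simp add: scaled_def fps_mult_nth sum_distrib_left mult.assoc[symmetric])
next
  case (2 x n)
  have "z m * e = z m" for m using z_z[of 0 m] by simp
  then show ?case
    by (simp add: scaled_def fps_mult_nth sum_distrib_right mult.assoc)
next
  case (5 n)
  have "shift (fps_const (f Wm 0) * (ser Wp * zser) - (ser Wp * zser) * fps_const (f Wm 0)) $ Suc n
    = fscale (1 - inverse (q ^ 2)) (ser Gtk * zser - ser Gk * zser) $ Suc n"
    unfolding commutator_zser shift_mult_left[symmetric] shift_W0_Wp by (simp add: left_diff_distrib)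
  then show ?case by (simp add: scaled_def[symmetric])
next
  case (6 n)
  have "shift ((ser Wm * zser) * fps_const (f Wp 0) - fps_const (f Wp 0) * (ser Wm * zser)) $ Suc n
    = fscale (1 - inverse (q ^ 2)) (ser Gtk * zser - ser Gk * zser) $ Suc n"
  proof -
    have "(ser Wm * zser) * fps_const (f Wp 0) - fps_const (f Wp 0) * (ser Wm * zser) = (ser Wm * fps_const (f Wp 0) - fps_const (f Wp 0) * ser Wm) * zser"
      using commutator_zser[of Wp 0 "ser Wm"] by (simp add: left_diff_distrib algebra_simps)
    then show ?thesis
      by (simp only: shift_mult_left[symmetric] shift_Wm_W1) (simp add: left_diff_distrib)
  qed
  then show ?case by (simp add: scaled_def[symmetric])
next
  case (7 n)
  show ?case unfolding scaled_0 by (rule linear_relation) (simp add: fps_eq_iff W0_G)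
next
  case (8 n)
  show ?case unfolding scaled_0 by (rule linear_relation') (simp add: fps_eq_iff Gt_W0)
next
  case (9 n)
  show ?case unfolding scaled_0 by (rule linear_relation') (simp add: fps_eq_iff G_W1)
next
  case (10 n)
  show ?case unfolding scaled_0 by (rule linear_relation) (simp add: fps_eq_iff W1_Gt)
next
  case (11 x m n)
  have "scaled x m * scaled x n - scaled x n * scaled x m = 0"
    unfolding scaled_commutator by (simp add: same_commute)
  then show ?case by simp
next
  case (12 m n)
  show ?case unfolding scaled_commutator sum.distrib[symmetric] distrib_right[symmetric] Wm_Wp by simp
next
  case (13 m n)
  show ?case unfolding scaled_commutator sum.distrib[symmetric] distrib_right[symmetric] Gt_G by simp
next
  case (14 x y m n)
  then have [simp]: "f y 0 = e" by auto
  have "scaled x m * scaled y (Suc n) - scaled y (Suc n) * scaled x m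
    = (\<Sum>i\<le>m. \<Sum>j\<le>n. (f x i * f y (Suc j) - f y (Suc j) * f x i) * (z (m - i) * z (n - j)))"
    unfolding scaled_commutator by (simp add: sum.atMost_Suc_shift del: sum.atMost_Suc)
  moreover have "scaled y (Suc m) * scaled x n - scaled x n * scaled y (Suc m)
    = (\<Sum>i\<le>m. \<Sum>j\<le>n. (f y (Suc i) * f x j - f x j * f y (Suc i)) * (z (m - i) * z (n - j)))"
    unfolding scaled_commutator by (simp add: sum.atMost_Suc_shift del: sum.atMost_Suc)
  ultimately show ?case
    using W_G[OF 14] by (simp add: sum.distrib[symmetric] distrib_right[symmetric])
qed simp_all

text \<open>
  Each of the two products in \<open>Z\<close> contains one factor at \<open>t/q\<close> and one at \<open>q t\<close>.
\<close>
lemma Z_scaled: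
  "alternating.Z scale q scaled = Z * (twist (inverse q) zser * twist q zser)"
proof -
  interpret S: alternating scale e q scaled by (rule scaled_alternating)
  have comm: "twist (inverse q) zser * twist q (ser x) = twist q (ser x) * twist (inverse q) zser" for x
    by (rule fps_mult_commute_if_nth) (simp add: z_f mult.commute)
  have comm': "twist (inverse q) zser * (twist q (ser x) * A) = twist q (ser x) * (twist (inverse q) zser * A)" for x A
    by (simp add: mult.assoc[symmetric] comm)
  have "twist (inverse q) (ser x * zser) * twist q (ser y * zser)
    = twist (inverse q) (ser x) * twist q (ser y) * (twist (inverse q) zser * twist q zser)" for x y
    by (simp add: twist_mult mult.assoc comm')
  then show ?thesis
    by (simp add: S.Z_def Z_def scaled_ser left_diff_distrib shift_mult_left)
qed

end

section \<open>Splitting off the centre\<close>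

lemma course_of_values:
  fixes F :: "nat \<Rightarrow> (nat \<Rightarrow> 'b) \<Rightarrow> 'b"
  assumes "\<And>n g h. (\<And>k. k < n \<Longrightarrow> g k = h k) \<Longrightarrow> F n g = F n h"
  obtains g where "\<And>n. g n = F n g"
proof -
  have "wfrec less_than (\<lambda>g n. F n g) = (\<lambda>n. F n (wfrec less_than (\<lambda>g n. F n g)))"
    by (rule wfrec_fixpoint) (auto simp: adm_wf_def intro!: assms)
  then show ?thesis using that by metis
qed

context alternating begin

text \<open>
  Subalgebras with unit \<open>e\<close>, which in general is not the unit of the ambient ring.
\<close>
definition is_subalg :: "'u set \<Rightarrow> bool" where
  "is_subalg K \<longleftrightarrow> e \<in> K \<and> (\<forall>x\<in>K. \<forall>y\<in>K. x + y \<in> K \<and> x * y \<in> K) \<and> (\<forall>c. \<forall>x\<in>K. c *s x \<in> K)"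

lemma
  assumes "is_subalg K"
  shows closed_e: "e \<in> K" and closed_add: "x \<in> K \<Longrightarrow> y \<in> K \<Longrightarrow> x + y \<in> K"
    and closed_mult: "x \<in> K \<Longrightarrow> y \<in> K \<Longrightarrow> x * y \<in> K"
    and closed_scale: "x \<in> K \<Longrightarrow> c *s x \<in> K"
    and closed_diff: "x \<in> K \<Longrightarrow> y \<in> K \<Longrightarrow> x - y \<in> K"
    and closed_zero: "0 \<in> K"
    and closed_minus: "x \<in> K \<Longrightarrow> - x \<in> K"
    and closed_sum: "(\<And>i. i \<in> I \<Longrightarrow> g i \<in> K) \<Longrightarrow> sum g I \<in> K"
proof -
  show e: "e \<in> K" and add: "x \<in> K \<Longrightarrow> y \<in> K \<Longrightarrow> x + y \<in> K"
    and "x \<in> K \<Longrightarrow> y \<in> K \<Longrightarrow> x * y \<in> K"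
    and sc: "x \<in> K \<Longrightarrow> c *s x \<in> K" for x y c
    using assms by (auto simp: is_subalg_def)
  show m: "- x \<in> K" if "x \<in> K" for x using sc[OF that, of "- 1"] by simp
  show "x \<in> K \<Longrightarrow> y \<in> K \<Longrightarrow> x - y \<in> K" using add[OF _ m] by force
  show z: "0 \<in> K" using sc[OF e, of 0] by simp
  show "sum g I \<in> K" if "\<And>i. i \<in> I \<Longrightarrow> g i \<in> K"
    using that by (induction I rule: infinite_finite_induct) (auto simp: z add)
qed

lemmas closed_intros = closed_e closed_add closed_mult closed_scale closed_diff closed_zero
  closed_minus closed_sum

lemma Z_nth: "Z $ n = (\<Sum>i=0..n. (inverse q ^ i * q ^ (n - i)) *s (f Gk i * f Gtk (n - i)))
   - (case n of 0 \<Rightarrow> 0 | Suc m \<Rightarrow>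
      q *s (\<Sum>i=0..m. (inverse q ^ i * q ^ (m - i)) *s (f Wm i * f Wp (m - i))))"
  by (cases n) (simp_all add: Z_def fps_mult_nth mult.commute)

lemma Z_0 [simp]: "Z $ 0 = e"
  by (simp add: Z_nth)

lemma is_subalg_Z: "is_subalg K \<Longrightarrow> (\<And>x n. f x n \<in> K) \<Longrightarrow> Z $ n \<in> K"
  unfolding Z_nth by (cases n) (auto intro!: closed_intros[of K])

end

lemma (in alternating) Z_unit: "e * Z $ n = Z $ n"
proof -
  define B where "B = {x. e * x = x \<and> x * e = x}"
  have "is_subalg B" unfolding B_def is_subalg_def
    by (auto simp: distrib_left distrib_right mult.assoc) (simp add: mult.assoc[symmetric])
  then have "Z $ n \<in> B" by (rule is_subalg_Z) (simp add: B_def)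
  then show ?thesis by (simp add: B_def)
qed

context alternating_nonroot begin

text \<open>
  Otherwise \<open>q\<^sup>2\<^sup>n = -1\<close> and \<open>q\<^sup>4\<^sup>n = 1\<close>.
\<close>
lemma q_power_sum: "q ^ n + inverse q ^ n \<noteq> 0" if "n \<ge> 1"
proof
  assume *: "q ^ n + inverse q ^ n = 0"
  have i: "q ^ n * inverse q ^ n = 1" using q0 by (simp add: power_mult_distrib[symmetric])
  have "q ^ n * (q ^ n + inverse q ^ n) = 0" using * by simp
  then have "q ^ n * q ^ n = - 1" by (simp add: distrib_left i eq_neg_iff_add_eq_0)
  moreover have "q ^ (n * 4) = (q ^ n * q ^ n) * (q ^ n * q ^ n)"
    by (simp add: power_mult power4_eq_xxxx mult.assoc)
  ultimately have "q ^ (n * 4) = 1" by simp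
  then show False using nonroot[of "n * 4"] that by simp
qed

text \<open>
  By induction on the index. The bracket of \<open>W\<^sub>0\<close> and \<open>W\<^sub>n\<close> yields \<open>G'\<^sub>n - G\<^sub>n\<close>, and the two extreme
  terms of \<open>Z\<^sub>n\<close> yield \<open>q\<^sup>-\<^sup>n G\<^sub>n + q\<^sup>n G'\<^sub>n\<close>; all other terms of \<open>Z\<^sub>n\<close> have smaller index.
\<close>
lemma generated_by_W0_W1:
  assumes K: "is_subalg K" and W0: "f Wm 0 \<in> K" and W1: "f Wp 0 \<in> K"
    and Z: "\<And>n. Z $ n \<in> K"
  shows "f x n \<in> K"
proof -
  note cl = closed_intros[OF K]
  have unscale: "x \<in> K" if "c *s x \<in> K" "c \<noteq> 0" for c x
    using closed_scale[OF K that(1), of "inverse c"] that(2) by simp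
  have "\<forall>x. f x n \<in> K"
  proof (induction n rule: less_induct)
    case (less n)
    show ?case
    proof (cases n)
      case 0
      have "f x 0 \<in> K" for x
        using W0 W1 closed_e[OF K] by (cases x) auto
      then show ?thesis using 0 by simp
    next
      case (Suc m)
      have IH: "f x i \<in> K" if "i \<le> m" for x i using less that Suc by auto
      define s where "s = q ^ n + inverse q ^ n"
      have s: "s \<noteq> 0" unfolding s_def using q_power_sum[of n] Suc by simp
      have "(1 - inverse (q ^ 2)) *s (f Gtk n - f Gk n) \<in> K"
        unfolding Suc W0_Wp[symmetric] by (intro cl IH) auto
      then have D: "f Gtk n - f Gk n \<in> K"
        by (rule unscale) (use inverse_q_square_neq_1 in \<open>simp add: power_inverse\<close>)
      define r where "r i = (inverse q ^ i * q ^ (n - i)) *s (f Gk i * f Gtk (n - i))" for i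
      have r: "r i \<in> K" if "i \<in> {1..<n}" for i
        unfolding r_def using that Suc by (intro cl IH) auto
      have "sum r {0..n} = r 0 + r n + sum r {1..<n}"
      proof -
        have "{0..n} = insert 0 (insert n {1..<n})" using Suc by auto
        then show ?thesis using Suc by (simp add: add.assoc)
      qed
      moreover have "sum r {0..n} \<in> K"
      proof -
        have "sum r {0..n} = Z $ n + q *s (\<Sum>i=0..m. (inverse q ^ i * q ^ (m - i)) *s (f Wm i * f Wp (m - i)))"
          by (simp add: Z_nth r_def Suc del: sum.cl_ivl_Suc)
        also have "\<dots> \<in> K" by (intro cl IH Z) auto
        finally show ?thesis .
      qed
      ultimately have "r 0 + r n \<in> K"
        using closed_diff[OF K, of "sum r {0..n}" "sum r {1..<n}"] closed_sum[OF K, of "{1..<n}" r] r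
        by simp
      moreover have "r 0 + r n = s *s f Gk n + (q ^ n) *s (f Gtk n - f Gk n)"
        by (simp add: r_def s_def scale_left_distrib scale_right_diff_distrib)
      ultimately have "s *s f Gk n \<in> K"
        using closed_diff[OF K, of "r 0 + r n" "(q ^ n) *s (f Gtk n - f Gk n)"] closed_scale[OF K D]
        by simp
      then have G: "f Gk n \<in> K" by (rule unscale) (rule s)
      have Gt: "f Gtk n \<in> K" using closed_add[OF K D G] by simp
      have "f Wm n \<in> K" unfolding W_eq_q_commutator[of n] by (intro cl W0 G)
      moreover have "(q - inverse q) *s f Wp n \<in> K" unfolding G_W1[symmetric] by (intro cl W1 G)
      then have "f Wp n \<in> K" by (rule unscale) (rule nonroot_diff)
      ultimately show ?thesis using G Gt by (metis kind.exhaust)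
    qed
  qed
  then show ?thesis by simp
qed

lemma Z_commute: "Z $ m * Z $ n = Z $ n * Z $ m"
proof -
  have "is_subalg {x. Z $ m * x = x * Z $ m}"
  proof -
    have "Z $ m * e = e * Z $ m" using Z_central[of m Gk 0] by simp
    moreover have "Z $ m * (x * y) = x * y * Z $ m" if "Z $ m * x = x * Z $ m" "Z $ m * y = y * Z $ m" for x y
      using that by (metis mult.assoc)
    ultimately show ?thesis by (auto simp: is_subalg_def distrib_left distrib_right)
  qed
  from is_subalg_Z[OF this, of n] show ?thesis using Z_central by auto
qed

text \<open>
  The series \<open>\<zeta>\<close> solves \<open>\<zeta>(t/q) \<zeta>(qt) = Z(t)\<close>, and \<open>f'\<close> is the family scaled by its inverse \<open>\<eta>\<close>, so that
  \<open>Z(t)\<close> becomes 1 and the previous lemma applies to \<open>f'\<close>.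
\<close>
theorem factorization:
  obtains \<zeta> f' where
    "alternating scale e q f'"
    "\<And>x n. f x n = (Abs_fps (f' x) * Abs_fps \<zeta>) $ n"
    "alternating.Z scale q f' = fps_const e"
    "Z = twist (inverse q) (Abs_fps \<zeta>) * twist q (Abs_fps \<zeta>)"
    "\<And>K n. is_subalg K \<Longrightarrow> (\<And>k. Z $ k \<in> K) \<Longrightarrow> \<zeta> n \<in> K"
    "\<And>K x n. is_subalg K \<Longrightarrow> f Wm 0 \<in> K \<Longrightarrow> f Wp 0 \<in> K \<Longrightarrow> f' x n \<in> K"
    "\<zeta> 0 = e"
proof -
  \<comment> \<open>the coefficient of \<open>t\<^sup>n\<close> in \<open>\<zeta>(t/q) \<zeta>(qt) = Z(t)\<close>, solved for \<open>\<zeta>\<^sub>n\<close>; its coefficient is \<open>q\<^sup>n + q\<^sup>-\<^sup>n\<close>\<close>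
  define F where "F n g = (if n = 0 then e else inverse (q ^ n + inverse q ^ n) *s
      (Z $ n - (\<Sum>i=1..<n. (inverse q ^ i * q ^ (n - i)) *s (g i * g (n - i)))))" for n and g :: "nat \<Rightarrow> 'u"
  obtain \<zeta> where \<zeta>: "\<And>n. \<zeta> n = F n \<zeta>"
    by (rule course_of_values[of F]) (auto simp: F_def intro!: sum.cong)
  \<comment> \<open>the coefficient of \<open>t\<^sup>n\<close> in \<open>\<eta>(t) \<zeta>(t) = 1\<close>, solved for \<open>\<eta>\<^sub>n\<close>\<close>
  define H where "H n g = (if n = 0 then e else - (\<Sum>i<n. g i * \<zeta> (n - i)))" for n and g :: "nat \<Rightarrow> 'u"
  obtain \<eta> where \<eta>: "\<And>n. \<eta> n = H n \<eta>"
    by (rule course_of_values[of H]) (auto simp: H_def intro!: sum.cong)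
  have \<zeta>_0: "\<zeta> 0 = e" and \<eta>_0: "\<eta> 0 = e" using \<zeta>[of 0] \<eta>[of 0] by (simp_all add: F_def H_def)
  have \<zeta>_K: "\<zeta> n \<in> K" if K: "is_subalg K" and Z: "\<And>k. Z $ k \<in> K" for K n
  proof (induction n rule: less_induct)
    case (less n)
    then show ?case
      by (subst \<zeta>) (auto simp: F_def intro!: closed_intros[OF K] Z)
  qed
  have \<eta>_K: "\<eta> n \<in> K" if K: "is_subalg K" and Z: "\<And>k. Z $ k \<in> K" for K n
  proof (induction n rule: less_induct)
    case (less n)
    then show ?case
      by (subst \<eta>) (auto simp: H_def intro!: closed_intros[OF K] \<zeta>_K[OF K Z])
  qed
  define B where "B = {x. e * x = x \<and> x * e = x}"
  have B: "is_subalg B" unfolding B_def is_subalg_def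
    by (auto simp: distrib_left distrib_right mult.assoc) (simp add: mult.assoc[symmetric])
  have fB: "f x n \<in> B" for x n by (simp add: B_def)
  have ZB: "Z $ n \<in> B" for n by (rule is_subalg_Z[OF B fB])
  have \<zeta>B: "\<zeta> n \<in> B" and \<eta>B: "\<eta> n \<in> B" for n by (rule \<zeta>_K[OF B ZB] \<eta>_K[OF B ZB])+
  \<comment> \<open>The double centralizer of the \<open>Z\<^sub>n\<close>. It contains the \<open>Z\<^sub>n\<close> because they commute with
    their own centralizer, and it is a subalgebra; so the coefficients
    of \<open>\<zeta>\<close> and \<open>\<eta>\<close> commute with the family and with each other.\<close>
  define C where "C = {x. \<forall>y\<in>B. (\<forall>n. Z $ n * y = y * Z $ n) \<longrightarrow> x * y = y * x}"
  have C: "is_subalg C"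
  proof -
    have "x * x' * y = y * (x * x')" if "x * y = y * x" "x' * y = y * x'" for x x' y :: 'u
      using that by (metis mult.assoc)
    then show ?thesis
      by (auto simp: is_subalg_def C_def B_def distrib_left distrib_right)
  qed
  have ZC: "Z $ n \<in> C" for n by (simp add: C_def)
  have \<zeta>C: "\<zeta> n \<in> C" and \<eta>C: "\<eta> n \<in> C" for n by (rule \<zeta>_K[OF C ZC] \<eta>_K[OF C ZC])+
  have comm_f: "x * f k n = f k n * x" and comm_Z: "x * Z $ n = Z $ n * x" if "x \<in> C" for x k n
    using that fB ZB Z_central Z_commute by (auto simp: C_def)
  have comm: "x * y = y * x" if "x \<in> C" "y \<in> C" "y \<in> B" for x y
    using that comm_Z[OF that(2)] by (auto simp: C_def)
  interpret S: central_scaling scale e q f \<eta>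
    by unfold_locales (use \<eta>_0 \<eta>B \<eta>C comm comm_f in \<open>auto simp: B_def\<close>)
  define zs where "zs = Abs_fps \<zeta>"
  have inv: "S.zser * zs = fps_const e"
  proof (rule fps_ext)
    fix n
    show "(S.zser * zs) $ n = fps_const e $ n"
    proof (cases n)
      case (Suc m)
      have "(S.zser * zs) $ n = (\<Sum>i<n. \<eta> i * \<zeta> (n - i)) + \<eta> n * \<zeta> 0"
        by (simp add: fps_mult_nth zs_def atLeast0AtMost lessThan_Suc_atMost[symmetric])
      also have "\<eta> n * \<zeta> 0 = \<eta> n" using \<eta>B[of n] by (simp add: \<zeta>_0 B_def)
      also have "\<eta> n = - (\<Sum>i<n. \<eta> i * \<zeta> (n - i))" by (subst \<eta>) (simp add: H_def Suc)
      finally show ?thesis by (simp add: Suc)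
    qed (simp add: \<eta>_0 \<zeta>_0 zs_def)
  qed
  have sq: "Z = twist (inverse q) zs * twist q zs"
  proof (rule fps_ext)
    fix n
    show "Z $ n = (twist (inverse q) zs * twist q zs) $ n"
    proof (cases n)
      case (Suc m)
      define r where "r i = (inverse q ^ i * q ^ (n - i)) *s (\<zeta> i * \<zeta> (n - i))" for i
      have "(twist (inverse q) zs * twist q zs) $ n = sum r {0..n}"
        by (simp add: fps_mult_nth zs_def r_def mult.commute)
      also have "{0..n} = insert 0 (insert n {1..<n})" using Suc by auto
      also have "sum r (insert 0 (insert n {1..<n})) = r 0 + r n + sum r {1..<n}"
        using Suc by (simp add: add.assoc)
      also have "r 0 + r n = (q ^ n + inverse q ^ n) *s \<zeta> n"
        using \<zeta>B[of n] by (simp add: r_def \<zeta>_0 B_def scale_left_distrib)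
      also have "\<dots> = Z $ n - sum r {1..<n}"
        using q_power_sum[of n] Suc by (subst \<zeta>) (simp add: F_def r_def)
      finally show ?thesis by simp
    qed (simp add: zs_def \<zeta>_0)
  qed
  have zc: "zs * S.zser = S.zser * zs"
    by (rule fps_mult_commute_if_nth) (simp add: zs_def comm \<zeta>C \<eta>C \<eta>B)
  have eq: "twist c zs * twist d S.zser = twist d S.zser * twist c zs" for c d
    by (rule fps_mult_commute_if_nth) (simp add: zs_def comm \<zeta>C \<eta>C \<eta>B mult.commute)
  have tinv: "twist c zs * twist c S.zser = fps_const e" for c
    using inv by (simp add: zc twist_mult[symmetric])
  have Z': "alternating.Z scale q S.scaled = fps_const e"
  proof -
    have "alternating.Z scale q S.scaled = twist (inverse q) zs * (twist q zs * twist (inverse q) S.zser) * twist q S.zser"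
      by (simp add: S.Z_scaled sq mult.assoc)
    also have "\<dots> = (twist (inverse q) zs * twist (inverse q) S.zser) * (twist q zs * twist q S.zser)"
      by (simp only: eq[of q "inverse q"] mult.assoc)
    finally show ?thesis by (simp add: tinv)
  qed
  have f: "f x n = (Abs_fps (S.scaled x) * Abs_fps \<zeta>) $ n" for x n
    unfolding zs_def[symmetric]
    by (simp add: S.scaled_ser mult.assoc inv)
  have K: "S.scaled x n \<in> K" if K: "is_subalg K" "f Wm 0 \<in> K" "f Wp 0 \<in> K" for K x n
  proof -
    interpret P: alternating_nonroot scale e q S.scaled
      by (intro alternating_nonroot.intro S.scaled_alternating alternating_nonroot_axioms.intro q0 nonroot)
    have Z: "P.Z $ n \<in> K" for n
      using Z' closed_e[OF K(1)] closed_zero[OF K(1)]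
      by simp
    show ?thesis
      by (rule P.generated_by_W0_W1[OF K(1)]) (simp_all only: S.scaled_0 K Z)
  qed
  show ?thesis
  proof (rule that[of S.scaled \<zeta>])
    show "\<zeta> n \<in> K" if "is_subalg K" "\<And>k. Z $ k \<in> K" for K n
      using that by (rule \<zeta>_K)
    show "S.scaled x n \<in> K" if "is_subalg K" "f Wm 0 \<in> K" "f Wp 0 \<in> K" for K x n
      using that by (rule K)
  qed (use S.scaled_alternating f Z' sq[unfolded zs_def] \<zeta>_0 in simp_all)
qed

end

section \<open>Algebras on carrier sets\<close>

locale assoc_algebra = ring A for A :: "('a::field, 'b) module" (structure) +
  assumes smult_closed [simp, intro]: "x \<in> carrier A \<Longrightarrow> c \<odot> x \<in> carrier A"
    and smult_l_distr: "x \<in> carrier A \<Longrightarrow> (c + d) \<odot> x = c \<odot> x \<oplus> d \<odot> x"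
    and smult_r_distr: "x \<in> carrier A \<Longrightarrow> y \<in> carrier A \<Longrightarrow> c \<odot> (x \<oplus> y) = c \<odot> x \<oplus> c \<odot> y"
    and smult_smult: "x \<in> carrier A \<Longrightarrow> c \<odot> (d \<odot> x) = (c * d) \<odot> x"
    and smult_one [simp]: "x \<in> carrier A \<Longrightarrow> 1 \<odot> x = x"
    and mult_smult_left: "x \<in> carrier A \<Longrightarrow> y \<in> carrier A \<Longrightarrow> (c \<odot> x) \<otimes> y = c \<odot> (x \<otimes> y)"
    and mult_smult_right: "x \<in> carrier A \<Longrightarrow> y \<in> carrier A \<Longrightarrow> x \<otimes> (c \<odot> y) = c \<odot> (x \<otimes> y)"
begin

lemma smult_zero_left [simp]: "x \<in> carrier A \<Longrightarrow> 0 \<odot> x = \<zero>"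
  using smult_l_distr[of x 0 0] by (metis add.r_cancel_one' add_0 smult_closed)

lemma smult_zero_right [simp]: "c \<odot> \<zero> = \<zero>"
  using smult_r_distr[of \<zero> \<zero> c] by (metis add.r_cancel_one' zero_closed l_zero smult_closed)

lemma smult_minus_one: "x \<in> carrier A \<Longrightarrow> (- 1) \<odot> x = \<ominus> x"
  using smult_l_distr[of x "- 1" 1] by (simp add: minus_equality)

lemma subalgebrasI:
  assumes "K \<subseteq> carrier A" "\<one> \<in> K"
    and "\<And>x y. x \<in> K \<Longrightarrow> y \<in> K \<Longrightarrow> x \<oplus> y \<in> K"
    and "\<And>x y. x \<in> K \<Longrightarrow> y \<in> K \<Longrightarrow> x \<otimes> y \<in> K"
    and "\<And>c x. x \<in> K \<Longrightarrow> c \<odot> x \<in> K"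
  shows "K \<in> subalgebras A"
proof -
  have "\<ominus> x \<in> K" if "x \<in> K" for x
    using assms(5)[OF that, of "- 1"] assms(1) that by (metis smult_minus_one subsetD)
  then have "subring K A" using assms by (intro subringI) auto
  then show ?thesis using assms(5) by (simp add: subalgebras_def)
qed

lemma carrier_subalgebra: "carrier A \<in> subalgebras A"
  by (rule subalgebrasI) auto

lemma subalgebra_is_algebra:
  assumes "K \<in> subalgebras A"
  shows "assoc_algebra (A\<lparr>carrier := K\<rparr>)"
proof -
  have K: "subring K A" and sm: "\<And>c x. x \<in> K \<Longrightarrow> c \<odot> x \<in> K"
    using assms by (auto simp: subalgebras_def)
  have "x \<in> K \<Longrightarrow> x \<in> carrier A" for x using subringE(1)[OF K] by auto
  with sm show ?thesis
    by (intro assoc_algebra.intro subring_is_ring[OF K] assoc_algebra_axioms.intro)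
      (simp_all add: smult_l_distr smult_r_distr smult_smult mult_smult_left mult_smult_right)
qed

lemma gen_subalgebra_carrier_subalgebra:
  assumes "S \<subseteq> carrier A"
  shows "carrier (gen_subalgebra A S) \<in> subalgebras A"
proof -
  have "subring K A \<Longrightarrow> K \<subseteq> carrier A" for K by (rule subringE(1))
  then show ?thesis
    using assms carrier_subalgebra unfolding gen_subalgebra_def
    by (intro subalgebrasI)
      (auto simp: subalgebras_def subringE(3,6,7))
qed

lemma gen_subalgebra_is_algebra: "S \<subseteq> carrier A \<Longrightarrow> assoc_algebra (gen_subalgebra A S)"
  using subalgebra_is_algebra[OF gen_subalgebra_carrier_subalgebra, of S] by (simp add: gen_subalgebra_def)

lemma gen_subalgebra_subset: "S \<subseteq> carrier A \<Longrightarrow> carrier (gen_subalgebra A S) \<subseteq> carrier A"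
  using carrier_subalgebra by (auto simp: gen_subalgebra_def)

end

lemma gen_subalgebra_self: "S \<subseteq> carrier (gen_subalgebra A S)"
  by (auto simp: gen_subalgebra_def)

lemma gen_subalgebra_minimal: "K \<in> subalgebras A \<Longrightarrow> S \<subseteq> K \<Longrightarrow> carrier (gen_subalgebra A S) \<subseteq> K"
  by (auto simp: gen_subalgebra_def)

lemma gen_subalgebra_simps [simp]:
  "x \<otimes>\<^bsub>gen_subalgebra A S\<^esub> y = x \<otimes>\<^bsub>A\<^esub> y" "x \<oplus>\<^bsub>gen_subalgebra A S\<^esub> y = x \<oplus>\<^bsub>A\<^esub> y"
  "c \<odot>\<^bsub>gen_subalgebra A S\<^esub> x = c \<odot>\<^bsub>A\<^esub> x" "\<one>\<^bsub>gen_subalgebra A S\<^esub> = \<one>\<^bsub>A\<^esub>"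
  "\<zero>\<^bsub>gen_subalgebra A S\<^esub> = \<zero>\<^bsub>A\<^esub>"
  by (simp_all add: gen_subalgebra_def)

definition alg_hom :: "('a::field, 'b) module \<Rightarrow> ('a, 'c) module \<Rightarrow> ('b \<Rightarrow> 'c) set" where
  "alg_hom A B = {h \<in> ring_hom A B. \<forall>c. \<forall>x\<in>carrier A. h (c \<odot>\<^bsub>A\<^esub> x) = c \<odot>\<^bsub>B\<^esub> h x}"

lemma alg_homI:
  assumes "\<And>x. x \<in> carrier A \<Longrightarrow> h x \<in> carrier B"
    and "\<And>x y. x \<in> carrier A \<Longrightarrow> y \<in> carrier A \<Longrightarrow> h (x \<otimes>\<^bsub>A\<^esub> y) = h x \<otimes>\<^bsub>B\<^esub> h y"
    and "\<And>x y. x \<in> carrier A \<Longrightarrow> y \<in> carrier A \<Longrightarrow> h (x \<oplus>\<^bsub>A\<^esub> y) = h x \<oplus>\<^bsub>B\<^esub> h y"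
    and "h \<one>\<^bsub>A\<^esub> = \<one>\<^bsub>B\<^esub>"
    and "\<And>c x. x \<in> carrier A \<Longrightarrow> h (c \<odot>\<^bsub>A\<^esub> x) = c \<odot>\<^bsub>B\<^esub> h x"
  shows "h \<in> alg_hom A B"
  using assms by (auto simp: alg_hom_def intro!: ring_hom_memI)

lemma
  assumes "h \<in> alg_hom A B"
  shows alg_hom_closed: "x \<in> carrier A \<Longrightarrow> h x \<in> carrier B"
    and alg_hom_mult: "x \<in> carrier A \<Longrightarrow> y \<in> carrier A \<Longrightarrow> h (x \<otimes>\<^bsub>A\<^esub> y) = h x \<otimes>\<^bsub>B\<^esub> h y"
    and alg_hom_add: "x \<in> carrier A \<Longrightarrow> y \<in> carrier A \<Longrightarrow> h (x \<oplus>\<^bsub>A\<^esub> y) = h x \<oplus>\<^bsub>B\<^esub> h y"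
    and alg_hom_one: "h \<one>\<^bsub>A\<^esub> = \<one>\<^bsub>B\<^esub>"
    and alg_hom_smult: "x \<in> carrier A \<Longrightarrow> h (c \<odot>\<^bsub>A\<^esub> x) = c \<odot>\<^bsub>B\<^esub> h x"
  using assms by (auto simp: alg_hom_def ring_hom_mult ring_hom_add ring_hom_one ring_hom_closed)

lemma
  assumes h: "h \<in> alg_hom A B" and "assoc_algebra A" "assoc_algebra B"
  shows alg_hom_zero: "h \<zero>\<^bsub>A\<^esub> = \<zero>\<^bsub>B\<^esub>"
    and alg_hom_minus: "x \<in> carrier A \<Longrightarrow> y \<in> carrier A \<Longrightarrow> h (x \<ominus>\<^bsub>A\<^esub> y) = h x \<ominus>\<^bsub>B\<^esub> h y"
    and alg_hom_finsum: "g \<in> I \<rightarrow> carrier A \<Longrightarrow> finite I \<Longrightarrow> h (finsum A g I) = finsum B (\<lambda>i. h (g i)) I"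
proof -
  interpret A: assoc_algebra A by fact
  interpret B: assoc_algebra B by fact
  show z: "h \<zero>\<^bsub>A\<^esub> = \<zero>\<^bsub>B\<^esub>"
    using alg_hom_smult[OF h A.zero_closed, of 0] alg_hom_closed[OF h A.zero_closed] by simp
  have m: "h (\<ominus>\<^bsub>A\<^esub> y) = \<ominus>\<^bsub>B\<^esub> h y" if "y \<in> carrier A" for y
    using alg_hom_smult[OF h that, of "- 1"] that alg_hom_closed[OF h that]
    by (simp add: A.smult_minus_one B.smult_minus_one)
  show "h (x \<ominus>\<^bsub>A\<^esub> y) = h x \<ominus>\<^bsub>B\<^esub> h y" if "x \<in> carrier A" "y \<in> carrier A"
    using that by (simp add: a_minus_def alg_hom_add[OF h] m)
  show "h (finsum A g I) = finsum B (\<lambda>i. h (g i)) I" if "g \<in> I \<rightarrow> carrier A" "finite I"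
    using that(2,1)
  proof (induction I rule: finite_induct)
    case (insert i I)
    then have "g i \<in> carrier A" "g \<in> I \<rightarrow> carrier A" by auto
    with insert show ?case
      using alg_hom_closed[OF h] by (simp add: alg_hom_add[OF h] A.finsum_closed Pi_iff)
  qed (simp add: z)
qed

text \<open>
  The equalizer of two homomorphisms is a subalgebra.
\<close>
lemma gen_subalgebra_hom_eq:
  assumes A: "assoc_algebra A" and S: "S \<subseteq> carrier A"
    and h: "h \<in> alg_hom (gen_subalgebra A S) C" and h': "h' \<in> alg_hom (gen_subalgebra A S) C"
    and eq: "\<And>x. x \<in> S \<Longrightarrow> h x = h' x" and x: "x \<in> carrier (gen_subalgebra A S)"
  shows "h x = h' x"
proof -
  interpret A: assoc_algebra A by (rule A)
  interpret G: assoc_algebra "gen_subalgebra A S" by (rule A.gen_subalgebra_is_algebra[OF S])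
  have "{x \<in> carrier (gen_subalgebra A S). h x = h' x} \<in> subalgebras A"
    using alg_hom_one[OF h] alg_hom_one[OF h'] alg_hom_add[OF h] alg_hom_add[OF h']
      alg_hom_mult[OF h] alg_hom_mult[OF h'] alg_hom_smult[OF h] alg_hom_smult[OF h']
      G.one_closed G.a_closed G.m_closed G.smult_closed A.gen_subalgebra_subset[OF S]
    by (intro A.subalgebrasI) auto
  from gen_subalgebra_minimal[OF this] show ?thesis
    using x eq gen_subalgebra_self[of S A] by blast
qed

lemma alg_hom_image_subalgebra:
  assumes "assoc_algebra A" and "assoc_algebra B" and h: "h \<in> alg_hom A B"
  shows "h ` carrier A \<in> subalgebras B"
proof -
  interpret A: assoc_algebra A by fact
  interpret B: assoc_algebra B by fact
  show ?thesis
    by (rule B.subalgebrasI)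
      (auto simp: alg_hom_closed[OF h] alg_hom_one[OF h, symmetric] alg_hom_add[OF h, symmetric]
        alg_hom_mult[OF h, symmetric] alg_hom_smult[OF h, symmetric])
qed

text \<open>
  The zero element is a separate hypothesis because the target is a bare record: it could be any element there.
\<close>
lemma assoc_algebra_image:
  assumes "assoc_algebra A" and h: "h \<in> alg_hom A B" and surj: "carrier B \<subseteq> h ` carrier A"
    and zero: "h \<zero>\<^bsub>A\<^esub> = \<zero>\<^bsub>B\<^esub>"
  shows "assoc_algebra B"
proof -
  interpret A: assoc_algebra A by fact
  note hs = alg_hom_mult[OF h, symmetric] alg_hom_add[OF h, symmetric] alg_hom_smult[OF h, symmetric]
    alg_hom_one[OF h, symmetric] zero[symmetric]
  note cl = alg_hom_closed[OF h]
  have pre: "\<exists>a\<in>carrier A. y = h a" if "y \<in> carrier B" for y using that surj by auto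
  have "abelian_group B"
  proof (rule abelian_groupI)
    fix x assume "x \<in> carrier B"
    then obtain a where a: "a \<in> carrier A" "x = h a" using pre by blast
    then show "\<exists>y\<in>carrier B. y \<oplus>\<^bsub>B\<^esub> x = \<zero>\<^bsub>B\<^esub>"
      by (intro bexI[of _ "h (\<ominus>\<^bsub>A\<^esub> a)"]) (simp_all add: hs cl A.l_neg)
  qed (auto dest!: pre simp: hs cl A.a_assoc A.a_comm A.a_lcomm)
  moreover have "Group.monoid B"
    by (rule monoidI) (auto dest!: pre simp: hs cl A.m_assoc)
  ultimately have "ring B"
    by (rule ringI) (auto dest!: pre simp: hs cl A.l_distr A.r_distr)
  then show ?thesis
    by (intro assoc_algebra.intro assoc_algebra_axioms.intro)
      (auto dest!: pre simp: hs cl A.smult_l_distr A.smult_r_distr A.smult_smult A.mult_smult_left A.mult_smult_right)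
qed

section \<open>Quotients\<close>

context
  fixes A :: "('a::field, 'b) module" and I
  assumes A: "assoc_algebra A" and I: "ideal I A"
begin

interpretation A: assoc_algebra A by (rule A)
interpretation I: ideal I A by (rule I)

lemma coset_eq_iff: "x \<in> carrier A \<Longrightarrow> y \<in> carrier A \<Longrightarrow> I +>\<^bsub>A\<^esub> x = I +>\<^bsub>A\<^esub> y \<longleftrightarrow> x \<ominus>\<^bsub>A\<^esub> y \<in> I"
  using A.quotient_eq_iff_same_a_r_cos[OF I] by blast

lemma carrier_alg_quot: "carrier (alg_quot A I) = (\<lambda>x. I +>\<^bsub>A\<^esub> x) ` carrier A"
  by (auto simp: alg_quot_def FactRing_def A_RCOSETS_def' a_r_coset_def)

lemma ideal_smult: "x \<in> I \<Longrightarrow> c \<odot>\<^bsub>A\<^esub> x \<in> I"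
  using I.I_l_closed[of x "c \<odot>\<^bsub>A\<^esub> \<one>\<^bsub>A\<^esub>"] I.Icarr by (simp add: A.mult_smult_left)

lemma alg_quot_hom: "(\<lambda>x. I +>\<^bsub>A\<^esub> x) \<in> alg_hom A (alg_quot A I)"
proof (rule alg_homI)
  fix c x assume x: "x \<in> carrier A"
  have "I +>\<^bsub>A\<^esub> (c \<odot>\<^bsub>A\<^esub> y) = I +>\<^bsub>A\<^esub> (c \<odot>\<^bsub>A\<^esub> x)" if "y \<in> I +>\<^bsub>A\<^esub> x" for y
  proof -
    from that obtain i where i: "i \<in> I" "y = i \<oplus>\<^bsub>A\<^esub> x" by (auto simp: a_r_coset_def')
    then have ic: "i \<in> carrier A" and ci: "c \<odot>\<^bsub>A\<^esub> i \<in> carrier A" and cx: "c \<odot>\<^bsub>A\<^esub> x \<in> carrier A"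
      using x I.Icarr[of i] by auto
    have "c \<odot>\<^bsub>A\<^esub> y \<ominus>\<^bsub>A\<^esub> c \<odot>\<^bsub>A\<^esub> x = c \<odot>\<^bsub>A\<^esub> i"
      by (simp only: i(2) A.smult_r_distr[OF ic x] a_minus_def A.a_assoc[OF ci cx A.a_inv_closed[OF cx]]
          A.r_neg[OF cx] A.r_zero[OF ci])
    moreover have "c \<odot>\<^bsub>A\<^esub> y \<in> carrier A" using i(2) ic x by simp
    ultimately show ?thesis
      using coset_eq_iff[OF _ cx] ideal_smult[OF i(1)] by simp
  qed
  moreover have "x \<in> I +>\<^bsub>A\<^esub> x" using x by (rule I.a_rcos_self)
  ultimately have "(\<Union>y\<in>I +>\<^bsub>A\<^esub> x. I +>\<^bsub>A\<^esub> (c \<odot>\<^bsub>A\<^esub> y)) = I +>\<^bsub>A\<^esub> (c \<odot>\<^bsub>A\<^esub> x)"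
    by (intro UN_constant_eq ballI)
  then show "I +>\<^bsub>A\<^esub> (c \<odot>\<^bsub>A\<^esub> x) = c \<odot>\<^bsub>alg_quot A I\<^esub> (I +>\<^bsub>A\<^esub> x)"
    by (simp add: alg_quot_def)
qed (auto simp: carrier_alg_quot, auto simp: alg_quot_def FactRing_def I.rcoset_mult_add I.a_rcos_sum)

lemma alg_quot_is_algebra: "assoc_algebra (alg_quot A I)"
proof (rule assoc_algebra_image[OF A alg_quot_hom])
  show "I +>\<^bsub>A\<^esub> \<zero>\<^bsub>A\<^esub> = \<zero>\<^bsub>alg_quot A I\<^esub>"
    by (auto simp: alg_quot_def FactRing_def a_r_coset_def' I.Icarr)
qed (simp add: carrier_alg_quot)

lemma alg_quot_lift:
  assumes h: "h \<in> alg_hom A C" and C: "assoc_algebra C" and ker: "\<And>i. i \<in> I \<Longrightarrow> h i = \<zero>\<^bsub>C\<^esub>"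
  obtains h' where "h' \<in> alg_hom (alg_quot A I) C" "\<And>x. x \<in> carrier A \<Longrightarrow> h' (I +>\<^bsub>A\<^esub> x) = h x"
proof -
  interpret C: assoc_algebra C by (rule C)
  define h' where "h' X = h (SOME x. x \<in> carrier A \<and> X = I +>\<^bsub>A\<^esub> x)" for X
  have h': "h' (I +>\<^bsub>A\<^esub> x) = h x" if x: "x \<in> carrier A" for x
  proof -
    define y where "y = (SOME y. y \<in> carrier A \<and> I +>\<^bsub>A\<^esub> x = I +>\<^bsub>A\<^esub> y)"
    have y: "y \<in> carrier A" "I +>\<^bsub>A\<^esub> x = I +>\<^bsub>A\<^esub> y"
      using someI[of "\<lambda>y. y \<in> carrier A \<and> I +>\<^bsub>A\<^esub> x = I +>\<^bsub>A\<^esub> y" x] x unfolding y_def by auto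
    then have "x \<ominus>\<^bsub>A\<^esub> y \<in> I" using x coset_eq_iff by blast
    then have "h x \<ominus>\<^bsub>C\<^esub> h y = \<zero>\<^bsub>C\<^esub>"
      using ker alg_hom_minus[OF h A C x y(1)] by simp
    then have "h x = h y" using alg_hom_closed[OF h] x y(1) by simp
    then show ?thesis unfolding h'_def y_def by simp
  qed
  have "h' \<in> alg_hom (alg_quot A I) C"
    by (rule alg_homI; (unfold carrier_alg_quot)?)
      (auto simp: h' alg_hom_closed[OF h] alg_hom_mult[OF alg_quot_hom, symmetric] alg_hom_mult[OF h]
        alg_hom_add[OF alg_quot_hom, symmetric] alg_hom_add[OF h] alg_hom_one[OF alg_quot_hom, symmetric] alg_hom_one[OF h]
        alg_hom_smult[OF alg_quot_hom, symmetric] alg_hom_smult[OF h])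
  then show ?thesis using h' by (rule that)
qed

end

section \<open>Monoid algebras\<close>

lemma lookup_map_times [simp]:
  "Poly_Mapping.lookup (Poly_Mapping.map ((*) (c::'a::field)) p) x = c * Poly_Mapping.lookup p x"
  by (simp add: Poly_Mapping.map.rep_eq when_def)

lemma map_times_single [simp]:
  "Poly_Mapping.map ((*) (c::'a::field)) (Poly_Mapping.single x a) = Poly_Mapping.single x (c * a)"
  by (rule poly_mapping_eqI) (simp add: lookup_single when_def)

interpretation pm: Modules.module "\<lambda>c::'a::field. Poly_Mapping.map ((*) c) :: ('m \<Rightarrow>\<^sub>0 'a) \<Rightarrow> _"
  by unfold_locales (auto intro!: poly_mapping_eqI simp: lookup_add algebra_simps)

lemma poly_mapping_singles:
  fixes p :: "'m \<Rightarrow>\<^sub>0 'a::comm_monoid_add"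
  shows "p = (\<Sum>x\<in>Poly_Mapping.keys p. Poly_Mapping.single x (Poly_Mapping.lookup p x))"
  by (rule poly_mapping_eqI)
    (simp add: lookup_sum lookup_single when_def in_keys_iff)

text \<open>
  Every statement about a monoid algebra that is additive reduces to the basis elements.
\<close>
lemma poly_mapping_singles_induct [consumes 1, case_names zero add single]:
  fixes p :: "'m \<Rightarrow>\<^sub>0 'a::comm_monoid_add"
  assumes "Poly_Mapping.keys p \<subseteq> S" and "P 0" and "\<And>p r. P p \<Longrightarrow> P r \<Longrightarrow> P (p + r)"
    and "\<And>x c. x \<in> S \<Longrightarrow> P (Poly_Mapping.single x c)"
  shows "P p"
proof -
  have "P (\<Sum>x\<in>X. Poly_Mapping.single x (Poly_Mapping.lookup p x))" if "finite X" "X \<subseteq> S" for X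
    using that by (induction X rule: finite_induct) (auto intro: assms)
  from this[of "Poly_Mapping.keys p"] assms(1) show ?thesis
    using poly_mapping_singles[of p] by simp
qed

lemma monoid_algebra_simps [simp]:
  "carrier (monoid_algebra M) = {p. Poly_Mapping.keys p \<subseteq> carrier M}"
  "p \<oplus>\<^bsub>monoid_algebra M\<^esub> r = p + r"
  "\<zero>\<^bsub>monoid_algebra M\<^esub> = 0"
  "\<one>\<^bsub>monoid_algebra M\<^esub> = Poly_Mapping.single \<one>\<^bsub>M\<^esub> 1"
  "c \<odot>\<^bsub>monoid_algebra M\<^esub> p = Poly_Mapping.map ((*) c) p"
  by (simp_all add: monoid_algebra_def)

lemma monoid_algebra_mult_supset:
  assumes "finite S" "Poly_Mapping.keys p \<subseteq> S" "finite T" "Poly_Mapping.keys r \<subseteq> T"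
  shows "p \<otimes>\<^bsub>monoid_algebra M\<^esub> r = (\<Sum>x\<in>S. \<Sum>y\<in>T.
    Poly_Mapping.single (x \<otimes>\<^bsub>M\<^esub> y) (Poly_Mapping.lookup p x * Poly_Mapping.lookup r y))"
proof -
  have "p \<otimes>\<^bsub>monoid_algebra M\<^esub> r = (\<Sum>x\<in>Poly_Mapping.keys p. \<Sum>y\<in>T.
    Poly_Mapping.single (x \<otimes>\<^bsub>M\<^esub> y) (Poly_Mapping.lookup p x * Poly_Mapping.lookup r y))"
    by (simp add: monoid_algebra_def, rule sum.cong[OF refl], rule sum.mono_neutral_left)
      (use assms in \<open>auto simp: in_keys_iff\<close>)
  also have "\<dots> = (\<Sum>x\<in>S. \<Sum>y\<in>T.
    Poly_Mapping.single (x \<otimes>\<^bsub>M\<^esub> y) (Poly_Mapping.lookup p x * Poly_Mapping.lookup r y))"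
    using assms by (intro sum.mono_neutral_left) (auto simp: in_keys_iff)
  finally show ?thesis .
qed

lemma monoid_algebra_distrib:
  "(p + p') \<otimes>\<^bsub>monoid_algebra M\<^esub> r = p \<otimes>\<^bsub>monoid_algebra M\<^esub> r + p' \<otimes>\<^bsub>monoid_algebra M\<^esub> r"
  "p \<otimes>\<^bsub>monoid_algebra M\<^esub> (r + r') = p \<otimes>\<^bsub>monoid_algebra M\<^esub> r + p \<otimes>\<^bsub>monoid_algebra M\<^esub> r'"
proof -
  let ?S = "Poly_Mapping.keys p \<union> Poly_Mapping.keys p'" and ?T = "Poly_Mapping.keys r \<union> Poly_Mapping.keys r'"
  note exp = monoid_algebra_mult_supset[of ?S _ ?T]
  have k: "Poly_Mapping.keys (p + p') \<subseteq> ?S" "Poly_Mapping.keys (r + r') \<subseteq> ?T" by (rule keys_add)+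
  show "(p + p') \<otimes>\<^bsub>monoid_algebra M\<^esub> r = p \<otimes>\<^bsub>monoid_algebra M\<^esub> r + p' \<otimes>\<^bsub>monoid_algebra M\<^esub> r"
    using k by (simp add: exp lookup_add distrib_right single_add sum.distrib)
  show "p \<otimes>\<^bsub>monoid_algebra M\<^esub> (r + r') = p \<otimes>\<^bsub>monoid_algebra M\<^esub> r + p \<otimes>\<^bsub>monoid_algebra M\<^esub> r'"
    using k by (simp add: exp lookup_add distrib_left single_add sum.distrib)
qed

lemma monoid_algebra_diff:
  "(p - p') \<otimes>\<^bsub>monoid_algebra M\<^esub> r = p \<otimes>\<^bsub>monoid_algebra M\<^esub> r - p' \<otimes>\<^bsub>monoid_algebra M\<^esub> r"
  "p \<otimes>\<^bsub>monoid_algebra M\<^esub> (r - r') = p \<otimes>\<^bsub>monoid_algebra M\<^esub> r - p \<otimes>\<^bsub>monoid_algebra M\<^esub> r'"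
  using monoid_algebra_distrib(1)[of M "p - p'" p' r] monoid_algebra_distrib(2)[of M p "r - r'" r']
  by (simp_all add: algebra_simps)

lemma monoid_algebra_single_mult [simp]:
  "Poly_Mapping.single x a \<otimes>\<^bsub>monoid_algebra M\<^esub> Poly_Mapping.single y b
    = Poly_Mapping.single (x \<otimes>\<^bsub>M\<^esub> y) (a * b)"
  by (subst monoid_algebra_mult_supset[of "{x}" _ "{y}"]) auto

lemma monoid_algebra_zero_mult [simp]:
  "0 \<otimes>\<^bsub>monoid_algebra M\<^esub> p = 0" "p \<otimes>\<^bsub>monoid_algebra M\<^esub> 0 = 0"
  by (simp_all add: monoid_algebra_def)

lemma keys_map_times: "Poly_Mapping.keys (Poly_Mapping.map ((*) (c::'a::field)) p) \<subseteq> Poly_Mapping.keys p"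
  by (auto simp: in_keys_iff)

lemma keys_add_subset: "Poly_Mapping.keys p \<subseteq> S \<Longrightarrow> Poly_Mapping.keys r \<subseteq> S \<Longrightarrow> Poly_Mapping.keys (p + r) \<subseteq> S"
  using keys_add[of p r] by auto

lemma monoid_algebra_is_algebra:
  assumes "Group.monoid M"
  shows "assoc_algebra (monoid_algebra M :: ('a::field, 'm \<Rightarrow>\<^sub>0 'a) module)" (is "assoc_algebra ?A")
proof -
  interpret M: Group.monoid M by fact
  have closed: "p \<otimes>\<^bsub>?A\<^esub> r \<in> carrier ?A" if "p \<in> carrier ?A" "r \<in> carrier ?A" for p r
  proof -
    have r: "Poly_Mapping.keys r \<subseteq> carrier M" using that by simp
    from that have "Poly_Mapping.keys p \<subseteq> carrier M" by simp
    then show ?thesis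
    proof (induction p rule: poly_mapping_singles_induct)
      case (single x c)
      from r show ?case
        by (induction r rule: poly_mapping_singles_induct)
          (use single in \<open>auto simp: monoid_algebra_distrib keys_add_subset\<close>)
    qed (auto simp: monoid_algebra_distrib keys_add_subset)
  qed
  have assoc: "(p \<otimes>\<^bsub>?A\<^esub> r) \<otimes>\<^bsub>?A\<^esub> s = p \<otimes>\<^bsub>?A\<^esub> (r \<otimes>\<^bsub>?A\<^esub> s)"
    if "p \<in> carrier ?A" "r \<in> carrier ?A" "s \<in> carrier ?A" for p r s
  proof -
    have r: "Poly_Mapping.keys r \<subseteq> carrier M" and s: "Poly_Mapping.keys s \<subseteq> carrier M" using that by auto
    from that have "Poly_Mapping.keys p \<subseteq> carrier M" by simp
    then show ?thesis
    proof (induction p rule: poly_mapping_singles_induct)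
      case x: (single x c)
      from r show ?case
      proof (induction r rule: poly_mapping_singles_induct)
        case (single y d)
        from s show ?case
          by (induction s rule: poly_mapping_singles_induct)
            (use x single in \<open>auto simp: monoid_algebra_distrib M.m_assoc mult.assoc\<close>)
      qed (auto simp: monoid_algebra_distrib)
    qed (auto simp: monoid_algebra_distrib)
  qed
  have one: "\<one>\<^bsub>?A\<^esub> \<otimes>\<^bsub>?A\<^esub> p = p" "p \<otimes>\<^bsub>?A\<^esub> \<one>\<^bsub>?A\<^esub> = p" if "p \<in> carrier ?A" for p
  proof -
    from that have "Poly_Mapping.keys p \<subseteq> carrier M" by simp
    then have "\<one>\<^bsub>?A\<^esub> \<otimes>\<^bsub>?A\<^esub> p = p \<and> p \<otimes>\<^bsub>?A\<^esub> \<one>\<^bsub>?A\<^esub> = p"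
      by (induction p rule: poly_mapping_singles_induct) (auto simp: monoid_algebra_distrib)
    then show "\<one>\<^bsub>?A\<^esub> \<otimes>\<^bsub>?A\<^esub> p = p" "p \<otimes>\<^bsub>?A\<^esub> \<one>\<^bsub>?A\<^esub> = p" by auto
  qed
  have smult: "Poly_Mapping.map ((*) c) p \<otimes>\<^bsub>?A\<^esub> r = Poly_Mapping.map ((*) c) (p \<otimes>\<^bsub>?A\<^esub> r)"
    "p \<otimes>\<^bsub>?A\<^esub> Poly_Mapping.map ((*) c) r = Poly_Mapping.map ((*) c) (p \<otimes>\<^bsub>?A\<^esub> r)" for c p r
  proof -
    have "Poly_Mapping.keys p \<subseteq> UNIV" by simp
    then have "Poly_Mapping.map ((*) c) p \<otimes>\<^bsub>?A\<^esub> r = Poly_Mapping.map ((*) c) (p \<otimes>\<^bsub>?A\<^esub> r)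
      \<and> p \<otimes>\<^bsub>?A\<^esub> Poly_Mapping.map ((*) c) r = Poly_Mapping.map ((*) c) (p \<otimes>\<^bsub>?A\<^esub> r)"
    proof (induction p rule: poly_mapping_singles_induct)
      case (single x d)
      have "Poly_Mapping.keys r \<subseteq> UNIV" by simp
      then show ?case
        by (induction r rule: poly_mapping_singles_induct)
          (auto simp: monoid_algebra_distrib pm.scale_right_distrib mult.assoc mult.left_commute)
    qed (auto simp: monoid_algebra_distrib pm.scale_right_distrib)
    then show "Poly_Mapping.map ((*) c) p \<otimes>\<^bsub>?A\<^esub> r = Poly_Mapping.map ((*) c) (p \<otimes>\<^bsub>?A\<^esub> r)"
      "p \<otimes>\<^bsub>?A\<^esub> Poly_Mapping.map ((*) c) r = Poly_Mapping.map ((*) c) (p \<otimes>\<^bsub>?A\<^esub> r)" by auto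
  qed
  have "abelian_group ?A"
  proof (rule abelian_groupI)
    fix p assume "p \<in> carrier ?A"
    then show "\<exists>r\<in>carrier ?A. r \<oplus>\<^bsub>?A\<^esub> p = \<zero>\<^bsub>?A\<^esub>"
      by (intro bexI[of _ "- p"]) auto
  qed (auto simp: keys_add_subset add.assoc add.commute)
  moreover have "Group.monoid ?A"
    using closed assoc one by (intro monoidI) auto
  ultimately have "ring ?A"
    by (rule ringI) (simp_all add: monoid_algebra_distrib)
  then show ?thesis
    by (intro assoc_algebra.intro assoc_algebra_axioms.intro)
      (use keys_map_times in \<open>fastforce simp: smult pm.scale_left_distrib pm.scale_right_distrib\<close>)+
qed

definition linear_extension :: "('a::field, 'c) module \<Rightarrow> ('m \<Rightarrow> 'c) \<Rightarrow> ('m \<Rightarrow>\<^sub>0 'a) \<Rightarrow> 'c" where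
  "linear_extension C h p = (\<Oplus>\<^bsub>C\<^esub>x\<in>Poly_Mapping.keys p. Poly_Mapping.lookup p x \<odot>\<^bsub>C\<^esub> h x)"

lemma
  assumes "assoc_algebra C" and h: "h \<in> X \<rightarrow> carrier C"
  shows linear_extension_closed: "Poly_Mapping.keys p \<subseteq> X \<Longrightarrow> linear_extension C h p \<in> carrier C"
    and linear_extension_add: "Poly_Mapping.keys p \<subseteq> X \<Longrightarrow> Poly_Mapping.keys r \<subseteq> X \<Longrightarrow>
      linear_extension C h (p + r) = linear_extension C h p \<oplus>\<^bsub>C\<^esub> linear_extension C h r"
    and linear_extension_single: "x \<in> X \<Longrightarrow> linear_extension C h (Poly_Mapping.single x c) = c \<odot>\<^bsub>C\<^esub> h x"
proof -
  interpret C: assoc_algebra C by fact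
  have hX: "h x \<in> carrier C" if "x \<in> X" for x using h that by auto
  have sup: "linear_extension C h p = (\<Oplus>\<^bsub>C\<^esub>x\<in>S. Poly_Mapping.lookup p x \<odot>\<^bsub>C\<^esub> h x)"
    if "finite S" "Poly_Mapping.keys p \<subseteq> S" "S \<subseteq> X" for S p
    unfolding linear_extension_def using that hX
    by (intro C.add.finprod_mono_neutral_cong_left) (auto simp: in_keys_iff)
  show "linear_extension C h p \<in> carrier C" if "Poly_Mapping.keys p \<subseteq> X"
    unfolding linear_extension_def using that hX by (intro C.finsum_closed) auto
  show "linear_extension C h (p + r) = linear_extension C h p \<oplus>\<^bsub>C\<^esub> linear_extension C h r"
    if X: "Poly_Mapping.keys p \<subseteq> X" "Poly_Mapping.keys r \<subseteq> X"
  proof -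
    let ?S = "Poly_Mapping.keys p \<union> Poly_Mapping.keys r"
    have "linear_extension C h (p + r) = (\<Oplus>\<^bsub>C\<^esub>x\<in>?S. Poly_Mapping.lookup p x \<odot>\<^bsub>C\<^esub> h x \<oplus>\<^bsub>C\<^esub> Poly_Mapping.lookup r x \<odot>\<^bsub>C\<^esub> h x)"
      using X keys_add[of p r] hX
      by (subst sup[of ?S]) (auto simp: lookup_add C.smult_l_distr intro!: C.finsum_cong')
    also have "\<dots> = linear_extension C h p \<oplus>\<^bsub>C\<^esub> linear_extension C h r"
      using X hX by (subst C.finsum_addf) (auto simp: sup[of ?S])
    finally show ?thesis .
  qed
  show "linear_extension C h (Poly_Mapping.single x c) = c \<odot>\<^bsub>C\<^esub> h x" if "x \<in> X"
    using hX[OF that] that by (subst sup[of "{x}"]) (auto simp: Pi_iff)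
qed

lemma linear_extension_hom:
  fixes C :: "('a::field, 'c) module"
  assumes "Group.monoid M" and C: "assoc_algebra C" and h: "h \<in> carrier M \<rightarrow> carrier C"
    and mult: "\<And>x y. x \<in> carrier M \<Longrightarrow> y \<in> carrier M \<Longrightarrow> h (x \<otimes>\<^bsub>M\<^esub> y) = h x \<otimes>\<^bsub>C\<^esub> h y"
    and one: "h \<one>\<^bsub>M\<^esub> = \<one>\<^bsub>C\<^esub>"
  shows "linear_extension C h \<in> alg_hom (monoid_algebra M) C"
proof -
  interpret M: Group.monoid M by fact
  interpret C: assoc_algebra C by fact
  interpret A: assoc_algebra "monoid_algebra M :: ('a, _) module" by (rule monoid_algebra_is_algebra) fact
  note le = linear_extension_closed[OF C h] linear_extension_add[OF C h] linear_extension_single[OF C h]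
  have hc: "h x \<in> carrier C" if "x \<in> carrier M" for x using h that by auto
  have zero: "linear_extension C h 0 = \<zero>\<^bsub>C\<^esub>" by (simp add: linear_extension_def)
  show ?thesis
  proof (rule alg_homI)
    fix p r :: "_ \<Rightarrow>\<^sub>0 'a" assume "p \<in> carrier (monoid_algebra M)" "r \<in> carrier (monoid_algebra M)"
    then have p: "Poly_Mapping.keys p \<subseteq> carrier M" and r: "Poly_Mapping.keys r \<subseteq> carrier M" by auto
    have "Poly_Mapping.keys p \<subseteq> carrier M \<and> linear_extension C h (p \<otimes>\<^bsub>monoid_algebra M\<^esub> r) = linear_extension C h p \<otimes>\<^bsub>C\<^esub> linear_extension C h r"
      using p
    proof (induction p rule: poly_mapping_singles_induct)
      case zero
      then show ?case using r by (simp add: \<open>linear_extension C h 0 = \<zero>\<^bsub>C\<^esub>\<close> le)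
    next
      case (add p p')
      moreover have "Poly_Mapping.keys (p \<otimes>\<^bsub>monoid_algebra M\<^esub> r) \<subseteq> carrier M" "Poly_Mapping.keys (p' \<otimes>\<^bsub>monoid_algebra M\<^esub> r) \<subseteq> carrier M"
        using A.m_closed add r by auto
      ultimately show ?case using r
        by (simp add: monoid_algebra_distrib le C.l_distr keys_add_subset)
    next
      case x: (single x c)
      have "Poly_Mapping.keys r \<subseteq> carrier M \<and> linear_extension C h (Poly_Mapping.single x c \<otimes>\<^bsub>monoid_algebra M\<^esub> r) = linear_extension C h (Poly_Mapping.single x c) \<otimes>\<^bsub>C\<^esub> linear_extension C h r"
        using r
      proof (induction r rule: poly_mapping_singles_induct)
        case zero
        then show ?case using x by (simp add: \<open>linear_extension C h 0 = \<zero>\<^bsub>C\<^esub>\<close> le hc)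
      next
        case (add r r')
        moreover have "Poly_Mapping.keys (Poly_Mapping.single x c \<otimes>\<^bsub>monoid_algebra M\<^esub> r) \<subseteq> carrier M" "Poly_Mapping.keys (Poly_Mapping.single x c \<otimes>\<^bsub>monoid_algebra M\<^esub> r') \<subseteq> carrier M"
          using A.m_closed[of "Poly_Mapping.single x c"] add x by auto
        ultimately show ?case using x
          by (simp add: monoid_algebra_distrib le C.r_distr keys_add_subset hc)
      next
        case (single y d)
        then show ?case using x
          by (simp add: le mult hc C.mult_smult_left C.mult_smult_right C.smult_smult mult.commute)
      qed
      then show ?case using x by simp
    qed
    then show "linear_extension C h (p \<otimes>\<^bsub>monoid_algebra M\<^esub> r) = linear_extension C h p \<otimes>\<^bsub>C\<^esub> linear_extension C h r"
      by simp
  next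
    fix c and p :: "_ \<Rightarrow>\<^sub>0 'a" assume "p \<in> carrier (monoid_algebra M)"
    then have "Poly_Mapping.keys p \<subseteq> carrier M" by simp
    then have "Poly_Mapping.keys p \<subseteq> carrier M \<and> linear_extension C h (Poly_Mapping.map ((*) c) p) = c \<odot>\<^bsub>C\<^esub> linear_extension C h p"
    proof (induction p rule: poly_mapping_singles_induct)
      case (add p r)
      moreover have "Poly_Mapping.keys (Poly_Mapping.map ((*) c) p) \<subseteq> carrier M" "Poly_Mapping.keys (Poly_Mapping.map ((*) c) r) \<subseteq> carrier M"
        using add by (simp_all add: order_trans[OF keys_map_times])
      ultimately show ?case by (simp add: le pm.scale_right_distrib C.smult_r_distr keys_add_subset)
    qed (simp_all add: zero le hc C.smult_smult)
    then show "linear_extension C h (c \<odot>\<^bsub>monoid_algebra M\<^esub> p) = c \<odot>\<^bsub>C\<^esub> linear_extension C h p" by simp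
  qed (simp_all add: le one)
qed

lemma alg_hom_eq_on_singles:
  assumes "assoc_algebra (monoid_algebra M :: ('a::field, 'm \<Rightarrow>\<^sub>0 'a) module)" and C: "assoc_algebra C"
    and h: "h \<in> alg_hom (monoid_algebra M) C" and h': "h' \<in> alg_hom (monoid_algebra M) C"
    and eq: "\<And>x. x \<in> carrier M \<Longrightarrow> h (Poly_Mapping.single x 1) = h' (Poly_Mapping.single x (1::'a))"
    and p: "p \<in> carrier (monoid_algebra M)"
  shows "h p = h' p"
proof -
  have "Poly_Mapping.keys p \<subseteq> carrier M" using p by simp
  then have "Poly_Mapping.keys p \<subseteq> carrier M \<and> h p = h' p"
  proof (induction p rule: poly_mapping_singles_induct)
    case zero
    show ?case using alg_hom_zero[OF h assms(1) C] alg_hom_zero[OF h' assms(1) C] by simp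
  next
    case (add p r)
    then show ?case using alg_hom_add[OF h, of p r] alg_hom_add[OF h', of p r] by (simp add: keys_add_subset)
  next
    case (single x c)
    then show ?case
      using alg_hom_smult[OF h, of "Poly_Mapping.single x 1" c] alg_hom_smult[OF h', of "Poly_Mapping.single x 1" c] eq[of x]
      by simp
  qed
  then show ?thesis by simp
qed

section \<open>Free algebras and presentations\<close>

abbreviation word_monoid :: "'g list Group.monoid" where
  "word_monoid \<equiv> \<lparr>carrier = UNIV, monoid.mult = (@), one = []\<rparr>"

lemma word_monoid: "Group.monoid word_monoid"
  by (rule monoidI) auto

lemma free_algebra_is_algebra: "assoc_algebra (free_algebra :: ('a::field, 'g list \<Rightarrow>\<^sub>0 'a) module)"
  unfolding free_algebra_def by (rule monoid_algebra_is_algebra[OF word_monoid])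

lemma carrier_free_algebra [simp]: "carrier free_algebra = UNIV"
  by (simp add: free_algebra_def)

lemma free_algebra_lift:
  assumes C: "assoc_algebra C" and f: "\<And>g. f g \<in> carrier C"
  obtains h where "h \<in> alg_hom free_algebra C" "\<And>g. h (free_gen g) = f g"
proof -
  interpret C: assoc_algebra C by (rule C)
  define w where "w xs = foldr (\<lambda>g x. f g \<otimes>\<^bsub>C\<^esub> x) xs \<one>\<^bsub>C\<^esub>" for xs
  have wc [simp]: "w xs \<in> carrier C" for xs
    unfolding w_def by (induction xs) (simp_all add: f)
  have "w (xs @ ys) = w xs \<otimes>\<^bsub>C\<^esub> w ys" for xs ys
  proof (induction xs)
    case (Cons x xs)
    have "w (x # zs) = f x \<otimes>\<^bsub>C\<^esub> w zs" for zs by (simp add: w_def)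
    with Cons show ?case by (simp add: C.m_assoc f)
  qed (simp add: w_def wc[unfolded w_def])
  then have "linear_extension C w \<in> alg_hom free_algebra C"
    unfolding free_algebra_def by (intro linear_extension_hom[OF word_monoid C]) (auto, simp add: w_def)
  moreover have "linear_extension C w (free_gen g) = f g" for g
    unfolding free_gen_def by (subst linear_extension_single[OF C, of w UNIV]) (auto simp: f, auto simp: w_def f)
  ultimately show ?thesis by (rule that)
qed

context
  fixes R :: "(('g list \<Rightarrow>\<^sub>0 'a::field) \<times> ('g list \<Rightarrow>\<^sub>0 'a)) set"
begin

interpretation F: assoc_algebra "free_algebra :: ('a, 'g list \<Rightarrow>\<^sub>0 'a) module"
  by (rule free_algebra_is_algebra)

lemma relation_ideal_ideal: "ideal (relation_ideal R) free_algebra"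
  unfolding relation_ideal_def by (rule F.genideal_ideal) simp

lemma presented_is_algebra: "assoc_algebra (alg_quot free_algebra (relation_ideal R))"
  by (rule alg_quot_is_algebra[OF free_algebra_is_algebra relation_ideal_ideal])

lemma presented_relation:
  assumes "(l, r) \<in> R"
  shows "relation_ideal R +>\<^bsub>free_algebra\<^esub> l = relation_ideal R +>\<^bsub>free_algebra\<^esub> r"
proof -
  have "l \<ominus>\<^bsub>free_algebra\<^esub> r \<in> relation_ideal R"
    unfolding relation_ideal_def using assms by (intro subsetD[OF F.genideal_self]) auto
  then show ?thesis
    using coset_eq_iff[OF free_algebra_is_algebra relation_ideal_ideal, of l r] by simp
qed

lemma presented_lift:
  assumes C: "assoc_algebra C" and h: "h \<in> alg_hom free_algebra C"
    and R: "\<And>l r. (l, r) \<in> R \<Longrightarrow> h l = h r"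
  obtains h' where "h' \<in> alg_hom (alg_quot free_algebra (relation_ideal R)) C"
    "\<And>x. h' (relation_ideal R +>\<^bsub>free_algebra\<^esub> x) = h x"
proof -
  interpret C: assoc_algebra C by (rule C)
  have "ring_hom_ring free_algebra C h"
    using h F.ring_axioms C.ring_axioms by (intro ring_hom_ringI2) (auto simp: alg_hom_def)
  then have "ideal (a_kernel free_algebra C h) free_algebra"
    by (rule ring_hom_ring.kernel_is_ideal)
  moreover have "{l \<ominus>\<^bsub>free_algebra\<^esub> r |l r. (l, r) \<in> R} \<subseteq> a_kernel free_algebra C h"
    using R alg_hom_minus[OF h free_algebra_is_algebra C] alg_hom_closed[OF h]
    by (auto simp: a_kernel_def') 
  ultimately have "relation_ideal R \<subseteq> a_kernel free_algebra C h"
    unfolding relation_ideal_def by (rule F.genideal_minimal)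
  then have "h i = \<zero>\<^bsub>C\<^esub>" if "i \<in> relation_ideal R" for i
    using that by (auto simp: a_kernel_def')
  then show ?thesis
    using alg_quot_lift[OF free_algebra_is_algebra relation_ideal_ideal h C] that
    by (metis UNIV_I carrier_free_algebra)
qed

text \<open>
  The preimage of \<open>K\<close> in the free algebra contains all words.
\<close>
lemma presented_generated:
  assumes K: "K \<in> subalgebras (alg_quot free_algebra (relation_ideal R))"
    and gen: "\<And>g. relation_ideal R +>\<^bsub>free_algebra\<^esub> free_gen g \<in> K"
  shows "carrier (alg_quot free_algebra (relation_ideal R)) \<subseteq> K"
proof -
  let ?Q = "alg_quot free_algebra (relation_ideal R)"
  define \<pi> where "\<pi> x = relation_ideal R +>\<^bsub>free_algebra\<^esub> x" for x
  have \<pi>: "\<pi> \<in> alg_hom free_algebra ?Q"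
    unfolding \<pi>_def[abs_def] by (rule alg_quot_hom[OF free_algebra_is_algebra relation_ideal_ideal])
  have sub: "subring K ?Q" and sc: "\<And>c x. x \<in> K \<Longrightarrow> c \<odot>\<^bsub>?Q\<^esub> x \<in> K"
    using K by (auto simp: subalgebras_def)
  have word: "\<pi> (Poly_Mapping.single w 1) \<in> K" for w
  proof (induction w)
    case Nil
    have "\<pi> \<one>\<^bsub>free_algebra\<^esub> \<in> K" unfolding alg_hom_one[OF \<pi>] by (rule subringE(3)[OF sub])
    then show ?case by (simp add: free_algebra_def)
  next
    case (Cons g w)
    have "Poly_Mapping.single (g # w) (1::'a) = free_gen g \<otimes>\<^bsub>free_algebra\<^esub> Poly_Mapping.single w 1"
      by (simp add: free_algebra_def free_gen_def)
    then show ?case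
      using alg_hom_mult[OF \<pi>] gen[of g] Cons by (simp add: \<pi>_def[symmetric] subringE(6)[OF sub])
  qed
  have "\<pi> p \<in> K" for p
  proof -
    have "Poly_Mapping.keys p \<subseteq> UNIV" by simp
    then show ?thesis
    proof (induction p rule: poly_mapping_singles_induct)
      case zero
      show ?case
        using alg_hom_zero[OF \<pi> free_algebra_is_algebra presented_is_algebra] subringE(2)[OF sub]
        by (simp add: free_algebra_def)
    next
      case (add p r)
      then show ?case
        using alg_hom_add[OF \<pi>, of p r] subringE(7)[OF sub] by (simp add: free_algebra_def)
    next
      case (single x c)
      show ?case
        using alg_hom_smult[OF \<pi>, of "Poly_Mapping.single x 1" c] sc[OF word] by (simp add: free_algebra_def)
    qed
  qed
  then show ?thesis
    unfolding carrier_alg_quot[OF free_algebra_is_algebra relation_ideal_ideal] by (auto simp: \<pi>_def)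
qed

end

section \<open>Tensor products\<close>

locale two_algebras = A: assoc_algebra A + B: assoc_algebra B
  for A :: "('a::field, 'b) module" and B :: "('a, 'c) module"
begin

abbreviation "AB \<equiv> monoid_algebra (A \<times>\<times> B) :: ('a, 'b \<times> 'c \<Rightarrow>\<^sub>0 'a) module"
abbreviation "T \<equiv> tensor_algebra A B"
abbreviation "N \<equiv> tensor_null A B"

lemma prod_monoid: "Group.monoid (A \<times>\<times> B)"
  by (rule DirProd_monoid[OF A.monoid_axioms B.monoid_axioms])

sublocale P: assoc_algebra AB
  by (rule monoid_algebra_is_algebra[OF prod_monoid])

lemma null_induct [consumes 1, case_names zero add smult relation]:
  assumes "n \<in> N" "P 0" "\<And>x y. P x \<Longrightarrow> P y \<Longrightarrow> P (x + y)"
    and "\<And>c x. P x \<Longrightarrow> P (Poly_Mapping.map ((*) c) x)" and "\<And>r. r \<in> tensor_relations A B \<Longrightarrow> P r"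
  shows "P n"
  using assms(1) unfolding tensor_null_def
  by (induction rule: pm.span_induct_alt) (auto intro: assms)

lemma null_intros:
  "0 \<in> N" "x \<in> N \<Longrightarrow> y \<in> N \<Longrightarrow> x + y \<in> N" "x \<in> N \<Longrightarrow> Poly_Mapping.map ((*) c) x \<in> N"
  "r \<in> tensor_relations A B \<Longrightarrow> r \<in> N" "x \<in> N \<Longrightarrow> - x \<in> N"
  unfolding tensor_null_def by (auto intro: pm.span_zero pm.span_add pm.span_scale pm.span_base pm.span_neg)

lemma single_carrier: "a \<in> carrier A \<Longrightarrow> b \<in> carrier B \<Longrightarrow> Poly_Mapping.single (a, b) c \<in> carrier AB"
  by (auto simp: DirProd_def)

lemma relation_intros:
  "a \<in> carrier A \<Longrightarrow> a' \<in> carrier A \<Longrightarrow> b \<in> carrier B \<Longrightarrow>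
    Poly_Mapping.single (a \<oplus>\<^bsub>A\<^esub> a', b) 1 - Poly_Mapping.single (a, b) 1 - Poly_Mapping.single (a', b) 1
      \<in> tensor_relations A B"
  "a \<in> carrier A \<Longrightarrow> b \<in> carrier B \<Longrightarrow> b' \<in> carrier B \<Longrightarrow>
    Poly_Mapping.single (a, b \<oplus>\<^bsub>B\<^esub> b') 1 - Poly_Mapping.single (a, b) 1 - Poly_Mapping.single (a, b') 1
      \<in> tensor_relations A B"
  "a \<in> carrier A \<Longrightarrow> b \<in> carrier B \<Longrightarrow>
    Poly_Mapping.single (c \<odot>\<^bsub>A\<^esub> a, b) 1 - Poly_Mapping.single (a, b) c \<in> tensor_relations A B"
  "a \<in> carrier A \<Longrightarrow> b \<in> carrier B \<Longrightarrow>
    Poly_Mapping.single (a, c \<odot>\<^bsub>B\<^esub> b) 1 - Poly_Mapping.single (a, b) c \<in> tensor_relations A B"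
  unfolding tensor_relations_def by blast+

lemma relation_cases:
  assumes "r \<in> tensor_relations A B"
  obtains (add_left) a a' b where
      "r = Poly_Mapping.single (a \<oplus>\<^bsub>A\<^esub> a', b) 1 - Poly_Mapping.single (a, b) 1 - Poly_Mapping.single (a', b) 1"
      "a \<in> carrier A" "a' \<in> carrier A" "b \<in> carrier B"
  | (add_right) a b b' where
      "r = Poly_Mapping.single (a, b \<oplus>\<^bsub>B\<^esub> b') 1 - Poly_Mapping.single (a, b) 1 - Poly_Mapping.single (a, b') 1"
      "a \<in> carrier A" "b \<in> carrier B" "b' \<in> carrier B"
  | (smult_left) a b c where
      "r = Poly_Mapping.single (c \<odot>\<^bsub>A\<^esub> a, b) 1 - Poly_Mapping.single (a, b) c"
      "a \<in> carrier A" "b \<in> carrier B"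
  | (smult_right) a b c where
      "r = Poly_Mapping.single (a, c \<odot>\<^bsub>B\<^esub> b) 1 - Poly_Mapping.single (a, b) c"
      "a \<in> carrier A" "b \<in> carrier B"
  using assms unfolding tensor_relations_def Un_iff mem_Collect_eq
  apply (elim disjE exE conjE)
  subgoal by (rule add_left)
  subgoal by (rule add_right)
  subgoal by (rule smult_left)
  subgoal by (rule smult_right)
  done

lemma carrier_diff: "p - r \<in> carrier AB" if "p \<in> carrier AB" "r \<in> carrier AB"
  using that keys_diff[of p r] by auto

lemma relations_carrier: "r \<in> tensor_relations A B \<Longrightarrow> r \<in> carrier AB"
  by (erule relation_cases)
    (simp_all add: carrier_diff single_carrier del: monoid_algebra_simps(1))

lemma null_carrier: "n \<in> N \<Longrightarrow> n \<in> carrier AB"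
proof (induction n rule: null_induct)
  case (add x y)
  then show ?case using P.a_closed[of x y] by simp
next
  case (smult c x)
  then show ?case using P.smult_closed[of x c] by simp
qed (simp_all add: relations_carrier del: monoid_algebra_simps(1), simp)

text \<open>
  A product of a bilinearity relation and a pure tensor is a relation of the same kind. Hence the span of the
  relations is an ideal.
\<close>
lemma relation_mult_single:
  assumes r: "r \<in> tensor_relations A B" and x: "x \<in> carrier A" "y \<in> carrier B"
  shows "Poly_Mapping.single (x, y) 1 \<otimes>\<^bsub>AB\<^esub> r \<in> tensor_relations A B"
    and "r \<otimes>\<^bsub>AB\<^esub> Poly_Mapping.single (x, y) 1 \<in> tensor_relations A B"
  using r by (cases rule: relation_cases;
    use x in \<open>simp add: monoid_algebra_diff A.r_distr A.l_distr B.r_distr B.l_distr A.mult_smult_left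
      A.mult_smult_right B.mult_smult_left B.mult_smult_right relation_intros\<close>)+

lemma tensor_null_ideal: "ideal N AB"
proof (rule idealI)
  show "ring AB" by (rule P.ring_axioms)
  show "subgroup N (add_monoid AB)"
  proof (rule P.add.subgroupI)
    fix n assume n: "n \<in> N"
    have "\<ominus>\<^bsub>AB\<^esub> n = - n"
      using P.smult_minus_one[OF null_carrier[OF n]] by simp
    then show "\<ominus>\<^bsub>AB\<^esub> n \<in> N"
      using null_intros(5)[OF n] by simp
  qed (use null_carrier null_intros in auto)
  fix n p assume n: "n \<in> N" and p: "p \<in> carrier AB"
  from p have "Poly_Mapping.keys p \<subseteq> carrier (A \<times>\<times> B)" by simp
  then have "p \<otimes>\<^bsub>AB\<^esub> n \<in> N \<and> n \<otimes>\<^bsub>AB\<^esub> p \<in> N"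
  proof (induction p rule: poly_mapping_singles_induct)
    case (single z c)
    obtain x y where z: "z = (x, y)" "x \<in> carrier A" "y \<in> carrier B"
      using single by (auto simp: DirProd_def)
    have zc: "Poly_Mapping.single z 1 \<in> carrier AB" using z single_carrier by simp
    have nc: "n \<in> carrier AB" by (rule null_carrier[OF n])
    from n have "Poly_Mapping.single z 1 \<otimes>\<^bsub>AB\<^esub> n \<in> N \<and> n \<otimes>\<^bsub>AB\<^esub> Poly_Mapping.single z 1 \<in> N \<and> n \<in> N"
    proof (induction n rule: null_induct)
      case (smult c n)
      then show ?case
        using P.mult_smult_left[OF null_carrier[of n] zc, of c] P.mult_smult_right[OF zc null_carrier[of n], of c] null_intros(3)
        by simp
    qed (use relation_mult_single z null_intros in \<open>auto simp: monoid_algebra_distrib\<close>)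
    then show ?case
      using P.mult_smult_left[OF zc nc, of c] P.mult_smult_right[OF nc zc, of c] null_intros(3)[of _ c]
      by auto
  qed (auto simp: monoid_algebra_distrib null_intros)
  then show "p \<otimes>\<^bsub>AB\<^esub> n \<in> N" "n \<otimes>\<^bsub>AB\<^esub> p \<in> N" by auto
qed

lemma tensor_is_algebra: "assoc_algebra T"
  unfolding tensor_algebra_def by (rule alg_quot_is_algebra[OF P.assoc_algebra_axioms tensor_null_ideal])

sublocale T: assoc_algebra T by (rule tensor_is_algebra)

lemma quotient_hom: "(\<lambda>x. N +>\<^bsub>AB\<^esub> x) \<in> alg_hom AB T"
  unfolding tensor_algebra_def by (rule alg_quot_hom[OF P.assoc_algebra_axioms tensor_null_ideal])

lemma pure_closed: "a \<in> carrier A \<Longrightarrow> b \<in> carrier B \<Longrightarrow> pure_tensor A B a b \<in> carrier T"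
  unfolding pure_tensor_def by (intro alg_hom_closed[OF quotient_hom] single_carrier)

lemma pure_mult:
  assumes "a \<in> carrier A" "b \<in> carrier B" "a' \<in> carrier A" "b' \<in> carrier B"
  shows "pure_tensor A B a b \<otimes>\<^bsub>T\<^esub> pure_tensor A B a' b' = pure_tensor A B (a \<otimes>\<^bsub>A\<^esub> a') (b \<otimes>\<^bsub>B\<^esub> b')"
  unfolding pure_tensor_def
  by (subst alg_hom_mult[OF quotient_hom, symmetric]) (use assms single_carrier in auto)

lemma pure_one: "pure_tensor A B \<one>\<^bsub>A\<^esub> \<one>\<^bsub>B\<^esub> = \<one>\<^bsub>T\<^esub>"
  unfolding pure_tensor_def using alg_hom_one[OF quotient_hom] by simp

lemma coset_eq: "x - y \<in> N \<Longrightarrow> x \<in> carrier AB \<Longrightarrow> y \<in> carrier AB \<Longrightarrow> N +>\<^bsub>AB\<^esub> x = N +>\<^bsub>AB\<^esub> y"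
proof -
  assume "x - y \<in> N" and xy: "x \<in> carrier AB" "y \<in> carrier AB"
  have "y \<oplus>\<^bsub>AB\<^esub> (x - y) = x" by simp
  moreover have "x - y \<in> carrier AB" using null_carrier[OF \<open>x - y \<in> N\<close>] .
  ultimately have "x \<ominus>\<^bsub>AB\<^esub> y = x - y"
    using xy by (metis P.add.inv_solve_right' P.minus_eq P.a_comm P.a_inv_closed P.r_neg1)
  then show ?thesis
    using coset_eq_iff[OF P.assoc_algebra_axioms tensor_null_ideal xy] \<open>x - y \<in> N\<close> by simp
qed

lemma pure_add_left:
  assumes "a \<in> carrier A" "a' \<in> carrier A" "b \<in> carrier B"
  shows "pure_tensor A B (a \<oplus>\<^bsub>A\<^esub> a') b = pure_tensor A B a b \<oplus>\<^bsub>T\<^esub> pure_tensor A B a' b"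
proof -
  have "Poly_Mapping.single (a \<oplus>\<^bsub>A\<^esub> a', b) 1 - (Poly_Mapping.single (a, b) 1 + Poly_Mapping.single (a', b) 1) \<in> N"
    using assms unfolding diff_diff_add[symmetric] by (intro null_intros(4) relation_intros)
  then show ?thesis
    unfolding pure_tensor_def using assms P.a_closed[OF single_carrier single_carrier, of a b a' b 1 1]
    by (subst alg_hom_add[OF quotient_hom, symmetric])
      (simp_all add: single_carrier coset_eq del: monoid_algebra_simps(1))
qed

lemma pure_add_right:
  assumes "a \<in> carrier A" "b \<in> carrier B" "b' \<in> carrier B"
  shows "pure_tensor A B a (b \<oplus>\<^bsub>B\<^esub> b') = pure_tensor A B a b \<oplus>\<^bsub>T\<^esub> pure_tensor A B a b'"
proof -
  have "Poly_Mapping.single (a, b \<oplus>\<^bsub>B\<^esub> b') 1 - (Poly_Mapping.single (a, b) 1 + Poly_Mapping.single (a, b') 1) \<in> N"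
    using assms unfolding diff_diff_add[symmetric] by (intro null_intros(4) relation_intros)
  then show ?thesis
    unfolding pure_tensor_def using assms P.a_closed[OF single_carrier single_carrier, of a b a b' 1 1]
    by (subst alg_hom_add[OF quotient_hom, symmetric])
      (simp_all add: single_carrier coset_eq del: monoid_algebra_simps(1))
qed

lemma pure_smult:
  assumes "a \<in> carrier A" "b \<in> carrier B"
  shows "pure_tensor A B (c \<odot>\<^bsub>A\<^esub> a) b = c \<odot>\<^bsub>T\<^esub> pure_tensor A B a b"
    and "pure_tensor A B a (c \<odot>\<^bsub>B\<^esub> b) = c \<odot>\<^bsub>T\<^esub> pure_tensor A B a b"
proof -
  have "Poly_Mapping.single (c \<odot>\<^bsub>A\<^esub> a, b) 1 - Poly_Mapping.single (a, b) c \<in> N"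
    "Poly_Mapping.single (a, c \<odot>\<^bsub>B\<^esub> b) 1 - Poly_Mapping.single (a, b) c \<in> N"
    by (intro null_intros(4) relation_intros assms)+
  then show "pure_tensor A B (c \<odot>\<^bsub>A\<^esub> a) b = c \<odot>\<^bsub>T\<^esub> pure_tensor A B a b"
    "pure_tensor A B a (c \<odot>\<^bsub>B\<^esub> b) = c \<odot>\<^bsub>T\<^esub> pure_tensor A B a b"
    unfolding pure_tensor_def using assms
    by (subst alg_hom_smult[OF quotient_hom, symmetric];
        simp add: single_carrier coset_eq del: monoid_algebra_simps(1))+
qed

lemma left_hom: "(\<lambda>a. pure_tensor A B a \<one>\<^bsub>B\<^esub>) \<in> alg_hom A T"
  by (rule alg_homI) (simp_all add: pure_closed pure_mult pure_add_left pure_smult pure_one)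

lemma right_hom: "(\<lambda>b. pure_tensor A B \<one>\<^bsub>A\<^esub> b) \<in> alg_hom B T"
  by (rule alg_homI) (simp_all add: pure_closed pure_mult pure_add_right pure_smult pure_one)

lemma tensor_hom_eq:
  assumes C: "assoc_algebra C" and h: "h \<in> alg_hom T C" and h': "h' \<in> alg_hom T C"
    and eq: "\<And>a b. a \<in> carrier A \<Longrightarrow> b \<in> carrier B \<Longrightarrow> h (pure_tensor A B a b) = h' (pure_tensor A B a b)"
    and t: "t \<in> carrier T"
  shows "h t = h' t"
proof -
  have comp: "(\<lambda>x. k (N +>\<^bsub>AB\<^esub> x)) \<in> alg_hom AB C" if k: "k \<in> alg_hom T C" for k
    by (rule alg_homI)
      (simp_all only: alg_hom_mult[OF quotient_hom] alg_hom_add[OF quotient_hom] alg_hom_one[OF quotient_hom]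
        alg_hom_smult[OF quotient_hom] alg_hom_closed[OF quotient_hom]
        alg_hom_mult[OF k] alg_hom_add[OF k] alg_hom_one[OF k] alg_hom_smult[OF k] alg_hom_closed[OF k])
  obtain p where p: "p \<in> carrier AB" "t = N +>\<^bsub>AB\<^esub> p"
    using t unfolding tensor_algebra_def carrier_alg_quot[OF P.assoc_algebra_axioms tensor_null_ideal] by blast
  show ?thesis unfolding p(2)
    by (rule alg_hom_eq_on_singles[OF P.assoc_algebra_axioms C comp[OF h] comp[OF h'] _ p(1)])
      (use eq in \<open>auto simp: DirProd_def pure_tensor_def\<close>)
qed

lemma tensor_lift:
  assumes C: "assoc_algebra C" and f: "f \<in> alg_hom A C" and g: "g \<in> alg_hom B C"
    and comm: "\<And>a b. a \<in> carrier A \<Longrightarrow> b \<in> carrier B \<Longrightarrow> f a \<otimes>\<^bsub>C\<^esub> g b = g b \<otimes>\<^bsub>C\<^esub> f a"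
  obtains h where "h \<in> alg_hom T C"
    "\<And>a b. a \<in> carrier A \<Longrightarrow> b \<in> carrier B \<Longrightarrow> h (pure_tensor A B a b) = f a \<otimes>\<^bsub>C\<^esub> g b"
proof -
  interpret C: assoc_algebra C by (rule C)
  note fc = alg_hom_closed[OF f] and gc = alg_hom_closed[OF g]
  define k where "k = (\<lambda>(a, b). f a \<otimes>\<^bsub>C\<^esub> g b)"
  have kc: "k \<in> carrier (A \<times>\<times> B) \<rightarrow> carrier C" by (auto simp: k_def fc gc DirProd_def)
  have K: "linear_extension C k \<in> alg_hom AB C"
  proof (rule linear_extension_hom[OF prod_monoid C kc])
    fix x y assume "x \<in> carrier (A \<times>\<times> B)" "y \<in> carrier (A \<times>\<times> B)"
    then obtain a b a' b' where xy: "x = (a, b)" "y = (a', b')"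
      and c: "a \<in> carrier A" "b \<in> carrier B" "a' \<in> carrier A" "b' \<in> carrier B"
      by (auto simp: DirProd_def)
    have "f a \<otimes>\<^bsub>C\<^esub> f a' \<otimes>\<^bsub>C\<^esub> (g b \<otimes>\<^bsub>C\<^esub> g b') = f a \<otimes>\<^bsub>C\<^esub> g b \<otimes>\<^bsub>C\<^esub> (f a' \<otimes>\<^bsub>C\<^esub> g b')"
      using c comm[of a' b] by (simp add: fc gc C.m_assoc) (metis C.m_assoc fc gc)
    then show "k (x \<otimes>\<^bsub>A \<times>\<times> B\<^esub> y) = k x \<otimes>\<^bsub>C\<^esub> k y"
      using c by (simp add: k_def xy alg_hom_mult[OF f] alg_hom_mult[OF g])
  qed (simp add: k_def alg_hom_one[OF f] alg_hom_one[OF g])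
  have single: "linear_extension C k (Poly_Mapping.single (a, b) c) = c \<odot>\<^bsub>C\<^esub> (f a \<otimes>\<^bsub>C\<^esub> g b)"
    if "a \<in> carrier A" "b \<in> carrier B" for a b c
    by (subst linear_extension_single[OF C kc]) (use that in \<open>auto simp: k_def DirProd_def\<close>)
  have diff: "linear_extension C k (x - y) = linear_extension C k x \<ominus>\<^bsub>C\<^esub> linear_extension C k y"
    if "x \<in> carrier AB" "y \<in> carrier AB" for x y
  proof -
    have "x - y \<in> carrier AB" using that keys_diff[of x y] by auto
    then have "linear_extension C k (x - y) \<oplus>\<^bsub>C\<^esub> linear_extension C k y = linear_extension C k x"
      using alg_hom_add[OF K, of "x - y" y] that by simp
    then show ?thesis
      using alg_hom_closed[OF K] that \<open>x - y \<in> carrier AB\<close> by (metis C.add.inv_solve_right' C.minus_eq)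
  qed
  have zero: "(u \<oplus>\<^bsub>C\<^esub> v) \<ominus>\<^bsub>C\<^esub> u \<ominus>\<^bsub>C\<^esub> v = \<zero>\<^bsub>C\<^esub>" if "u \<in> carrier C" "v \<in> carrier C" for u v
    using that by algebra
  have rel: "linear_extension C k r = \<zero>\<^bsub>C\<^esub>" if "r \<in> tensor_relations A B" for r
    using that
    by (cases rule: relation_cases)
      (simp_all add: diff carrier_diff single_carrier single zero fc gc alg_hom_add[OF f] alg_hom_add[OF g]
        alg_hom_smult[OF f] alg_hom_smult[OF g] C.l_distr C.r_distr C.mult_smult_left C.mult_smult_right C.r_neg
        a_minus_def[of C "_ \<odot>\<^bsub>C\<^esub> _"] del: monoid_algebra_simps(1))
  have "linear_extension C k n = \<zero>\<^bsub>C\<^esub>" if "n \<in> N" for n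
  proof -
    from that have "n \<in> N \<and> linear_extension C k n = \<zero>\<^bsub>C\<^esub>"
    proof (induction n rule: null_induct)
      case zero
      show ?case using alg_hom_zero[OF K P.assoc_algebra_axioms C] null_intros by simp
    next
      case (add x y)
      then show ?case using alg_hom_add[OF K null_carrier null_carrier, of x y] null_intros by simp
    next
      case (smult c x)
      then show ?case using alg_hom_smult[OF K null_carrier, of x c] null_intros by simp
    qed (auto simp: rel null_intros)
    then show ?thesis by simp
  qed
  then obtain h where h: "h \<in> alg_hom T C" "\<And>x. x \<in> carrier AB \<Longrightarrow> h (N +>\<^bsub>AB\<^esub> x) = linear_extension C k x"
    using alg_quot_lift[OF P.assoc_algebra_axioms tensor_null_ideal K C] unfolding tensor_algebra_def by metis
  then show ?thesis
    using that[OF h(1)] by (simp only: pure_tensor_def single_carrier) (simp add: single fc gc)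
qed

end

section \<open>A type containing all algebras\<close>

text \<open>
  The product of all algebras whose elements have type \<open>'b\<close>. Every single algebra \<open>A\<close> is a corner of it: the
  elements that vanish at all other algebras form a copy of \<open>A\<close>, with unit \<open>ualg_embed A \<one>\<^bsub>A\<^esub>\<close>. This
  embedding transports identities between \<open>A\<close> and a type of class \<open>ring\<close>, over which power series can be formed.
\<close>
typedef (overloaded) ('a::field, 'b) ualg =
  "{u :: ('a, 'b) module \<Rightarrow> 'b. \<forall>A. if assoc_algebra A then u A \<in> carrier A else u A = undefined}"
  by (rule exI[of _ "\<lambda>A. if assoc_algebra A then \<zero>\<^bsub>A\<^esub> else undefined"])
    (auto simp: assoc_algebra_def ring.ring_simprules)

setup_lifting type_definition_ualg

lemma assoc_algebra_ring: "assoc_algebra A \<Longrightarrow> ring A"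
  by (simp add: assoc_algebra_def)

lift_definition ualg_proj :: "('a::field, 'b) module \<Rightarrow> ('a, 'b) ualg \<Rightarrow> 'b" is "\<lambda>A u. u A" .

lemma proj_closed: "assoc_algebra A \<Longrightarrow> ualg_proj A u \<in> carrier A"
  by transfer metis

lemma ualg_eqI: "(\<And>A. assoc_algebra A \<Longrightarrow> ualg_proj A u = ualg_proj A v) \<Longrightarrow> u = v"
  by transfer (metis ext)

instantiation ualg :: (field, type) ring
begin

lift_definition zero_ualg :: "('a, 'b) ualg" is "\<lambda>A. if assoc_algebra A then \<zero>\<^bsub>A\<^esub> else undefined"
  by (simp add: assoc_algebra_ring ring.ring_simprules)

lift_definition plus_ualg :: "('a, 'b) ualg \<Rightarrow> ('a, 'b) ualg \<Rightarrow> ('a, 'b) ualg"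
  is "\<lambda>u v A. if assoc_algebra A then u A \<oplus>\<^bsub>A\<^esub> v A else undefined"
  by (metis assoc_algebra_ring ring.ring_simprules(1))

lift_definition uminus_ualg :: "('a, 'b) ualg \<Rightarrow> ('a, 'b) ualg"
  is "\<lambda>u A. if assoc_algebra A then \<ominus>\<^bsub>A\<^esub> u A else undefined"
  by (metis assoc_algebra_ring ring.ring_simprules(3))

lift_definition minus_ualg :: "('a, 'b) ualg \<Rightarrow> ('a, 'b) ualg \<Rightarrow> ('a, 'b) ualg"
  is "\<lambda>u v A. if assoc_algebra A then u A \<ominus>\<^bsub>A\<^esub> v A else undefined"
  by (metis assoc_algebra_ring ring.ring_simprules(4))

lift_definition times_ualg :: "('a, 'b) ualg \<Rightarrow> ('a, 'b) ualg \<Rightarrow> ('a, 'b) ualg"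
  is "\<lambda>u v A. if assoc_algebra A then u A \<otimes>\<^bsub>A\<^esub> v A else undefined"
  by (metis assoc_algebra_ring ring.ring_simprules(5))

lemma proj_simps:
  fixes u v :: "('a, 'b) ualg"
  assumes "assoc_algebra A"
  shows "ualg_proj A 0 = \<zero>\<^bsub>A\<^esub>" "ualg_proj A (u + v) = ualg_proj A u \<oplus>\<^bsub>A\<^esub> ualg_proj A v" "ualg_proj A (- u) = \<ominus>\<^bsub>A\<^esub> ualg_proj A u"
    "ualg_proj A (u - v) = ualg_proj A u \<ominus>\<^bsub>A\<^esub> ualg_proj A v" "ualg_proj A (u * v) = ualg_proj A u \<otimes>\<^bsub>A\<^esub> ualg_proj A v"
  using assms by (transfer; simp)+

instance
proof
  fix u v w :: "('a, 'b) ualg"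
  show "u + v + w = u + (v + w)"
    by (rule ualg_eqI) (simp add: proj_simps assoc_algebra_ring proj_closed ring.ring_simprules(7))
  show "u + v = v + u"
    by (rule ualg_eqI) (simp add: proj_simps assoc_algebra_ring proj_closed ring.ring_simprules(10))
  show "0 + u = u"
    by (rule ualg_eqI) (simp add: proj_simps assoc_algebra_ring proj_closed ring.ring_simprules(8))
  show "- u + u = 0"
    by (rule ualg_eqI) (simp add: proj_simps assoc_algebra_ring proj_closed ring.ring_simprules(9))
  show "u - v = u + - v"
    by (rule ualg_eqI) (simp add: proj_simps a_minus_def)
  show "u * v * w = u * (v * w)"
    by (rule ualg_eqI) (simp add: proj_simps assoc_algebra_ring proj_closed ring.ring_simprules(11))
  show "(u + v) * w = u * w + v * w"
    by (rule ualg_eqI) (simp add: proj_simps assoc_algebra_ring proj_closed ring.ring_simprules(13))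
  show "u * (v + w) = u * v + u * w"
    by (rule ualg_eqI) (simp add: proj_simps assoc_algebra_ring proj_closed ring.ring_simprules(23))
qed

end

lift_definition uscale :: "'a::field \<Rightarrow> ('a, 'b) ualg \<Rightarrow> ('a, 'b) ualg"
  is "\<lambda>c u A. if assoc_algebra A then c \<odot>\<^bsub>A\<^esub> u A else undefined"
  by (metis assoc_algebra.smult_closed)

lemma proj_uscale: "assoc_algebra A \<Longrightarrow> ualg_proj A (uscale c u) = c \<odot>\<^bsub>A\<^esub> ualg_proj A u"
  by transfer simp

interpretation ualg: series_ring uscale
proof
  fix a b :: 'a and u v :: "('a, 'b) ualg"
  show "uscale a (u + v) = uscale a u + uscale a v"
    by (rule ualg_eqI) (simp add: proj_simps proj_uscale proj_closed assoc_algebra.smult_r_distr)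
  show "uscale (a + b) u = uscale a u + uscale b u"
    by (rule ualg_eqI) (simp add: proj_simps proj_uscale proj_closed assoc_algebra.smult_l_distr)
  show "uscale a (uscale b u) = uscale (a * b) u"
    by (rule ualg_eqI) (simp add: proj_simps proj_uscale proj_closed assoc_algebra.smult_smult)
  show "uscale 1 u = u"
    by (rule ualg_eqI) (simp add: proj_simps proj_uscale proj_closed assoc_algebra.smult_one)
  show "uscale a u * v = uscale a (u * v)"
    by (rule ualg_eqI) (simp add: proj_simps proj_uscale proj_closed assoc_algebra.mult_smult_left)
  show "u * uscale a v = uscale a (u * v)"
    by (rule ualg_eqI) (simp add: proj_simps proj_uscale proj_closed assoc_algebra.mult_smult_right)
qed

lift_definition ualg_embed :: "('a::field, 'b) module \<Rightarrow> 'b \<Rightarrow> ('a, 'b) ualg"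
  is "\<lambda>A x B. if assoc_algebra B then if B = A \<and> x \<in> carrier A then x else \<zero>\<^bsub>B\<^esub> else undefined"
  by (simp add: assoc_algebra_ring ring.ring_simprules)

lemma proj_embed_eq: "assoc_algebra B \<Longrightarrow> ualg_proj B (ualg_embed A x) = (if B = A \<and> x \<in> carrier A then x else \<zero>\<^bsub>B\<^esub>)"
  by transfer simp

lemma proj_embed [simp]: "assoc_algebra A \<Longrightarrow> x \<in> carrier A \<Longrightarrow> ualg_proj A (ualg_embed A x) = x"
  by (simp add: proj_embed_eq)

lemma embed_proj:
  fixes A :: "('a::field, 'b) module"
  assumes "assoc_algebra A"
  shows "ualg_embed A (ualg_proj A u) = ualg_embed A \<one>\<^bsub>A\<^esub> * u"
proof (rule ualg_eqI)
  fix B :: "('a, 'b) module" assume "assoc_algebra B"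
  interpret A: assoc_algebra A by fact
  interpret B: assoc_algebra B by fact
  show "ualg_proj B (ualg_embed A (ualg_proj A u)) = ualg_proj B (ualg_embed A \<one>\<^bsub>A\<^esub> * u)"
    using proj_closed[OF \<open>assoc_algebra B\<close>, of u]
    by (auto simp: proj_simps \<open>assoc_algebra B\<close> proj_embed_eq)
qed

lemma
  fixes A :: "('a::field, 'b) module"
  assumes A: "assoc_algebra A" and x: "x \<in> carrier A"
  shows embed_mult: "y \<in> carrier A \<Longrightarrow> ualg_embed A (x \<otimes>\<^bsub>A\<^esub> y) = ualg_embed A x * ualg_embed A y"
    and embed_add: "y \<in> carrier A \<Longrightarrow> ualg_embed A (x \<oplus>\<^bsub>A\<^esub> y) = ualg_embed A x + ualg_embed A y"
    and embed_minus: "y \<in> carrier A \<Longrightarrow> ualg_embed A (x \<ominus>\<^bsub>A\<^esub> y) = ualg_embed A x - ualg_embed A y"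
    and embed_smult: "ualg_embed A (c \<odot>\<^bsub>A\<^esub> x) = uscale c (ualg_embed A x)"
proof -
  interpret A: assoc_algebra A by (rule A)
  have B: "\<zero>\<^bsub>B\<^esub> \<otimes>\<^bsub>B\<^esub> \<zero>\<^bsub>B\<^esub> = \<zero>\<^bsub>B\<^esub>" "\<zero>\<^bsub>B\<^esub> \<oplus>\<^bsub>B\<^esub> \<zero>\<^bsub>B\<^esub> = \<zero>\<^bsub>B\<^esub>" "\<zero>\<^bsub>B\<^esub> \<ominus>\<^bsub>B\<^esub> \<zero>\<^bsub>B\<^esub> = \<zero>\<^bsub>B\<^esub>" "c \<odot>\<^bsub>B\<^esub> \<zero>\<^bsub>B\<^esub> = \<zero>\<^bsub>B\<^esub>"
    if "assoc_algebra B" for B :: "('a, 'b) module"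
  proof -
    interpret B: assoc_algebra B by fact
    show "\<zero>\<^bsub>B\<^esub> \<otimes>\<^bsub>B\<^esub> \<zero>\<^bsub>B\<^esub> = \<zero>\<^bsub>B\<^esub>" "\<zero>\<^bsub>B\<^esub> \<oplus>\<^bsub>B\<^esub> \<zero>\<^bsub>B\<^esub> = \<zero>\<^bsub>B\<^esub>" "\<zero>\<^bsub>B\<^esub> \<ominus>\<^bsub>B\<^esub> \<zero>\<^bsub>B\<^esub> = \<zero>\<^bsub>B\<^esub>" "c \<odot>\<^bsub>B\<^esub> \<zero>\<^bsub>B\<^esub> = \<zero>\<^bsub>B\<^esub>"
      by (simp_all add: a_minus_def)
  qed
  show "ualg_embed A (x \<otimes>\<^bsub>A\<^esub> y) = ualg_embed A x * ualg_embed A y" if "y \<in> carrier A"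
    using x that by (intro ualg_eqI) (auto simp: proj_simps proj_embed_eq B)
  show "ualg_embed A (x \<oplus>\<^bsub>A\<^esub> y) = ualg_embed A x + ualg_embed A y" if "y \<in> carrier A"
    using x that by (intro ualg_eqI) (auto simp: proj_simps proj_embed_eq B)
  show "ualg_embed A (x \<ominus>\<^bsub>A\<^esub> y) = ualg_embed A x - ualg_embed A y" if "y \<in> carrier A"
    using x that by (intro ualg_eqI) (auto simp: proj_simps proj_embed_eq B)
  show "ualg_embed A (c \<odot>\<^bsub>A\<^esub> x) = uscale c (ualg_embed A x)"
    using x by (intro ualg_eqI) (auto simp: proj_uscale proj_embed_eq B)
qed

lemma embed_zero: "assoc_algebra A \<Longrightarrow> ualg_embed A \<zero>\<^bsub>A\<^esub> = 0"
  by (rule ualg_eqI) (auto simp: proj_simps proj_embed_eq)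

lemma proj_sum:
  assumes "assoc_algebra A" "finite I"
  shows "ualg_proj A (sum g I) = (\<Oplus>\<^bsub>A\<^esub>i\<in>I. ualg_proj A (g i))"
proof -
  interpret A: assoc_algebra A by fact
  from assms(2) show ?thesis
    by (induction I rule: finite_induct) (auto simp: proj_simps assms(1) proj_closed)
qed

lemma embed_inject: "assoc_algebra A \<Longrightarrow> x \<in> carrier A \<Longrightarrow> y \<in> carrier A \<Longrightarrow> ualg_embed A x = ualg_embed A y \<longleftrightarrow> x = y"
  by (metis proj_embed)

section \<open>Alternating families in an algebra\<close>

text \<open>
  The locale \<open>alternating\<close> for an algebra on a carrier set, transported along its embedding.
\<close>
definition alternating_family :: "('a::field, 'b) module \<Rightarrow> 'a \<Rightarrow> (kind \<Rightarrow> nat \<Rightarrow> 'b) \<Rightarrow> bool" where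
  "alternating_family A q f \<longleftrightarrow> (\<forall>x n. f x n \<in> carrier A) \<and>
     alternating uscale (ualg_embed A \<one>\<^bsub>A\<^esub>) q (\<lambda>x n. ualg_embed A (f x n))"

fun alt_elem :: "kind \<Rightarrow> nat \<Rightarrow> (alt_gen list \<Rightarrow>\<^sub>0 'a::field)" where
  "alt_elem Wm n = free_gen (AltW (- int n))"
| "alt_elem Wp n = free_gen (AltW (int n + 1))"
| "alt_elem Gk 0 = \<one>\<^bsub>free_algebra\<^esub>"
| "alt_elem Gk (Suc n) = free_gen (AltG n)"
| "alt_elem Gtk 0 = \<one>\<^bsub>free_algebra\<^esub>"
| "alt_elem Gtk (Suc n) = free_gen (AltGt n)"

text \<open>
  The presentation lists the relations of \<open>G\<^sub>n\<close> for \<open>n \<ge> 1\<close> only. The remaining cases in the locale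
  involve \<open>G\<^sub>0 = 1\<close> and hold trivially.
\<close>
lemma alternating_family_iff_relations:
  fixes A :: "('a::field, 'b) module"
  assumes A: "assoc_algebra A" and h: "h \<in> alg_hom free_algebra A"
  shows "alternating_family A q (\<lambda>x n. h (alt_elem x n)) \<longleftrightarrow> (\<forall>(l, r) \<in> alt_relations q. h l = h r)"
proof -
  interpret A: assoc_algebra A by (rule A)
  interpret F: assoc_algebra "free_algebra :: ('a, alt_gen list \<Rightarrow>\<^sub>0 'a) module" by (rule free_algebra_is_algebra)
  have hc: "h x \<in> carrier A" for x by (rule alg_hom_closed[OF h]) simp
  define E where "E x = ualg_embed A (h x)" for x
  have E: "h l = h r \<longleftrightarrow> E l = E r" for l r
    unfolding E_def by (simp add: embed_inject A hc)
  have Es: "E (x \<otimes>\<^bsub>free_algebra\<^esub> y) = E x * E y" "E (x \<oplus>\<^bsub>free_algebra\<^esub> y) = E x + E y"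
    "E (x \<ominus>\<^bsub>free_algebra\<^esub> y) = E x - E y" "E (c \<odot>\<^bsub>free_algebra\<^esub> x) = uscale c (E x)"
    "E \<zero>\<^bsub>free_algebra\<^esub> = 0" "E \<one>\<^bsub>free_algebra\<^esub> = ualg_embed A \<one>\<^bsub>A\<^esub>" for x y c
    using alg_hom_minus[OF h free_algebra_is_algebra A, of x y] alg_hom_zero[OF h free_algebra_is_algebra A]
    by (simp_all add: E_def alg_hom_mult[OF h] alg_hom_add[OF h] alg_hom_smult[OF h] alg_hom_one[OF h]
        embed_mult embed_add embed_minus embed_smult embed_zero A hc)
  have unit: "ualg_embed A \<one>\<^bsub>A\<^esub> * E x = E x" "E x * ualg_embed A \<one>\<^bsub>A\<^esub> = E x" for x
    unfolding E_def by (simp_all add: embed_mult[symmetric] A hc)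
  define F where "F x n = E (alt_elem x n)" for x n
  have F: "F Wm n = E (free_gen (AltW (- int n)))" "F Wp n = E (free_gen (AltW (int n + 1)))"
    "F Gk (Suc n) = E (free_gen (AltG n))" "F Gtk (Suc n) = E (free_gen (AltGt n))"
    "F Gk 0 = ualg_embed A \<one>\<^bsub>A\<^esub>" "F Gtk 0 = ualg_embed A \<one>\<^bsub>A\<^esub>" for n
    by (simp_all add: F_def Es)
  \<comment> \<open>the linear relations and, below, the quadratic ones, in the form in which the presentation states them\<close>
  define lin where "lin k \<longleftrightarrow>
      F Wm 0 * F Wp k - F Wp k * F Wm 0 = uscale (1 - inverse (q ^ 2)) (F Gtk (Suc k) - F Gk (Suc k)) \<and>
      F Wm k * F Wp 0 - F Wp 0 * F Wm k = uscale (1 - inverse (q ^ 2)) (F Gtk (Suc k) - F Gk (Suc k)) \<and>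
      uscale q (F Wm 0 * F Gk (Suc k)) - uscale (inverse q) (F Gk (Suc k) * F Wm 0) = uscale (q - inverse q) (F Wm (Suc k)) \<and>
      uscale q (F Gtk (Suc k) * F Wm 0) - uscale (inverse q) (F Wm 0 * F Gtk (Suc k)) = uscale (q - inverse q) (F Wm (Suc k)) \<and>
      uscale q (F Gk (Suc k) * F Wp 0) - uscale (inverse q) (F Wp 0 * F Gk (Suc k)) = uscale (q - inverse q) (F Wp (Suc k)) \<and>
      uscale q (F Wp 0 * F Gtk (Suc k)) - uscale (inverse q) (F Gtk (Suc k) * F Wp 0) = uscale (q - inverse q) (F Wp (Suc k))"
    for k
  define comm where "comm x m y n = F x m * F y n - F y n * F x m" for x m y n
  define quad where "quad k l \<longleftrightarrow>
      comm Wm k Wm l = 0 \<and> comm Wp k Wp l = 0 \<and>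
      comm Wm k Wp l + comm Wp k Wm l = 0 \<and>
      comm Wm k Gk (Suc l) + comm Gk (Suc k) Wm l = 0 \<and>
      comm Wm k Gtk (Suc l) + comm Gtk (Suc k) Wm l = 0 \<and>
      comm Wp k Gk (Suc l) + comm Gk (Suc k) Wp l = 0 \<and>
      comm Wp k Gtk (Suc l) + comm Gtk (Suc k) Wp l = 0 \<and>
      comm Gk (Suc k) Gk (Suc l) = 0 \<and> comm Gtk (Suc k) Gtk (Suc l) = 0 \<and>
      comm Gtk (Suc k) Gk (Suc l) + comm Gk (Suc k) Gtk (Suc l) = 0" for k l
  have 1: "(\<forall>(l, r) \<in> alt_relations q. h l = h r) \<longleftrightarrow> (\<forall>k. lin k) \<and> (\<forall>k l. quad k l)"
    by (simp add: alt_relations_def Let_def ball_Un commutator_def q_commutator_def E Es lin_def quad_def comm_def F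
        add.commute[of 1])
  have comm0: "comm x m y 0 = 0" "comm y 0 x m = 0" if "y \<in> {Gk, Gtk}" for x m y
    using that by (auto simp: comm_def F(5,6) unit F_def[of x m])
  have unit_F: "ualg_embed A \<one>\<^bsub>A\<^esub> * F x n = F x n" "F x n * ualg_embed A \<one>\<^bsub>A\<^esub> = F x n" for x n
    by (simp_all add: F_def unit)
  have 2: "(\<forall>k. lin k) \<and> (\<forall>k l. quad k l) \<longleftrightarrow> alternating uscale (ualg_embed A \<one>\<^bsub>A\<^esub>) q F"
  proof
    assume "(\<forall>k. lin k) \<and> (\<forall>k l. quad k l)"
    then have lin: "lin k" and quad: "quad k l" for k l by auto
    show "alternating uscale (ualg_embed A \<one>\<^bsub>A\<^esub>) q F"
    proof (unfold_locales, goal_cases)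
      case (5 n) show ?case using lin[of n] by (simp add: lin_def)
    next
      case (6 n) show ?case using lin[of n] by (simp add: lin_def)
    next
      case (7 n) show ?case
        using lin by (cases n) (simp_all add: lin_def F(5,6) unit_F ualg.scale_left_diff_distrib)
    next
      case (8 n) show ?case
        using lin by (cases n) (simp_all add: lin_def F(5,6) unit_F ualg.scale_left_diff_distrib)
    next
      case (9 n) show ?case
        using lin by (cases n) (simp_all add: lin_def F(5,6) unit_F ualg.scale_left_diff_distrib)
    next
      case (10 n) show ?case
        using lin by (cases n) (simp_all add: lin_def F(5,6) unit_F ualg.scale_left_diff_distrib)
    next
      case (11 x m n)
      have "comm x m x n = 0"
        using quad by (cases x; cases m; cases n) (simp_all add: quad_def comm0)
      then show ?case by (simp add: comm_def)
    next
      case (12 m n) show ?case using quad[of m n] by (simp add: quad_def comm_def)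
    next
      case (13 m n)
      have "comm Gtk m Gk n + comm Gk m Gtk n = 0"
        using quad by (cases m; cases n) (simp_all add: quad_def comm0)
      then show ?case by (simp add: comm_def)
    next
      case (14 x y m n)
      then have "comm x m y (Suc n) + comm y (Suc m) x n = 0"
        using quad[of m n] by (auto simp: quad_def)
      then show ?case by (simp add: comm_def)
    qed (simp_all add: F(5,6) unit_F)
  next
    assume "alternating uscale (ualg_embed A \<one>\<^bsub>A\<^esub>) q F"
    then interpret a: alternating uscale "ualg_embed A \<one>\<^bsub>A\<^esub>" q F .
    have "lin k" for k
      unfolding lin_def using a.W0_Wp a.Wm_W1 a.W0_G a.Gt_W0 a.G_W1 a.W1_Gt by simp
    moreover have "quad k l" for k l
      unfolding quad_def comm_def using a.W_G a.Wm_Wp a.Gt_G by (simp add: a.same_commute[of _ k l] a.same_commute[of _ "Suc k" "Suc l"])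
    ultimately show "(\<forall>k. lin k) \<and> (\<forall>k l. quad k l)" by blast
  qed
  have "(\<forall>(l, r) \<in> alt_relations q. h l = h r) \<longleftrightarrow> alternating uscale (ualg_embed A \<one>\<^bsub>A\<^esub>) q (\<lambda>x n. E (alt_elem x n))"
    using 1 2 by (simp add: F_def[abs_def])
  then show ?thesis
    by (simp add: alternating_family_def hc E_def)
qed

section \<open>Convolutions and central scaling in an algebra on a carrier set\<close>

lemma powi_split:
  assumes "(q::'a::field) \<noteq> 0" "k \<le> n"
  shows "q powi (int n - 2 * int k) = inverse q ^ k * q ^ (n - k)"
proof -
  have "int n - 2 * int k = int (n - k) - int k" using assms(2) by simp
  then have "q powi (int n - 2 * int k) = q powi (int (n - k)) / q powi (int k)"
    using power_int_diff[of q "int (n - k)" "int k"] assms(1) by metis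
  then show ?thesis
    by (simp only: power_int_of_nat) (simp add: divide_inverse power_inverse mult.commute)
qed

definition family_Z :: "('a::field, 'b) module \<Rightarrow> 'a \<Rightarrow> (kind \<Rightarrow> nat \<Rightarrow> 'b) \<Rightarrow> nat \<Rightarrow> 'b" where
  "family_Z A q f n =
     (\<Oplus>\<^bsub>A\<^esub> k \<in> {0..n}. (q powi (int n - 2 * int k)) \<odot>\<^bsub>A\<^esub> (f Gk k \<otimes>\<^bsub>A\<^esub> f Gtk (n - k)))
     \<ominus>\<^bsub>A\<^esub> q \<odot>\<^bsub>A\<^esub> (\<Oplus>\<^bsub>A\<^esub> k \<in> {0..<n}.
        (q powi (int n - 1 - 2 * int k)) \<odot>\<^bsub>A\<^esub> (f Wm k \<otimes>\<^bsub>A\<^esub> f Wp (n - 1 - k)))"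

text \<open>
  The coefficients of \<open>z(t/q) z(qt)\<close>.
\<close>
definition qconv :: "('a::field, 'b) module \<Rightarrow> 'a \<Rightarrow> (nat \<Rightarrow> 'b) \<Rightarrow> nat \<Rightarrow> 'b" where
  "qconv A q z n = (\<Oplus>\<^bsub>A\<^esub> k \<in> {0..n}. (q powi (int n - 2 * int k)) \<odot>\<^bsub>A\<^esub> (z k \<otimes>\<^bsub>A\<^esub> z (n - k)))"

text \<open>
  The coefficients of \<open>x(t) z(t)\<close>.
\<close>
definition conv :: "('a::field, 'b) module \<Rightarrow> (nat \<Rightarrow> 'b) \<Rightarrow> (nat \<Rightarrow> 'b) \<Rightarrow> nat \<Rightarrow> 'b" where
  "conv A x z n = (\<Oplus>\<^bsub>A\<^esub> k \<in> {0..n}. x k \<otimes>\<^bsub>A\<^esub> z (n - k))"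

lemma family_Z_eq:
  assumes A: "assoc_algebra A" and f: "alternating_family A q f" and q: "q \<noteq> 0"
  shows "family_Z A q f n = ualg_proj A (alternating.Z uscale q (\<lambda>x n. ualg_embed A (f x n)) $ n)"
proof -
  interpret A: assoc_algebra A by (rule A)
  have fc: "f x n \<in> carrier A" for x n using f by (simp add: alternating_family_def)
  interpret a: alternating uscale "ualg_embed A \<one>\<^bsub>A\<^esub>" q "\<lambda>x n. ualg_embed A (f x n)"
    using f by (simp add: alternating_family_def)
  show ?thesis
  proof (cases n)
    case 0
    then show ?thesis
      by (simp add: family_Z_def a.Z_nth proj_simps proj_uscale A fc a_minus_def del: a.Z_0 a.G_0 a.Gt_0) 
  next
    case (Suc m)
    have 1: "ualg_proj A (\<Sum>i=0..n. uscale (inverse q ^ i * q ^ (n - i)) (ualg_embed A (f Gk i) * ualg_embed A (f Gtk (n - i))))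
      = (\<Oplus>\<^bsub>A\<^esub> k \<in> {0..n}. (q powi (int n - 2 * int k)) \<odot>\<^bsub>A\<^esub> (f Gk k \<otimes>\<^bsub>A\<^esub> f Gtk (n - k)))"
      by (subst proj_sum[OF A]) (auto simp: proj_simps proj_uscale A fc powi_split q intro!: A.finsum_cong')
    have 2: "ualg_proj A (\<Sum>i=0..m. uscale (inverse q ^ i * q ^ (m - i)) (ualg_embed A (f Wm i) * ualg_embed A (f Wp (m - i))))
      = (\<Oplus>\<^bsub>A\<^esub> k \<in> {0..<n}. (q powi (int n - 1 - 2 * int k)) \<odot>\<^bsub>A\<^esub> (f Wm k \<otimes>\<^bsub>A\<^esub> f Wp (n - 1 - k)))"
      unfolding Suc atLeastLessThanSuc_atLeastAtMost
      by (subst proj_sum[OF A]) (auto simp: proj_simps proj_uscale A fc powi_split q intro!: A.finsum_cong')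
    show ?thesis
      unfolding family_Z_def a.Z_nth 1[symmetric] 2[symmetric] using Suc
      by (simp add: proj_simps proj_uscale A del: sum.cl_ivl_Suc)
  qed
qed

lemma qconv_eq:
  assumes A: "assoc_algebra A" and z: "\<And>n. z n \<in> carrier A" and q: "q \<noteq> 0"
  shows "qconv A q z n = ualg_proj A ((ualg.twist (inverse q) (Abs_fps (\<lambda>n. ualg_embed A (z n)))
    * ualg.twist q (Abs_fps (\<lambda>n. ualg_embed A (z n)))) $ n)"
proof -
  interpret A: assoc_algebra A by (rule A)
  show ?thesis
    unfolding qconv_def fps_mult_nth
    by (subst proj_sum[OF A]) (auto simp: proj_simps proj_uscale A z powi_split q mult.commute[of "q ^ _"] intro!: A.finsum_cong')
qed

lemma conv_eq:
  assumes A: "assoc_algebra A" and x: "\<And>n. x n \<in> carrier A" and z: "\<And>n. z n \<in> carrier A"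
  shows "conv A x z n = ualg_proj A ((Abs_fps (\<lambda>n. ualg_embed A (x n)) * Abs_fps (\<lambda>n. ualg_embed A (z n))) $ n)"
proof -
  interpret A: assoc_algebra A by (rule A)
  show ?thesis
    unfolding conv_def fps_mult_nth
    by (subst proj_sum[OF A]) (auto simp: proj_simps A x z intro!: A.finsum_cong')
qed

lemma
  assumes A: "assoc_algebra A" and C: "assoc_algebra C" and j: "j \<in> alg_hom A C"
  shows alg_hom_family_Z: "(\<And>x n. f x n \<in> carrier A) \<Longrightarrow> j (family_Z A q f n) = family_Z C q (\<lambda>x n. j (f x n)) n"
    and alg_hom_qconv: "(\<And>n. z n \<in> carrier A) \<Longrightarrow> j (qconv A q z n) = qconv C q (\<lambda>n. j (z n)) n"
    and alg_hom_conv: "(\<And>n. y n \<in> carrier A) \<Longrightarrow> (\<And>n. z n \<in> carrier A) \<Longrightarrow> j (conv A y z n) = conv C (\<lambda>n. j (y n)) (\<lambda>n. j (z n)) n"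
proof -
  interpret A: assoc_algebra A by (rule A)
  interpret C: assoc_algebra C by (rule C)
  note js = alg_hom_finsum[OF j A C] alg_hom_smult[OF j] alg_hom_mult[OF j] alg_hom_minus[OF j A C]
    alg_hom_closed[OF j]
  show "j (family_Z A q f n) = family_Z C q (\<lambda>x n. j (f x n)) n" if "\<And>x n. f x n \<in> carrier A"
    using that by (simp add: family_Z_def js A.finsum_closed Pi_iff)
  show "j (qconv A q z n) = qconv C q (\<lambda>n. j (z n)) n" if "\<And>n. z n \<in> carrier A"
    using that by (simp add: qconv_def js A.finsum_closed Pi_iff)
  show "j (conv A y z n) = conv C (\<lambda>n. j (y n)) (\<lambda>n. j (z n)) n" if "\<And>n. y n \<in> carrier A" "\<And>n. z n \<in> carrier A"
    using that by (simp add: conv_def js A.finsum_closed Pi_iff)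
qed

text \<open>
  Up to the constant terms \<open>G\<^sub>0 = 1\<close>, a family is a choice of images for the free generators.
\<close>
lemma free_family_lift:
  assumes A: "assoc_algebra A" and f: "\<And>x n. f x n \<in> carrier A" and "f Gk 0 = \<one>\<^bsub>A\<^esub>" "f Gtk 0 = \<one>\<^bsub>A\<^esub>"
  obtains h where "h \<in> alg_hom free_algebra A" "\<And>x n. h (alt_elem x n) = f x n"
proof -
  define g where "g a = (case a of AltW i \<Rightarrow> if i \<le> 0 then f Wm (nat (- i)) else f Wp (nat (i - 1))
    | AltG n \<Rightarrow> f Gk (Suc n) | AltGt n \<Rightarrow> f Gtk (Suc n))" for a
  obtain h where h: "h \<in> alg_hom free_algebra A" "\<And>a. h (free_gen a) = g a"
    by (rule free_algebra_lift[OF A, of g]) (auto simp: g_def f split: alt_gen.split)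
  have "h (alt_elem x n) = f x n" for x n
    by (cases "(x, n)" rule: alt_elem.cases) (simp_all add: h(2) g_def alg_hom_one[OF h(1)] assms)
  with h(1) show ?thesis by (rule that)
qed

lemma alternating_family_closed: "alternating_family A q f \<Longrightarrow> f x n \<in> carrier A"
  by (simp add: alternating_family_def)

lemma alternating_family_0:
  assumes A: "assoc_algebra A" and f: "alternating_family A q f"
  shows "f Gk 0 = \<one>\<^bsub>A\<^esub>" "f Gtk 0 = \<one>\<^bsub>A\<^esub>"
proof -
  interpret A: assoc_algebra A by (rule A)
  interpret a: alternating uscale "ualg_embed A \<one>\<^bsub>A\<^esub>" q "\<lambda>x n. ualg_embed A (f x n)"
    using f by (simp add: alternating_family_def)
  show "f Gk 0 = \<one>\<^bsub>A\<^esub>" "f Gtk 0 = \<one>\<^bsub>A\<^esub>"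
    using a.G_0 a.Gt_0 alternating_family_closed[OF f] by (metis A.one_closed proj_embed[OF A])+
qed

lemma alternating_family_image:
  assumes A: "assoc_algebra A" and C: "assoc_algebra C" and j: "j \<in> alg_hom A C" and f: "alternating_family A q f"
  shows "alternating_family C q (\<lambda>x n. j (f x n))"
proof -
  obtain h where h: "h \<in> alg_hom free_algebra A" "\<And>x n. h (alt_elem x n) = f x n"
    by (rule free_family_lift[OF A, of f]) (use alternating_family_closed[OF f] alternating_family_0[OF A f] in auto)
  have jh: "(\<lambda>x. j (h x)) \<in> alg_hom free_algebra C"
    by (rule alg_homI) (simp_all add: alg_hom_closed[OF j] alg_hom_closed[OF h(1)] alg_hom_mult[OF j] alg_hom_mult[OF h(1)]
        alg_hom_add[OF j] alg_hom_add[OF h(1)] alg_hom_one[OF j] alg_hom_one[OF h(1)] alg_hom_smult[OF j] alg_hom_smult[OF h(1)])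
  show ?thesis
    using alternating_family_iff_relations[OF A h(1), of q] alternating_family_iff_relations[OF C jh, of q] f
    by (auto simp: h(2))
qed

text \<open>
  The homomorphism from the free algebra that is given by the family has its image in the subalgebra, and whether
  the relations hold depends only on this homomorphism.
\<close>
lemma alternating_family_subalgebra:
  assumes A: "assoc_algebra A" and f: "alternating_family A q f" and S: "S \<subseteq> carrier A"
    and fS: "\<And>x n. f x n \<in> carrier (gen_subalgebra A S)"
  shows "alternating_family (gen_subalgebra A S) q f"
proof -
  interpret A: assoc_algebra A by (rule A)
  have K: "assoc_algebra (gen_subalgebra A S)" by (rule A.gen_subalgebra_is_algebra[OF S])
  obtain h where h: "h \<in> alg_hom free_algebra (gen_subalgebra A S)" "\<And>x n. h (alt_elem x n) = f x n"
    by (rule free_family_lift[OF K, of f]) (use fS alternating_family_0[OF A f] in auto)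
  have h': "h \<in> alg_hom free_algebra A"
    using A.gen_subalgebra_subset[OF S] alg_hom_closed[OF h(1)] alg_hom_mult[OF h(1)] alg_hom_add[OF h(1)]
      alg_hom_one[OF h(1)] alg_hom_smult[OF h(1)]
    by (intro alg_homI) auto
  show ?thesis
    using alternating_family_iff_relations[OF A h', of q] alternating_family_iff_relations[OF K h(1), of q] f
    by (auto simp: h(2))
qed

text \<open>
  Rescaling a family with \<open>Z(t) = 1\<close>, on carrier sets.
\<close>
lemma central_scaling_family:
  assumes A: "assoc_algebra A" and f: "alternating_family A q f" and q: "q \<noteq> 0"
    and z: "\<And>n. z n \<in> carrier A" and z0: "z 0 = \<one>\<^bsub>A\<^esub>"
    and zf: "\<And>m x n. z m \<otimes>\<^bsub>A\<^esub> f x n = f x n \<otimes>\<^bsub>A\<^esub> z m"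
    and zz: "\<And>m n. z m \<otimes>\<^bsub>A\<^esub> z n = z n \<otimes>\<^bsub>A\<^esub> z m"
    and Z: "\<And>n. family_Z A q f n = (if n = 0 then \<one>\<^bsub>A\<^esub> else \<zero>\<^bsub>A\<^esub>)"
  shows "alternating_family A q (\<lambda>x. conv A (f x) z)"
    and "family_Z A q (\<lambda>x. conv A (f x) z) n = qconv A q z n"
proof -
  interpret A: assoc_algebra A by (rule A)
  note fc = alternating_family_closed[OF f]
  interpret S: central_scaling uscale "ualg_embed A \<one>\<^bsub>A\<^esub>" q "\<lambda>x n. ualg_embed A (f x n)" "\<lambda>n. ualg_embed A (z n)"
    using f z z0 zf zz
    by (intro central_scaling.intro central_scaling_axioms.intro)
      (simp_all add: alternating_family_def embed_mult[symmetric] A)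
  interpret SS: alternating uscale "ualg_embed A \<one>\<^bsub>A\<^esub>" q S.scaled by (rule S.scaled_alternating)
  have conv: "conv A (f x) z n = ualg_proj A (S.scaled x n)" for x n
    by (simp add: conv_eq[OF A fc z] S.scaled_def)
  have emb: "ualg_embed A (conv A (f x) z n) = S.scaled x n" for x n
    unfolding conv embed_proj[OF A] by simp
  show alt: "alternating_family A q (\<lambda>x. conv A (f x) z)"
    using S.scaled_alternating
    by (simp add: alternating_family_def emb) (simp add: conv proj_closed A)
  have "S.Z $ n = ualg_embed A (ualg_proj A (S.Z $ n))" for n
    by (simp add: embed_proj[OF A] S.Z_unit)
  then have SZ: "S.Z = fps_const (ualg_embed A \<one>\<^bsub>A\<^esub>)"
    using Z unfolding family_Z_eq[OF A f q] by (intro fps_ext) (simp add: embed_zero[OF A])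
  have "fps_const (ualg_embed A \<one>\<^bsub>A\<^esub>) * (ualg.twist (inverse q) S.zser * ualg.twist q S.zser) = ualg.twist (inverse q) S.zser * ualg.twist q S.zser"
  proof -
    have "fps_const (ualg_embed A \<one>\<^bsub>A\<^esub>) * ualg.twist c S.zser = ualg.twist c S.zser" for c
      by (rule fps_ext) simp
    then show ?thesis by (simp only: mult.assoc[symmetric])
  qed
  then have "SS.Z $ n = (ualg.twist (inverse q) S.zser * ualg.twist q S.zser) $ n"
    by (simp add: S.Z_scaled SZ)
  then show "family_Z A q (\<lambda>x. conv A (f x) z) n = qconv A q z n"
    by (simp add: family_Z_eq[OF A alt q] emb qconv_eq[OF A z q])
qed

section \<open>The algebra with alternating generators\<close>

definition Uq_family :: "'a::field \<Rightarrow> kind \<Rightarrow> nat \<Rightarrow> 'a Uq_elem" where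
  "Uq_family q x n = relation_ideal (alt_relations q)
     +>\<^bsub>(free_algebra :: ('a, alt_gen list \<Rightarrow>\<^sub>0 'a) module)\<^esub> alt_elem x n"

lemma Uq_is_algebra: "assoc_algebra (Uq q)"
  unfolding Uq_def by (rule presented_is_algebra)

lemma Uq_quotient_hom:
  "(\<lambda>x. relation_ideal (alt_relations q) +>\<^bsub>free_algebra\<^esub> x) \<in> alg_hom free_algebra (Uq q)"
  unfolding Uq_def by (rule alg_quot_hom[OF free_algebra_is_algebra relation_ideal_ideal])

lemma Uq_family_simps:
  "Uq_family q Wm n = Uq_W q (- int n)" "Uq_family q Wp n = Uq_W q (int n + 1)"
  "Uq_family q Gk n = Uq_G q n" "Uq_family q Gtk n = Uq_Gt q n"
  using alg_hom_one[OF Uq_quotient_hom[of q]]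
  by (simp_all add: Uq_family_def Uq_W_def Uq_G_def Uq_Gt_def Uq_gen_def split: nat.split)

lemma Uq_family_alternating: "alternating_family (Uq q) q (Uq_family q)"
  using alternating_family_iff_relations[OF Uq_is_algebra Uq_quotient_hom, of q q] presented_relation
  by (auto simp: Uq_family_def[abs_def])

lemma Uq_family_closed: "Uq_family q x n \<in> carrier (Uq q)"
  by (rule alternating_family_closed[OF Uq_family_alternating])

lemma Z_vee_eq: "Z_vee q n = family_Z (Uq q) q (Uq_family q) n"
proof -
  interpret U: assoc_algebra "Uq q" by (rule Uq_is_algebra)
  have "(\<Oplus>\<^bsub>Uq q\<^esub> k \<in> {0..<n}. (q powi (int n - 1 - 2 * int k)) \<odot>\<^bsub>Uq q\<^esub>
      (Uq_W q (- int k) \<otimes>\<^bsub>Uq q\<^esub> Uq_W q (int n - int k)))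
    = (\<Oplus>\<^bsub>Uq q\<^esub> k \<in> {0..<n}. (q powi (int n - 1 - 2 * int k)) \<odot>\<^bsub>Uq q\<^esub>
      (Uq_W q (- int k) \<otimes>\<^bsub>Uq q\<^esub> Uq_W q (int (n - 1 - k) + 1)))"
  proof (rule U.finsum_cong')
    fix k assume "k \<in> {0..<n}"
    then have "int n - int k = int (n - 1 - k) + 1" by simp
    then show "(q powi (int n - 1 - 2 * int k)) \<odot>\<^bsub>Uq q\<^esub> (Uq_W q (- int k) \<otimes>\<^bsub>Uq q\<^esub> Uq_W q (int n - int k))
      = (q powi (int n - 1 - 2 * int k)) \<odot>\<^bsub>Uq q\<^esub> (Uq_W q (- int k) \<otimes>\<^bsub>Uq q\<^esub> Uq_W q (int (n - 1 - k) + 1))"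
      by (simp only:)
  qed (use Uq_family_closed[of q Wm] Uq_family_closed[of q Wp] in \<open>auto simp: Uq_family_simps\<close>)
  then show ?thesis
    unfolding Z_vee_def family_Z_def Uq_family_simps by (simp only:)
qed

lemma Z_vee_closed: "Z_vee q n \<in> carrier (Uq q)"
proof -
  interpret U: assoc_algebra "Uq q" by (rule Uq_is_algebra)
  show ?thesis
    unfolding Z_vee_eq family_Z_def
    by (intro U.minus_closed U.finsum_closed U.smult_closed U.m_closed Pi_I Uq_family_closed)
qed

lemma Uq_lift:
  assumes A: "assoc_algebra A" and f: "alternating_family A q f"
  obtains \<Phi> where "\<Phi> \<in> alg_hom (Uq q) A" "\<And>x n. \<Phi> (Uq_family q x n) = f x n"
proof -
  obtain h where h: "h \<in> alg_hom free_algebra A" "\<And>x n. h (alt_elem x n) = f x n"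
    by (rule free_family_lift[OF A, of f]) (use alternating_family_closed[OF f] alternating_family_0[OF A f] in auto)
  have "h l = h r" if "(l, r) \<in> alt_relations q" for l r
    using alternating_family_iff_relations[OF A h(1), of q] f that by (auto simp: h(2))
  from presented_lift[OF A h(1) this] obtain \<Phi> where "\<Phi> \<in> alg_hom (Uq q) A"
    "\<And>x. \<Phi> (relation_ideal (alt_relations q) +>\<^bsub>free_algebra\<^esub> x) = h x"
    unfolding Uq_def by blast
  with h(2) show ?thesis by (intro that) (auto simp: Uq_family_def)
qed

lemma Uq_generated:
  assumes K: "K \<in> subalgebras (Uq q)" and gen: "\<And>x n. Uq_family q x n \<in> K"
  shows "carrier (Uq q) \<subseteq> K"
  unfolding Uq_def
proof (rule presented_generated[OF K[unfolded Uq_def]])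
  fix g
  have "Uq_gen q g \<in> K"
  proof (cases g)
    case (AltW i)
    show ?thesis
    proof (cases "i \<le> 0")
      case True
      then show ?thesis using gen[of Wm "nat (- i)"] AltW by (simp add: Uq_family_simps Uq_W_def)
    next
      case False
      then show ?thesis using gen[of Wp "nat (i - 1)"] AltW by (simp add: Uq_family_simps Uq_W_def)
    qed
  next
    case (AltG n)
    then show ?thesis using gen[of Gk "Suc n"] by (simp add: Uq_family_simps Uq_G_def)
  next
    case (AltGt n)
    then show ?thesis using gen[of Gtk "Suc n"] by (simp add: Uq_family_simps Uq_Gt_def)
  qed
  then show "relation_ideal (alt_relations q) +>\<^bsub>free_algebra\<^esub> free_gen g \<in> K"
    by (simp add: Uq_gen_def)
qed

context
  fixes q :: "'a::field"
  assumes q0: "q \<noteq> 0" and nonroot: "\<And>m::nat. m \<ge> 1 \<Longrightarrow> q ^ m \<noteq> 1"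
begin

interpretation U: assoc_algebra "Uq q" by (rule Uq_is_algebra)

interpretation N: alternating_nonroot uscale "ualg_embed (Uq q) \<one>\<^bsub>Uq q\<^esub>" q "\<lambda>x n. ualg_embed (Uq q) (Uq_family q x n)"
  by (intro alternating_nonroot.intro alternating_nonroot_axioms.intro q0 nonroot)
    (use Uq_family_alternating[of q] in \<open>simp add: alternating_family_def\<close>)

lemma proj_Z: "ualg_proj (Uq q) (N.Z $ n) = Z_vee q n"
  by (simp add: Z_vee_eq family_Z_eq[OF Uq_is_algebra Uq_family_alternating q0])

lemma embed_Z_vee: "ualg_embed (Uq q) (Z_vee q n) = N.Z $ n"
  by (simp only: proj_Z[symmetric] embed_proj[OF Uq_is_algebra] N.Z_unit)

lemma Z_vee_0: "Z_vee q 0 = \<one>\<^bsub>Uq q\<^esub>"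
  using proj_Z[of 0] by (simp add: Uq_is_algebra)

lemma Z_generators_closed: "{Z_vee q n | n. n \<ge> 1} \<subseteq> carrier (Uq q)"
  using Z_vee_closed by auto

lemma W_generators_closed: "{Uq_W q 0, Uq_W q 1} \<subseteq> carrier (Uq q)"
  using Uq_family_closed[of q Wm 0] Uq_family_closed[of q Wp 0] by (simp add: Uq_family_simps)

lemma W01_algebra: "assoc_algebra (W01_subalgebra q)"
  unfolding W01_subalgebra_def by (rule U.gen_subalgebra_is_algebra[OF W_generators_closed])

lemma Z_algebra: "assoc_algebra (Z_subalgebra q)"
  unfolding Z_subalgebra_def by (rule U.gen_subalgebra_is_algebra[OF Z_generators_closed])

lemma W01_subset: "w \<in> carrier (W01_subalgebra q) \<Longrightarrow> w \<in> carrier (Uq q)"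
  unfolding W01_subalgebra_def using U.gen_subalgebra_subset[OF W_generators_closed] by auto

lemma Z_subset: "z \<in> carrier (Z_subalgebra q) \<Longrightarrow> z \<in> carrier (Uq q)"
  unfolding Z_subalgebra_def using U.gen_subalgebra_subset[OF Z_generators_closed] by auto

lemma centralizer_subalgebra:
  assumes "u \<in> carrier (Uq q)"
  shows "{z \<in> carrier (Uq q). z \<otimes>\<^bsub>Uq q\<^esub> u = u \<otimes>\<^bsub>Uq q\<^esub> z} \<in> subalgebras (Uq q)"
proof (rule U.subalgebrasI)
  fix x y assume "x \<in> {z \<in> carrier (Uq q). z \<otimes>\<^bsub>Uq q\<^esub> u = u \<otimes>\<^bsub>Uq q\<^esub> z}" "y \<in> {z \<in> carrier (Uq q). z \<otimes>\<^bsub>Uq q\<^esub> u = u \<otimes>\<^bsub>Uq q\<^esub> z}"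
  then show "x \<otimes>\<^bsub>Uq q\<^esub> y \<in> {z \<in> carrier (Uq q). z \<otimes>\<^bsub>Uq q\<^esub> u = u \<otimes>\<^bsub>Uq q\<^esub> z}"
    using assms by simp (metis U.m_assoc)
qed (use assms in \<open>auto simp: U.l_distr U.r_distr U.mult_smult_left U.mult_smult_right\<close>)

text \<open>
  Centralizers are subalgebras, so both sides reduce to generators.
\<close>
lemma Z_subalgebra_central:
  assumes z: "z \<in> carrier (Z_subalgebra q)" and u: "u \<in> carrier (Uq q)"
  shows "z \<otimes>\<^bsub>Uq q\<^esub> u = u \<otimes>\<^bsub>Uq q\<^esub> z"
proof -
  have gens: "Z_vee q k \<otimes>\<^bsub>Uq q\<^esub> Uq_family q x n = Uq_family q x n \<otimes>\<^bsub>Uq q\<^esub> Z_vee q k" for k x n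
  proof -
    have "ualg_embed (Uq q) (Z_vee q k \<otimes>\<^bsub>Uq q\<^esub> Uq_family q x n) = ualg_embed (Uq q) (Uq_family q x n \<otimes>\<^bsub>Uq q\<^esub> Z_vee q k)"
      using N.Z_central[of k x n]
      by (simp add: embed_mult[OF Uq_is_algebra] Uq_family_closed Z_vee_closed embed_Z_vee)
    then show ?thesis
      by (simp add: embed_inject[OF Uq_is_algebra] Uq_family_closed Z_vee_closed)
  qed
  have "z \<otimes>\<^bsub>Uq q\<^esub> Uq_family q x n = Uq_family q x n \<otimes>\<^bsub>Uq q\<^esub> z" for x n
    using z gen_subalgebra_minimal[OF centralizer_subalgebra[OF Uq_family_closed[of q x n]], of "{Z_vee q n | n. n \<ge> 1}"]
      gens Z_vee_closed
    unfolding Z_subalgebra_def by blast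
  then have "carrier (Uq q) \<subseteq> {u \<in> carrier (Uq q). u \<otimes>\<^bsub>Uq q\<^esub> z = z \<otimes>\<^bsub>Uq q\<^esub> u}"
    using Uq_family_closed by (intro Uq_generated centralizer_subalgebra Z_subset[OF z]) auto
  then show ?thesis using u by auto
qed

lemma closed_preimage: "K \<in> subalgebras (Uq q) \<Longrightarrow> N.is_subalg {u. ualg_proj (Uq q) u \<in> K}"
  unfolding N.is_subalg_def subalgebras_def
  by (auto simp: Uq_is_algebra proj_simps proj_uscale subringE(3,6,7))

text \<open>
  The factorization on carrier sets. Elements of the big ring are recovered from their components because they are
  fixed by the unit of the corner.
\<close>
lemma Uq_factorization:
  obtains f' \<zeta> where
    "alternating_family (Uq q) q f'"
    "\<And>x n. f' x n \<in> carrier (W01_subalgebra q)"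
    "\<And>n. \<zeta> n \<in> carrier (Z_subalgebra q)"
    "\<zeta> 0 = \<one>\<^bsub>Uq q\<^esub>"
    "\<And>x n. Uq_family q x n = conv (Uq q) (f' x) \<zeta> n"
    "\<And>n. family_Z (Uq q) q f' n = (if n = 0 then \<one>\<^bsub>Uq q\<^esub> else \<zero>\<^bsub>Uq q\<^esub>)"
    "\<And>n. Z_vee q n = qconv (Uq q) q \<zeta> n"
proof -
  obtain F Y where F: "alternating uscale (ualg_embed (Uq q) \<one>\<^bsub>Uq q\<^esub>) q F"
    and prod: "\<And>x n. ualg_embed (Uq q) (Uq_family q x n) = (Abs_fps (F x) * Abs_fps Y) $ n"
    and ZF: "alternating.Z uscale q F = fps_const (ualg_embed (Uq q) \<one>\<^bsub>Uq q\<^esub>)"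
    and ZY: "N.Z = ualg.twist (inverse q) (Abs_fps Y) * ualg.twist q (Abs_fps Y)"
    and YK: "\<And>K n. N.is_subalg K \<Longrightarrow> (\<And>k. N.Z $ k \<in> K) \<Longrightarrow> Y n \<in> K"
    and FK: "\<And>K x n. N.is_subalg K \<Longrightarrow> ualg_embed (Uq q) (Uq_family q Wm 0) \<in> K \<Longrightarrow>
      ualg_embed (Uq q) (Uq_family q Wp 0) \<in> K \<Longrightarrow> F x n \<in> K"
    and Y0: "Y 0 = ualg_embed (Uq q) \<one>\<^bsub>Uq q\<^esub>"
    by (rule N.factorization) blast
  interpret F: alternating uscale "ualg_embed (Uq q) \<one>\<^bsub>Uq q\<^esub>" q F by (rule F)
  define f' where "f' x n = ualg_proj (Uq q) (F x n)" for x n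
  define \<zeta> where "\<zeta> n = ualg_proj (Uq q) (Y n)" for n
  have eF: "ualg_embed (Uq q) (f' x n) = F x n" for x n
    unfolding f'_def embed_proj[OF Uq_is_algebra] by simp
  have "N.is_subalg {u. ualg_embed (Uq q) \<one>\<^bsub>Uq q\<^esub> * u = u}"
    by (auto simp: N.is_subalg_def distrib_left mult.assoc[symmetric])
  from YK[OF this] have eY: "ualg_embed (Uq q) (\<zeta> n) = Y n" for n
    unfolding \<zeta>_def embed_proj[OF Uq_is_algebra] by (simp add: N.Z_unit)
  have f'c: "f' x n \<in> carrier (Uq q)" and \<zeta>c: "\<zeta> n \<in> carrier (Uq q)" for x n
    unfolding f'_def \<zeta>_def by (simp_all add: proj_closed Uq_is_algebra)
  have alt: "alternating_family (Uq q) q f'"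
    using F by (simp add: alternating_family_def f'c eF)
  have W01: "carrier (W01_subalgebra q) \<in> subalgebras (Uq q)"
    unfolding W01_subalgebra_def by (rule U.gen_subalgebra_carrier_subalgebra[OF W_generators_closed])
  have Zs: "carrier (Z_subalgebra q) \<in> subalgebras (Uq q)"
    unfolding Z_subalgebra_def by (rule U.gen_subalgebra_carrier_subalgebra[OF Z_generators_closed])
  show ?thesis
  proof (rule that[of f' \<zeta>, OF alt])
    show "f' x n \<in> carrier (W01_subalgebra q)" for x n
      using FK[OF closed_preimage[OF W01], of x n] gen_subalgebra_self[of "{Uq_W q 0, Uq_W q 1}" "Uq q"]
      by (simp add: f'_def proj_embed Uq_is_algebra Uq_family_closed) (simp add: Uq_family_simps W01_subalgebra_def)
    have "Z_vee q n \<in> carrier (Z_subalgebra q)" for n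
    proof (cases "n = 0")
      case True
      then show ?thesis using Zs by (simp add: Z_vee_0 subalgebras_def subringE(3))
    next
      case False
      then have "Z_vee q n \<in> {Z_vee q n | n. n \<ge> 1}" by (intro CollectI exI[of _ n]) auto
      then show ?thesis
        using gen_subalgebra_self[of "{Z_vee q n | n. n \<ge> 1}" "Uq q"] unfolding Z_subalgebra_def by blast
    qed
    then show "\<zeta> n \<in> carrier (Z_subalgebra q)" for n
      using YK[OF closed_preimage[OF Zs], of n] by (simp add: \<zeta>_def proj_Z)
    show "\<zeta> 0 = \<one>\<^bsub>Uq q\<^esub>" by (simp add: \<zeta>_def Y0 Uq_is_algebra)
    show "Uq_family q x n = conv (Uq q) (f' x) \<zeta> n" for x n
      using prod[of x n] Uq_family_closed[of q x n]
      by (simp add: conv_eq[OF Uq_is_algebra f'c \<zeta>c] eF eY) (metis proj_embed[OF Uq_is_algebra])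
    show "family_Z (Uq q) q f' n = (if n = 0 then \<one>\<^bsub>Uq q\<^esub> else \<zero>\<^bsub>Uq q\<^esub>)" for n
      by (simp add: family_Z_eq[OF Uq_is_algebra alt q0] eF ZF Uq_is_algebra proj_simps)
    show "Z_vee q n = qconv (Uq q) q \<zeta> n" for n
      by (simp add: qconv_eq[OF Uq_is_algebra \<zeta>c q0] eY ZY[symmetric] proj_Z)
  qed
qed

section \<open>The multiplication map\<close>

text \<open>
  The map \<open>\<Phi>\<close> is the homomorphism that sends the generating series \<open>f(t)\<close> of each family to \<open>f'(t) \<otimes> \<zeta>(t)\<close>.
\<close>
lemma multiplication_alg_iso:
  "\<exists>\<mu> \<in> alg_iso (tensor_algebra (W01_subalgebra q) (Z_subalgebra q)) (Uq q).
     \<forall>w \<in> carrier (W01_subalgebra q). \<forall>z \<in> carrier (Z_subalgebra q).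
       \<mu> (pure_tensor (W01_subalgebra q) (Z_subalgebra q) w z) = w \<otimes>\<^bsub>Uq q\<^esub> z"
proof -
  let ?W = "W01_subalgebra q" and ?Z = "Z_subalgebra q"
  let ?T = "tensor_algebra ?W ?Z" and ?p = "pure_tensor ?W ?Z"
  interpret W: assoc_algebra ?W by (rule W01_algebra)
  interpret Z: assoc_algebra ?Z by (rule Z_algebra)
  interpret WZ: two_algebras ?W ?Z by unfold_locales
  have W_simps: "x \<otimes>\<^bsub>?W\<^esub> y = x \<otimes>\<^bsub>Uq q\<^esub> y" "x \<oplus>\<^bsub>?W\<^esub> y = x \<oplus>\<^bsub>Uq q\<^esub> y" "c \<odot>\<^bsub>?W\<^esub> x = c \<odot>\<^bsub>Uq q\<^esub> x"
    "\<one>\<^bsub>?W\<^esub> = \<one>\<^bsub>Uq q\<^esub>" "\<zero>\<^bsub>?W\<^esub> = \<zero>\<^bsub>Uq q\<^esub>" for x y c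
    by (simp_all add: W01_subalgebra_def)
  have Z_simps: "x \<otimes>\<^bsub>?Z\<^esub> y = x \<otimes>\<^bsub>Uq q\<^esub> y" "x \<oplus>\<^bsub>?Z\<^esub> y = x \<oplus>\<^bsub>Uq q\<^esub> y" "c \<odot>\<^bsub>?Z\<^esub> x = c \<odot>\<^bsub>Uq q\<^esub> x"
    "\<one>\<^bsub>?Z\<^esub> = \<one>\<^bsub>Uq q\<^esub>" "\<zero>\<^bsub>?Z\<^esub> = \<zero>\<^bsub>Uq q\<^esub>" for x y c
    by (simp_all add: Z_subalgebra_def)
  have incW: "(\<lambda>w. w) \<in> alg_hom ?W (Uq q)"
    by (rule alg_homI) (simp_all add: W_simps W01_subset)
  have incZ: "(\<lambda>z. z) \<in> alg_hom ?Z (Uq q)"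
    by (rule alg_homI) (simp_all add: Z_simps Z_subset)
  obtain \<mu> where \<mu>: "\<mu> \<in> alg_hom ?T (Uq q)"
    and \<mu>_pure: "\<And>w z. w \<in> carrier ?W \<Longrightarrow> z \<in> carrier ?Z \<Longrightarrow> \<mu> (?p w z) = w \<otimes>\<^bsub>Uq q\<^esub> z"
    using WZ.tensor_lift[OF Uq_is_algebra incW incZ] Z_subalgebra_central W01_subset by metis
  obtain f' \<zeta> where f': "alternating_family (Uq q) q f'"
    and f'W: "\<And>x n. f' x n \<in> carrier ?W"
    and \<zeta>Z: "\<And>n. \<zeta> n \<in> carrier ?Z"
    and \<zeta>0: "\<zeta> 0 = \<one>\<^bsub>Uq q\<^esub>"
    and fac: "\<And>x n. Uq_family q x n = conv (Uq q) (f' x) \<zeta> n"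
    and Zf': "\<And>n. family_Z (Uq q) q f' n = (if n = 0 then \<one>\<^bsub>Uq q\<^esub> else \<zero>\<^bsub>Uq q\<^esub>)"
    and Z\<zeta>: "\<And>n. Z_vee q n = qconv (Uq q) q \<zeta> n"
    by (rule Uq_factorization) blast
  have f'_W0: "f' x 0 = Uq_family q x 0" for x
    using fac[of x 0] W01_subset[OF f'W] by (simp add: conv_def \<zeta>0)
  have altW: "alternating_family ?W q f'"
    unfolding W01_subalgebra_def
    by (rule alternating_family_subalgebra[OF Uq_is_algebra f' W_generators_closed f'W[unfolded W01_subalgebra_def]])
  define F where "F x n = ?p (f' x n) \<one>\<^bsub>?Z\<^esub>" for x n
  define Y where "Y n = ?p \<one>\<^bsub>?W\<^esub> (\<zeta> n)" for n
  have Yc: "Y n \<in> carrier ?T" for n unfolding Y_def by (simp add: WZ.pure_closed \<zeta>Z)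
  have altF: "alternating_family ?T q F"
    unfolding F_def[abs_def] by (rule alternating_family_image[OF W01_algebra WZ.tensor_is_algebra WZ.left_hom altW])
  have ZF: "family_Z ?T q F n = (if n = 0 then \<one>\<^bsub>?T\<^esub> else \<zero>\<^bsub>?T\<^esub>)" for n
  proof -
    have "family_Z ?W q f' n = family_Z (Uq q) q f' n"
      using alg_hom_family_Z[OF W01_algebra Uq_is_algebra incW, of f'] f'W by simp
    then have "?p (family_Z (Uq q) q f' n) \<one>\<^bsub>?Z\<^esub> = family_Z ?T q F n"
      using alg_hom_family_Z[OF W01_algebra WZ.tensor_is_algebra WZ.left_hom, of f' q n] f'W
      by (simp add: F_def[abs_def])
    then show ?thesis
      using alg_hom_one[OF WZ.left_hom] alg_hom_zero[OF WZ.left_hom W01_algebra WZ.tensor_is_algebra]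
      by (simp add: Zf' W_simps split: if_splits)
  qed
  have comm: "Y m \<otimes>\<^bsub>?T\<^esub> F x n = F x n \<otimes>\<^bsub>?T\<^esub> Y m" "Y m \<otimes>\<^bsub>?T\<^esub> Y n = Y n \<otimes>\<^bsub>?T\<^esub> Y m" for x m n
    using Z_subalgebra_central[OF \<zeta>Z Z_subset[OF \<zeta>Z], of m n]
    by (simp_all add: F_def Y_def WZ.pure_mult f'W \<zeta>Z Z_simps(1)[of "\<zeta> m" "\<zeta> n"] Z_simps(1)[of "\<zeta> n" "\<zeta> m"])
  have Y0: "Y 0 = \<one>\<^bsub>?T\<^esub>" by (simp add: Y_def \<zeta>0 Z_simps(4)[symmetric] WZ.pure_one)
  \<comment> \<open>\<open>F\<close> has trivial \<open>Z\<close> series, so after scaling by \<open>Y\<close> that series is \<open>Y(t/q) Y(qt) = 1 \<otimes> Z(t)\<close>\<close>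
  note scaled = central_scaling_family[where f = F and z = Y, OF WZ.tensor_is_algebra altF q0 Yc Y0 comm ZF]
  obtain \<Phi> where \<Phi>: "\<Phi> \<in> alg_hom (Uq q) ?T" "\<And>x n. \<Phi> (Uq_family q x n) = conv ?T (F x) Y n"
    by (rule Uq_lift[OF WZ.tensor_is_algebra scaled(1)]) blast
  have \<Phi>_gen0: "\<Phi> (Uq_family q x 0) = ?p (Uq_family q x 0) \<one>\<^bsub>?Z\<^esub>" for x
    using alternating_family_closed[OF altF, of x 0] \<Phi>(2)[of x 0]
    by (simp add: conv_def Y0 F_def f'_W0)
  have \<Phi>_Z: "\<Phi> (Z_vee q n) = ?p \<one>\<^bsub>?W\<^esub> (Z_vee q n)" for n
  proof -
    have "\<Phi> (Z_vee q n) = qconv ?T q Y n"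
      unfolding Z_vee_eq using alg_hom_family_Z[OF Uq_is_algebra WZ.tensor_is_algebra \<Phi>(1), of "Uq_family q" q n]
      by (simp add: Uq_family_closed \<Phi>(2) scaled(2))
    also have "\<dots> = ?p \<one>\<^bsub>?W\<^esub> (qconv ?Z q \<zeta> n)"
      using alg_hom_qconv[OF Z_algebra WZ.tensor_is_algebra WZ.right_hom, of \<zeta> q n] \<zeta>Z
      by (simp add: Y_def[abs_def])
    also have "qconv ?Z q \<zeta> n = Z_vee q n"
      using alg_hom_qconv[OF Z_algebra Uq_is_algebra incZ, of \<zeta> q n] \<zeta>Z by (simp add: Z\<zeta>)
    finally show ?thesis .
  qed
  have \<Phi>W: "(\<lambda>w. \<Phi> w) \<in> alg_hom ?W ?T" and \<Phi>Z': "(\<lambda>w. \<Phi> w) \<in> alg_hom ?Z ?T"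
    by (rule alg_homI; simp add: W_simps Z_simps W01_subset Z_subset alg_hom_closed[OF \<Phi>(1)]
        alg_hom_mult[OF \<Phi>(1)] alg_hom_add[OF \<Phi>(1)] alg_hom_one[OF \<Phi>(1)] alg_hom_smult[OF \<Phi>(1)])+
  have \<Phi>_W: "\<Phi> w = ?p w \<one>\<^bsub>?Z\<^esub>" if "w \<in> carrier ?W" for w
  proof (rule gen_subalgebra_hom_eq[OF Uq_is_algebra W_generators_closed, folded W01_subalgebra_def, OF \<Phi>W WZ.left_hom _ that])
    show "\<Phi> x = ?p x \<one>\<^bsub>?Z\<^esub>" if "x \<in> {Uq_W q 0, Uq_W q 1}" for x
      using that \<Phi>_gen0[of Wm] \<Phi>_gen0[of Wp] by (auto simp: Uq_family_simps)
  qed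
  have \<Phi>_Zall: "\<Phi> z = ?p \<one>\<^bsub>?W\<^esub> z" if "z \<in> carrier ?Z" for z
  proof (rule gen_subalgebra_hom_eq[OF Uq_is_algebra Z_generators_closed, folded Z_subalgebra_def, OF \<Phi>Z' WZ.right_hom _ that])
    show "\<Phi> x = ?p \<one>\<^bsub>?W\<^esub> x" if "x \<in> {Z_vee q n |n. 1 \<le> n}" for x
      using that \<Phi>_Z by auto
  qed
  have left_inv: "\<Phi> (\<mu> t) = t" if "t \<in> carrier ?T" for t
  proof (rule WZ.tensor_hom_eq[OF WZ.tensor_is_algebra _ _ _ that])
    show "(\<lambda>t. \<Phi> (\<mu> t)) \<in> alg_hom ?T ?T"
      by (rule alg_homI) (simp_all add: alg_hom_closed[OF \<mu>] alg_hom_closed[OF \<Phi>(1)] alg_hom_mult[OF \<mu>] alg_hom_mult[OF \<Phi>(1)]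
        alg_hom_add[OF \<mu>] alg_hom_add[OF \<Phi>(1)] alg_hom_one[OF \<mu>] alg_hom_one[OF \<Phi>(1)] alg_hom_smult[OF \<mu>] alg_hom_smult[OF \<Phi>(1)])
    show "(\<lambda>t. t) \<in> alg_hom ?T ?T" by (rule alg_homI) simp_all
    fix w z assume wz: "w \<in> carrier ?W" "z \<in> carrier ?Z"
    then show "\<Phi> (\<mu> (?p w z)) = ?p w z"
      using WZ.pure_mult[of w "\<one>\<^bsub>?Z\<^esub>" "\<one>\<^bsub>?W\<^esub>" z]
      by (simp add: \<mu>_pure alg_hom_mult[OF \<Phi>(1)] W01_subset Z_subset \<Phi>_W \<Phi>_Zall)
  qed
  have "\<mu> ` carrier ?T \<in> subalgebras (Uq q)"
    by (rule alg_hom_image_subalgebra[OF WZ.tensor_is_algebra Uq_is_algebra \<mu>])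
  moreover have "Uq_family q x n \<in> \<mu> ` carrier ?T" for x n
  proof -
    have "\<mu> (conv ?T (F x) Y n) = conv (Uq q) (\<lambda>n. \<mu> (F x n)) (\<lambda>n. \<mu> (Y n)) n"
      using alternating_family_closed[OF altF] Yc by (intro alg_hom_conv[OF WZ.tensor_is_algebra Uq_is_algebra \<mu>])
    also have "\<dots> = Uq_family q x n"
    proof -
      have "\<mu> (F x n) = f' x n" for n
        using \<mu>_pure[OF f'W Z.one_closed, of x n] W01_subset[OF f'W] by (simp add: F_def Z_simps(4))
      moreover have "\<mu> (Y n) = \<zeta> n" for n
        using \<mu>_pure[OF W.one_closed \<zeta>Z, of n] Z_subset[OF \<zeta>Z] by (simp add: Y_def W_simps(4))
      ultimately show ?thesis by (simp add: fac)
    qed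
    finally show ?thesis
      using alternating_family_closed[OF scaled(1)] by (metis image_eqI)
  qed
  ultimately have surj: "carrier (Uq q) \<subseteq> \<mu> ` carrier ?T"
    by (rule Uq_generated)
  have "bij_betw \<mu> (carrier ?T) (carrier (Uq q))"
    unfolding bij_betw_def
  proof
    show "inj_on \<mu> (carrier ?T)" by (rule inj_on_inverseI) (rule left_inv)
    show "\<mu> ` carrier ?T = carrier (Uq q)"
      using surj alg_hom_closed[OF \<mu>] by (intro equalityI image_subsetI)
  qed
  then have "\<mu> \<in> alg_iso ?T (Uq q)"
    using \<mu> by (simp add: alg_iso_def alg_hom_def ring_iso_def)
  with \<mu>_pure show ?thesis by blast
qed

end

theorem proposition6p5:
  fixes q :: "'a::field"
  assumes "q \<noteq> 0"
    and "\<And>m::nat. m \<ge> 1 \<Longrightarrow> q ^ m \<noteq> 1"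
  shows "\<exists>\<mu> \<in> alg_iso (tensor_algebra (W01_subalgebra q) (Z_subalgebra q)) (Uq q).
           \<forall>w \<in> carrier (W01_subalgebra q). \<forall>z \<in> carrier (Z_subalgebra q).
             \<mu> (pure_tensor (W01_subalgebra q) (Z_subalgebra q) w z) = w \<otimes>\<^bsub>Uq q\<^esub> z"
  using multiplication_alg_iso[OF assms] .

end
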